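(* Let $N\ge1$, $\gamma>0$, let $m$ satisfy condition $(\mathcal H)$ and let $\alpha\in(1,2]$. Then the fundamental solution $Q_{\gamma,\alpha}(t,x)$ can be interpreted as the probability density function of a random process $Y_{\gamma,\alpha}(t)$; that is, for every $t>0$, $Q_{\gamma,\alpha}(t,\cdot)\ge0$ and $\int_{\mathbb R^N}Q_{\gamma,\alpha}(t,x)\,dx=1$. Moreover, the mean square displacement of $Y_{\gamma,2}$, namely $\mathrm{msd}_{\gamma,2}(t)=\int_{\mathbb R^N}|x|^2Q_{\gamma,2}(t,x)\,dx$, is $$\mathrm{msd}_{\gamma,2}(t)=2\big(t+\gamma(1*m)(t)\big)\quad\text{for }t>0.$$
   Context: Notation: $*$ is convolution in time, $(a*b)(t)=\int_0^t a(t-\tau)b(\tau)\,d\tau$, so $(1*a)(t)=\int_0^ta(\tau)\,d\tau$; $\mathbb R_+=[0,\infty)$. The Fourier transform is $\tilde f(\xi)=\int_{\mathbb R^N} e^{-ix\cdot\xi}f(x)\,dx$, and $(-\Delta)^{\alpha/2}$ is the Fourier multiplier with symbol $|\xi|^\alpha$. Put $m_\gamma(t)=1+\gamma m(t)$. Condition $(\mathcal H)$: $m\in L^1_{loc}(\mathbb R_+)$, and there exist a nonnegative and nonincreasing function $k_\gamma\in L^1_{loc}(\mathbb R_+)$ and $\beta_\gamma\ge0$ such that $\beta_\gamma m_\gamma(t)+(k_\gamma*m_\gamma)(t)=1$ for $t>0$. $Q_{\gamma,\alpha}$ is the fundamental solution of $\partial_tQ+(-\Delta)^{\alpha/2}Q+\gamma\,\partial_t(m*(-\Delta)^{\alpha/2}Q)=0$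 for $t>0$, $x\in\mathbb R^N$, with $Q|_{t=0}=\delta_0$ (the Dirac measure). It is given by $\tilde Q_{\gamma,\alpha}(t,\xi)=s_\gamma(t,|\xi|^\alpha)$, where for $\nu\ge0$ the function $s_\gamma(\cdot,\nu)$ is the unique solution of $s_\gamma(t,\nu)+\nu\,(m_\gamma*s_\gamma(\cdot,\nu))(t)=1$, $t\ge0$. Equivalently $Q_{\gamma,\alpha}(t,x)=-\int_0^\infty H_\alpha(\rho,x)\,w_\gamma(t,d\rho)$, where $\tilde H_\alpha(\rho,\xi)=e^{-\rho|\xi|^\alpha}$ and $-w_\gamma(t,d\rho)$ is the positive finite measure on $[0,\infty)$ with $s_\gamma(t,\nu)=-\int_0^\infty e^{-\rho\nu}w_\gamma(t,d\rho)$.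
   Formalization: The mean square displacement is stated as 2N(t+γ(1*m)(t)); the printed formula without the factor N is false for N≥2 (for m=0, Q is the heat kernel and the second moment is 2Nt) and agrees with it for N=1. *)

theory Defs
  imports "HOL-Probability.Probability"
begin

definition L1_loc :: "(real \<Rightarrow> real) \<Rightarrow> bool" where
  "L1_loc f \<longleftrightarrow> (\<forall>T>0. f absolutely_integrable_on {0..T})"

definition conv :: "(real \<Rightarrow> real) \<Rightarrow> (real \<Rightarrow> real) \<Rightarrow> real \<Rightarrow> real" where
  "conv a b t = (LINT \<tau>:{0..t}|lebesgue. a (t - \<tau>) * b \<tau>)"

definition m_gamma :: "real \<Rightarrow> (real \<Rightarrow> real) \<Rightarrow> real \<Rightarrow> real" where
  "m_gamma \<gamma> m t = 1 + \<gamma> * m t"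

(* m and k are only determined up to null sets, and the convolution of two locally integrable
   functions is only defined almost everywhere, so the identity is required for almost every
   t > 0.  The kernel k may blow up at 0, so its sign and monotonicity are required on (0, infinity). *)
definition condition_H :: "real \<Rightarrow> (real \<Rightarrow> real) \<Rightarrow> bool" where
  "condition_H \<gamma> m \<longleftrightarrow> L1_loc m \<and>
     (\<exists>k \<beta>. L1_loc k \<and> (\<forall>t>0. 0 \<le> k t) \<and> antimono_on {0<..} k \<and> 0 \<le> \<beta> \<and>
       (AE t in lebesgue. t > 0 \<longrightarrow> \<beta> * m_gamma \<gamma> m t + conv k (m_gamma \<gamma> m) t = 1))"

definition relaxation_solution ::
    "real \<Rightarrow> (real \<Rightarrow> real) \<Rightarrow> real \<Rightarrow> (real \<Rightarrow> real) \<Rightarrow> bool" where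
  "relaxation_solution \<gamma> m \<nu> s \<longleftrightarrow> continuous_on {0..} s \<and>
     (\<forall>t\<ge>0. s t + \<nu> * conv (m_gamma \<gamma> m) s t = 1)"

(* Solutions are unique only on [0, infinity), while HOL functions also carry values at t < 0;
   hence the definite description ranges over the value at t and not over the function. *)
definition s_gamma :: "real \<Rightarrow> (real \<Rightarrow> real) \<Rightarrow> real \<Rightarrow> real \<Rightarrow> real" where
  "s_gamma \<gamma> m t \<nu> = (THE y. \<exists>s. relaxation_solution \<gamma> m \<nu> s \<and> s t = y)"

definition fourier :: "('a::euclidean_space \<Rightarrow> complex) \<Rightarrow> 'a \<Rightarrow> complex" where
  "fourier f \<xi> = (LINT x|lborel. exp (- (\<i> * complex_of_real (x \<bullet> \<xi>))) * f x)"

(* The fundamental solution of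
     d/dt Q + (-Laplace)^(alpha/2) Q + gamma d/dt (m * (-Laplace)^(alpha/2) Q) = 0,  Q(0) = delta,
   given through its Fourier transform in x.  Each Q t is a (Borel representative of a) class
   in L^1(R^N), so it is determined up to null sets; only t > 0 matters. *)
definition fundamental_solution ::
    "real \<Rightarrow> (real \<Rightarrow> real) \<Rightarrow> real \<Rightarrow> (real \<Rightarrow> real ^ 'n \<Rightarrow> real) \<Rightarrow> bool" where
  "fundamental_solution \<gamma> m \<alpha> Q \<longleftrightarrow>
     (\<forall>t>0. integrable lborel (Q t) \<and>
       (\<forall>\<xi>. fourier (\<lambda>x. complex_of_real (Q t x)) \<xi>
             = complex_of_real (s_gamma \<gamma> m t (norm \<xi> powr \<alpha>))))"

(* For the heat kernel (m = 0, alpha = 2, Fourier symbol exp (- t |xi|^2)) on R^N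
   this equals 2 N t. *)
definition msd :: "(real \<Rightarrow> real ^ 'n \<Rightarrow> real) \<Rightarrow> real \<Rightarrow> real" where
  "msd Q t = (LINT x|lborel. (norm x)\<^sup>2 * Q t x)"

end

theory Submission
  imports Defs "HOL-Analysis.Generalised_Binomial_Theorem" "HOL-Real_Asymp.Real_Asymp"
begin

text \<open>Write \<open>a = 1 + \<gamma> m\<close>, so that \<open>(\<beta> + k*) a = 1\<close> turns \<open>s + \<nu> (a * s) = 1\<close> into
  \<open>(\<beta> + k*)(1 - s) = \<nu> (1 * s)\<close>. Since \<open>k\<close> is nonnegative and nonincreasing, the backward Euler
  discretization of the latter equation expresses each value as \<open>c / (c + \<nu>)\<close> times a convex
  combination of the previous ones. With \<open>\<nu> = x powr d\<close>, \<open>0 < d \<le> 1\<close>, the factors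
  \<open>c / (c + x powr d)\<close> are Laplace transforms of subprobability measures on the half-line, and so are all values of
  the scheme and their limit \<open>s\<close>. This replaces Bernstein's theorem. The
  limit carries no mass at \<open>0\<close> and at \<open>\<infinity>\<close>, because \<open>s\<close> tends to \<open>1\<close> and \<open>0\<close> as \<open>\<nu>\<close> tends to \<open>0\<close> and \<open>\<infinity>\<close>;
  mixing heat kernels with it, for \<open>d = \<alpha> / 2\<close>, gives the nonnegative density \<open>Q\<close>. The second moment is the derivative of
  \<open>- s\<close> in \<open>\<nu>\<close> at \<open>0\<close>, which is the integral of \<open>a\<close>.\<close>

section \<open>Mixtures of powers\<close>

text \<open>The obstacle is that \<open>a\<close> and \<open>k\<close> are merely integrable and
  tied together only almost everywhere, so the scheme cannot be compared with \<open>s\<close>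
  pointwise. Integrals can: convolving the defect of the scheme with \<open>a\<close> turns the
  operator built from \<beta> and \<open>k\<close> into plain integration, and the integrated scheme
  then solves the integrated Volterra equation up to an error of order \<open>h\<close>. Since the
  discrete values are nonincreasing in time and \<open>s\<close> is continuous, convergence of the
  integrals forces convergence at every interior time. Treating \<nu> implicitly is essential: it
  enters only the denominator, so the weights stay free of \<nu>, and the dependence on \<nu> is
  carried by sums of products of resolvent factors. Transforms are taken in \<open>x\<close> with
  \<open>\<nu> = x powr d\<close>, and not in \<nu>, because the later Gaussians see \<xi> only
  through its squared norm. Finally, a fundamental solution is known only through its Fourier
  transform; the sign of an arbitrary one therefore rests on an explicit nonnegative one and a
  uniqueness theorem for the transform.\<close>

text \<open>With \<open>y = exp (- r)\<close> these are the Laplace transforms of probability measures in \<open>r\<close>. Mass at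
  \<open>y = 0\<close>, that is at \<open>r = \<infinity>\<close>, is allowed: the measures then live on a compact interval, and the class is
  closed under pointwise limits without a tightness condition.\<close>
definition power_mixture :: "(real \<Rightarrow> real) \<Rightarrow> bool" where
  "power_mixture f \<longleftrightarrow>
     (\<exists>N. real_distribution N \<and> (AE y in N. 0 \<le> y \<and> y \<le> 1) \<and> (\<forall>x>0. f x = (LINT y|N. y powr x)))"

lemma powr_le_one': "0 \<le> y \<Longrightarrow> y \<le> 1 \<Longrightarrow> 0 \<le> x \<Longrightarrow> y powr x \<le> (1::real)"
  using powr_mono2[of x y 1] by simp

lemma (in real_distribution) integrable_powr_unit:
  assumes "AE y in M. 0 \<le> y \<and> y \<le> 1" "x \<ge> 0"
  shows "integrable M (\<lambda>y. y powr x)"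
  by (rule integrable_const_bound[where B=1])
     (use assms in \<open>auto simp: powr_le_one'\<close>)

lemma power_mixture_cong:
  assumes "power_mixture f" "\<And>x. x > 0 \<Longrightarrow> f x = g x"
  shows "power_mixture g"
  using assms unfolding power_mixture_def by metis

lemma power_mixture_point:
  assumes "0 \<le> c" "c \<le> 1"
  shows "power_mixture (\<lambda>x. c powr x)"
  unfolding power_mixture_def
proof (intro exI conjI allI impI)
  show "real_distribution (return borel c)"
    by (simp add: real_distribution_def prob_space_return real_distribution_axioms_def)
  show "AE y in return borel c. 0 \<le> y \<and> y \<le> 1"
    using assms by (subst AE_return) auto
  show "c powr x = (LINT y|return borel c. y powr x)" for x
    by (subst integral_return) auto
qed

text \<open>The Dirac mass at \<open>0\<close> represents it, as \<open>0 powr x = 0\<close>. Having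
  it in the class is what lets weights add up to less than \<open>1\<close> in
  \<open>power_mixture_sum\<close>.\<close>

lemma power_mixture_zero: "power_mixture (\<lambda>x. 0)"
  using power_mixture_point[of 0] by simp

lemma power_mixture_one: "power_mixture (\<lambda>x. 1)"
  using power_mixture_point[of 1] by simp

lemma power_mixture_exp:
  assumes "0 \<le> r"
  shows "power_mixture (\<lambda>x. exp (- (r * x)))"
  using power_mixture_point[of "exp (- r)"] assms by (simp add: powr_def mult.commute)

lemma power_mixture_bounds:
  assumes "power_mixture f" "x > 0"
  shows "0 \<le> f x" "f x \<le> 1"
proof -
  obtain N where N: "real_distribution N" and ae: "AE y in N. 0 \<le> y \<and> y \<le> 1"
    and f: "f x = (LINT y|N. y powr x)"
    using assms unfolding power_mixture_def by blast
  interpret real_distribution N by fact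
  show "0 \<le> f x" unfolding f by (rule integral_nonneg_AE) auto
  have "f x \<le> (LINT y|N. 1)" unfolding f
    by (rule integral_mono_AE) (use ae assms in \<open>auto intro!: integrable_powr_unit[OF ae] powr_le_one' elim!: eventually_mono simp del: AE_conj_iff\<close>)
  then show "f x \<le> 1" using prob_space by simp
qed

text \<open>Multiplying independent variables \<open>y\<close> and \<open>z\<close> is convolution
  in \<open>r\<close>: the pushforward of the product measure under \<open>y * z\<close> does it,
  since powers are multiplicative.\<close>

lemma power_mixture_mult:
  assumes "power_mixture f" "power_mixture g"
  shows "power_mixture (\<lambda>x. f x * g x)"
proof -
  obtain M where M: "real_distribution M" "AE y in M. 0 \<le> y \<and> y \<le> 1"
    and f: "\<And>x. x > 0 \<Longrightarrow> f x = (LINT y|M. y powr x)"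
    using assms(1) unfolding power_mixture_def by blast
  obtain N where N: "real_distribution N" "AE y in N. 0 \<le> y \<and> y \<le> 1"
    and g: "\<And>x. x > 0 \<Longrightarrow> g x = (LINT y|N. y powr x)"
    using assms(2) unfolding power_mixture_def by blast
  interpret M: real_distribution M by fact
  interpret N: real_distribution N by fact
  interpret P: pair_prob_space M N ..
  have sets[measurable_cong]: "sets (M \<Otimes>\<^sub>M N) = sets (borel \<Otimes>\<^sub>M borel)"
    by (intro sets_pair_measure_cong) auto
  define K where "K = distr (M \<Otimes>\<^sub>M N) borel (\<lambda>(y, z). y * z)"
  have ae: "AE p in M \<Otimes>\<^sub>M N. (0 \<le> fst p \<and> fst p \<le> 1) \<and> (0 \<le> snd p \<and> snd p \<le> 1)"
    
  proof (rule P.AE_pair_measure)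
    show "AE y in M. AE z in N. (0 \<le> fst (y, z) \<and> fst (y, z) \<le> 1) \<and> (0 \<le> snd (y, z) \<and> snd (y, z) \<le> 1)"
      using M(2)
    proof (rule eventually_mono)
      fix y :: real assume "0 \<le> y \<and> y \<le> 1"
      then show "AE z in N. (0 \<le> fst (y, z) \<and> fst (y, z) \<le> 1) \<and> (0 \<le> snd (y, z) \<and> snd (y, z) \<le> 1)"
        using N(2) by (auto elim!: eventually_mono)
    qed
  qed measurable
  show ?thesis unfolding power_mixture_def
  proof (intro exI conjI allI impI)
    show "real_distribution K"
      unfolding K_def real_distribution_def real_distribution_axioms_def
      by (auto intro!: P.prob_space_distr)
    show "AE y in K. 0 \<le> y \<and> y \<le> 1"
      unfolding K_def using ae by (subst AE_distr_iff) (auto simp: split_beta mult_le_one elim!: eventually_mono simp del: AE_conj_iff)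
    fix x :: real assume x: "x > 0"
    have "(LINT y|K. y powr x) = (LINT p|(M \<Otimes>\<^sub>M N). (fst p * snd p) powr x)"
      unfolding K_def by (subst integral_distr) (auto simp: split_beta)
    also have "\<dots> = (LINT p|(M \<Otimes>\<^sub>M N). fst p powr x * snd p powr x)"
      by (rule integral_cong_AE) (use ae in \<open>auto simp: powr_mult elim!: eventually_mono simp del: AE_conj_iff\<close>)
    also have "\<dots> = (LINT y|M. LINT z|N. y powr x * z powr x)"
    proof (subst P.integral_fst'[symmetric])
      show "integrable (M \<Otimes>\<^sub>M N) (\<lambda>p. fst p powr x * snd p powr x)"
        by (rule P.P.integrable_const_bound[where B=1])
           (use ae x in \<open>auto intro!: mult_le_one powr_le_one' elim!: eventually_mono simp del: AE_conj_iff\<close>)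
    qed simp
    also have "\<dots> = f x * g x"
      using x by (simp add: f g)
    finally show "f x * g x = (LINT y|K. y powr x)" ..
  qed
qed

text \<open>A Bernoulli coin with parameter \<open>p\<close> selects one of the two measures; the
  bind over the coin is their mixture.\<close>

lemma power_mixture_convex:
  assumes "power_mixture f" "power_mixture g" "0 \<le> p" "p \<le> 1"
  shows "power_mixture (\<lambda>x. p * f x + (1 - p) * g x)"
proof -
  obtain M where M: "real_distribution M" "AE y in M. 0 \<le> y \<and> y \<le> 1"
    and f: "\<And>x. x > 0 \<Longrightarrow> f x = (LINT y|M. y powr x)"
    using assms(1) unfolding power_mixture_def by blast
  obtain N where N: "real_distribution N" "AE y in N. 0 \<le> y \<and> y \<le> 1"
    and g: "\<And>x. x > 0 \<Longrightarrow> g x = (LINT y|N. y powr x)"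
    using assms(2) unfolding power_mixture_def by blast
  interpret M: real_distribution M by fact
  interpret N: real_distribution N by fact
  let ?B = "measure_pmf (bernoulli_pmf p)"
  define L where "L = (\<lambda>b. if b then M else N)"
  have L[measurable]: "L \<in> ?B \<rightarrow>\<^sub>M subprob_algebra borel"
    using M.subprob_space_axioms N.subprob_space_axioms
    by (auto simp: L_def space_subprob_algebra)
  have L': "L \<in> ?B \<rightarrow>\<^sub>M prob_algebra borel"
    using M.prob_space_axioms N.prob_space_axioms
    by (auto simp: L_def space_prob_algebra)
  define K where "K = ?B \<bind> L"
  have setsK[measurable_cong]: "sets K = sets borel"
    unfolding K_def by (rule sets_bind'[OF _ L']) (simp add: space_prob_algebra measure_pmf.prob_space_axioms)
  have aeL: "AE y in L b. 0 \<le> y \<and> y \<le> 1" for b unfolding L_def using M(2) N(2) by (cases b) (simp_all only: if_True if_False)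
  show ?thesis unfolding power_mixture_def
  proof (intro exI conjI allI impI)
    show "real_distribution K"
      unfolding real_distribution_def real_distribution_axioms_def
      by (auto simp: setsK sets_eq_imp_space_eq[OF setsK] K_def
          intro!: measure_pmf.prob_space_bind[OF _ L] )
         (auto simp: L_def M.prob_space_axioms N.prob_space_axioms)
    show aeK: "AE y in K. 0 \<le> y \<and> y \<le> 1"
      unfolding K_def by (subst AE_bind[OF L]) (use aeL in \<open>simp_all del: AE_conj_iff\<close>)
    fix x :: real assume x: "x > 0"
    \<comment> \<open>\<open>integral_bind\<close> wants an integrand bounded everywhere, while
      \<open>y powr x\<close> is bounded by \<open>1\<close> only on the unit interval, which
      carries all the mass.\<close>
    let ?h = "\<lambda>y. indicator {0..1} y * y powr x"
    have h: "(LINT y|A. y powr x) = (LINT y|A. ?h y)"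
      if "sets A = sets borel" "AE y in A. 0 \<le> y \<and> y \<le> 1" for A
      by (rule integral_cong_AE) 
         (use that measurable_cong_sets[OF that(1) refl] in \<open>auto elim!: eventually_mono simp del: AE_conj_iff\<close>)
    have "(LINT y|K. y powr x) = (LINT y|K. ?h y)" using h setsK aeK by auto
    also have "\<dots> = (LINT b|?B. LINT y|L b. ?h y)"
      unfolding K_def
    proof (rule integral_bind[where B=1 and B'=1 and K=borel])
      show "AE b in ?B. emeasure (L b) (space (L b)) \<le> ennreal 1"
        using M.emeasure_space_1 N.emeasure_space_1 by (simp add: L_def)
      show "\<bar>?h y\<bar> \<le> 1" for y using x by (simp add: indicator_def powr_le_one')
    qed (use L in \<open>auto simp: measure_pmf.finite_measure_axioms\<close>)
    also have "\<dots> = p * f x + (1 - p) * g x"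
      using assms(3,4) x M N h[of M] h[of N] by (simp add: L_def f g)
    finally show "p * f x + (1 - p) * g x = (LINT y|K. y powr x)" ..
  qed
qed

lemma power_mixture_sum:
  assumes "finite I" "\<And>i. i \<in> I \<Longrightarrow> power_mixture (f i)" "\<And>i. i \<in> I \<Longrightarrow> 0 \<le> w i" "sum w I \<le> 1"
  shows "power_mixture (\<lambda>x. \<Sum>i\<in>I. w i * f i x)"
  using assms
proof (induction I arbitrary: w rule: finite_induct)
  case empty
  then show ?case by (simp add: power_mixture_zero)
next
  case (insert j I)
  have s: "sum w I \<ge> 0" "sum w I \<le> 1 - w j" using insert by (auto intro: sum_nonneg)
  show ?case
  \<comment> \<open>The remaining weights are rescaled by \<open>1 - w j\<close> below; if this
    factor is zero they all vanish.\<close>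
  proof (cases "w j = 1")
    case True
    then have "\<forall>i\<in>I. w i = 0"
      using s insert by (subst sum_nonneg_eq_0_iff[symmetric]) auto
    then show ?thesis using insert True by (simp add: insert)
  next
    case False
    then have wj: "0 \<le> w j" "w j < 1" using s insert by auto
    have "power_mixture (\<lambda>x. \<Sum>i\<in>I. w i / (1 - w j) * f i x)"
      using insert s wj by (intro insert.IH) (auto simp: sum_divide_distrib[symmetric] divide_le_eq)
    from power_mixture_convex[OF insert.prems(1)[of j] this, of "w j"] 
    have "power_mixture (\<lambda>x. w j * f j x + (1 - w j) * (\<Sum>i\<in>I. w i / (1 - w j) * f i x))"
      using wj by auto
    moreover have "(1 - w j) * (\<Sum>i\<in>I. w i / (1 - w j) * f i x) = (\<Sum>i\<in>I. w i * f i x)" for x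
      using wj by (simp add: sum_distrib_left)
    ultimately show ?thesis using insert by simp
  qed
qed

text \<open>All measures sit in the unit interval, so they are tight and a subsequence converges
  weakly. For \<open>x > 0\<close> the function \<open>y powr x\<close> is continuous there, and
  testing with it identifies the limit. At \<open>x = 0\<close> it would jump at
  \<open>y = 0\<close>, because \<open>0 powr 0 = 0\<close>; this is why the class speaks of
  \<open>x > 0\<close> only.\<close>

lemma power_mixture_LIMSEQ:
  assumes f: "\<And>n. power_mixture (f n)" and lim: "\<And>x. x > 0 \<Longrightarrow> (\<lambda>n. f n x) \<longlonglongrightarrow> g x"
  shows "power_mixture g"
proof -
  have "\<forall>n. \<exists>N. real_distribution N \<and> (AE y in N. 0 \<le> y \<and> y \<le> 1) \<and> (\<forall>x>0. f n x = (LINT y|N. y powr x))"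
    using f unfolding power_mixture_def by blast
  then obtain N where N: "\<And>n. real_distribution (N n)" and ae: "\<And>n. AE y in N n. 0 \<le> y \<and> y \<le> 1"
    and fN: "\<And>n x. x > 0 \<Longrightarrow> f n x = (LINT y|N n. y powr x)"
    by metis
  have "tight N" unfolding tight_def
  proof (intro conjI allI impI N exI)
    fix e :: real and n assume e: "e > 0"
    interpret real_distribution "N n" by (rule N)
    \<comment> \<open>\<open>tight\<close> uses intervals that are open on the left; starting at
      \<open>-1\<close> keeps a possible atom at \<open>0\<close> inside.\<close>
    show "(-1::real) < 1" by simp
    have "prob {-1<..1} = 1"
      by (subst prob_eq_1) (use ae[of n] in \<open>auto elim!: eventually_mono\<close>)
    then show "1 - e < prob {-1<..1}" using e by simp
  qed
  from tight_imp_convergent_subsubsequence[OF this strict_mono_id]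
  obtain r M where r: "strict_mono (r::nat\<Rightarrow>nat)" and M: "real_distribution M"
    and wc: "weak_conv_m (N \<circ> id \<circ> r) M" by blast
  then have wc: "weak_conv_m (\<lambda>n. N (r n)) M" by (simp add: comp_def)
  interpret M: real_distribution M by fact
  have conv: "(\<lambda>n. LINT y|N (r n). h y) \<longlonglongrightarrow> (LINT y|M. h y)"
    if "continuous_on UNIV h" "\<And>y. \<bar>h y\<bar> \<le> 1" for h :: "real \<Rightarrow> real"
    by (rule weak_conv_imp_integral_bdd_continuous_conv[OF N M wc, where B=1])
       (use that in \<open>auto simp: continuous_on_eq_continuous_at\<close>)
  \<comment> \<open>Weak convergence tests functions continuous and bounded on the whole line;
    \<open>clip\<close> extends functions on the unit interval to such functions.\<close>
  define clip :: "real \<Rightarrow> real" where "clip y = max 0 (min 1 y)" for y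
  have cclip: "continuous_on UNIV clip" unfolding clip_def by (intro continuous_intros)
  have clip[simp]: "0 \<le> clip y" "clip y \<le> 1" "0 \<le> y \<and> y \<le> 1 \<Longrightarrow> clip y = y" for y by (auto simp: clip_def)
  have [measurable]: "clip \<in> borel_measurable borel" unfolding clip_def by measurable
  have aeM: "AE y in M. 0 \<le> y \<and> y \<le> 1"
  proof -
    \<comment> \<open>This bounded continuous function vanishes exactly on the unit interval, so its
      integral detects mass outside.\<close>
    let ?h = "\<lambda>y::real. min 1 \<bar>y - clip y\<bar>"
    have "(\<lambda>n. LINT y|N (r n). ?h y) \<longlonglongrightarrow> (LINT y|M. ?h y)"
      by (rule conv) (auto intro!: continuous_intros cclip)
    moreover have "(LINT y|N n. ?h y) = 0" for n
    proof -
      interpret real_distribution "N n" by (rule N)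
      show ?thesis by (rule integral_eq_zero_AE) (use ae[of n] in \<open>rule eventually_mono\<close>, simp)
    qed
    ultimately have "(LINT y|M. ?h y) = 0" using LIMSEQ_unique[of "\<lambda>_. 0"] by auto
    moreover have "integrable M ?h" by (rule M.integrable_const_bound[where B=1]) auto
    ultimately have "AE y in M. ?h y = 0"
      by (subst (asm) integral_nonneg_eq_0_iff_AE) auto
    then show ?thesis
      by eventually_elim (auto simp: min_def clip_def max_def split: if_splits)
  qed
  show ?thesis unfolding power_mixture_def
  proof (intro exI conjI allI impI)
    show "real_distribution M" by fact
    show "AE y in M. 0 \<le> y \<and> y \<le> 1" by fact
    fix x :: real assume x: "x > 0"
    have "(\<lambda>n. LINT y|N (r n). clip y powr x) \<longlonglongrightarrow> (LINT y|M. clip y powr x)"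
      by (rule conv[OF continuous_on_powr'[OF cclip continuous_on_const]]) (use x in \<open>auto intro!: powr_le_one'\<close>)
    moreover have "(LINT y|N n. clip y powr x) = f n x" for n
    proof -
      interpret real_distribution "N n" by (rule N)
      show ?thesis unfolding fN[OF x]
        by (rule integral_cong_AE) (use ae[of n] in \<open>auto elim!: eventually_mono simp del: AE_conj_iff\<close>)
    qed
    moreover have "(LINT y|M. clip y powr x) = (LINT y|M. y powr x)"
      by (rule integral_cong_AE) (use aeM in \<open>auto elim!: eventually_mono simp del: AE_conj_iff\<close>)
    moreover have "(\<lambda>n. f (r n) x) \<longlonglongrightarrow> g x"
      using LIMSEQ_subseq_LIMSEQ[OF lim[OF x] r] by (simp add: comp_def)
    ultimately show "g x = (LINT y|M. y powr x)" using LIMSEQ_unique by auto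
  qed
qed

lemma power_mixture_sums:
  assumes "\<And>i. power_mixture (f i)" "\<And>i. 0 \<le> w i" "\<And>n. (\<Sum>i<n. w i) \<le> 1"
    "\<And>x. x > 0 \<Longrightarrow> (\<lambda>i. w i * f i x) sums g x"
  shows "power_mixture g"
  by (rule power_mixture_LIMSEQ[where f="\<lambda>n x. \<Sum>i<n. w i * f i x"])
     (use assms in \<open>auto intro!: power_mixture_sum simp: sums_def\<close>)

lemma power_mixture_power: "power_mixture f \<Longrightarrow> power_mixture (\<lambda>x. f x ^ n)"
  by (induction n) (auto intro: power_mixture_one power_mixture_mult)

text \<open>The resolvent of a compound Poisson generator is a geometric series of jump transforms.\<close>
lemma power_mixture_resolvent:
  assumes L: "power_mixture L" and c: "c > 0" and M: "M \<ge> 0"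
  shows "power_mixture (\<lambda>x. c / (c + M * (1 - L x)))"
proof (rule power_mixture_sums)
  show "power_mixture (\<lambda>x. L x ^ i)" for i by (rule power_mixture_power[OF L])
  let ?q = "M / (c + M)"
  have q: "0 \<le> ?q" "?q < 1" using c M by auto
  show "0 \<le> c / (c + M) * ?q ^ i" for i using c M by simp
  have q1: "c / (c + M) = 1 - ?q" using c M by (simp add: field_simps)
  show "(\<Sum>i<n. c / (c + M) * ?q ^ i) \<le> 1" for n
    using q unfolding q1 sum_distrib_left[symmetric] one_diff_power_eq[symmetric] by simp
  fix x :: real assume "x > 0"
  then have Lx: "0 \<le> L x" "L x \<le> 1" using power_mixture_bounds[OF L] by auto
  have "?q * L x \<le> ?q" using q Lx by (intro mult_left_le) auto
  then have "\<bar>?q * L x\<bar> < 1" using q Lx by (subst abs_of_nonneg) (auto simp del: times_divide_eq_left)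
  then have "(\<lambda>i. c / (c + M) * (?q * L x) ^ i) sums (c / (c + M) * (1 / (1 - ?q * L x)))"
    by (intro sums_mult geometric_sums) auto
  moreover have "c / (c + M) * (1 / (1 - ?q * L x)) = c / (c + M * (1 - L x))"
  proof -
    have "c + M * (1 - L x) > 0" using c M Lx by (simp add: add_pos_nonneg)
    then show ?thesis using c M by (simp add: divide_simps) (simp add: algebra_simps)
  qed
  ultimately show "(\<lambda>i. c / (c + M) * ?q ^ i * L x ^ i) sums (c / (c + M * (1 - L x)))"
    by (simp only: power_mult_distrib mult.assoc)
qed

section \<open>Fractional powers through the binomial series\<close>

text \<open>The signs make \<open>1 - (1 - z) powr d\<close> a power series in \<open>z\<close> with
  nonnegative coefficients. The first one enters through partial sums: the alternating sum of
  \<open>d gchoose k\<close> over \<open>k \<le> n\<close> equals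
  \<open>(- 1) ^ n * (d - 1 gchoose n)\<close>, and its nonnegativity keeps the coefficient sums at
  most \<open>1\<close>.\<close>

lemma gbinomial_minus_one_sign:
  assumes "0 \<le> d" "d \<le> (1::real)"
  shows "0 \<le> (- 1) ^ k * (d - 1 gchoose k)" and "k > 0 \<Longrightarrow> (- 1) ^ k * (d gchoose k) \<le> 0"
proof -
  show *: "0 \<le> (- 1) ^ k * (d - 1 gchoose k)" for k
  proof -
    have "(- 1) ^ k * (d - 1 gchoose k) = (\<Prod>i<k. (1 - d + real i)) / fact k"
    proof -
      have "(\<Prod>i<k. d - 1 - real i) = (\<Prod>i<k. (-1) * (1 - d + real i))" by (rule prod.cong) auto
      also have "\<dots> = (- 1) ^ k * (\<Prod>i<k. (1 - d + real i))" by (subst prod.distrib) simp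
      finally show ?thesis by (simp add: gbinomial_prod_rev atLeast0LessThan)
    qed
    also have "\<dots> \<ge> 0" using assms by (intro divide_nonneg_nonneg prod_nonneg) auto
    finally show ?thesis .
  qed
  assume "k > 0"
  then obtain j where k: "k = Suc j" by (cases k) auto
  have "(d gchoose Suc j) = d / (1 + real j) * (d - 1 gchoose j)"
    using gbinomial_absorption'[of "Suc j" d] by simp
  then have "(- 1) ^ k * (d gchoose k) = - (d / (1 + real j) * ((- 1) ^ j * (d - 1 gchoose j)))"
    by (simp add: k)
  also have "\<dots> \<le> 0" using *[of j] assms by simp
  finally show "(- 1) ^ k * (d gchoose k) \<le> 0" .
qed

text \<open>With \<open>z = exp (- (r * x))\<close> this is the generating function of the Sibuya
  distribution. Each power of \<open>z\<close> is the transform of a point mass at a multiple of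
  \<open>r\<close>, and the constant term cancels, so the weights start at index
  \<open>Suc 0\<close>.\<close>

lemma power_mixture_binomial:
  assumes d: "0 < d" "d \<le> 1" and r: "r > 0"
  shows "power_mixture (\<lambda>x. 1 - (1 - exp (- (r * x))) powr d)"
proof (rule power_mixture_sums)
  define w where "w i = - ((- 1) ^ Suc i * (d gchoose Suc i))" for i
  show "power_mixture (\<lambda>x. exp (- (real (Suc i) * r * x)))" for i
    using r by (intro power_mixture_exp) auto
  show "0 \<le> w i" for i
    using gbinomial_minus_one_sign(2)[of d "Suc i"] d by (simp add: w_def)
  show "(\<Sum>i<n. w i) \<le> 1" for n
  proof -
    have "(\<Sum>k\<le>n. (d gchoose k) * (- 1) ^ k) = 1 - (\<Sum>i<n. w i)"
      by (simp add: lessThan_Suc_atMost[symmetric] sum.lessThan_Suc_shift w_def sum_negf mult.commute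
            del: sum.lessThan_Suc gbinomial_Suc)
    then show ?thesis
      using gbinomial_minus_one_sign(1)[of d n] d unfolding gbinomial_sum_lower_neg by simp
  qed
  fix x :: real assume x: "x > 0"
  let ?y = "exp (- (r * x))"
  have "\<bar>- ?y\<bar> < 1" using r x by simp
  from gen_binomial_real[OF this, of d]
  have "(\<lambda>n. (d gchoose n) * (- ?y) ^ n) sums (1 - ?y) powr d" by simp
  then have "(\<lambda>n. (d gchoose Suc n) * (- ?y) ^ Suc n) sums ((1 - ?y) powr d - 1)"
    by (subst sums_Suc_iff) simp
  from sums_minus[OF this]
  have "(\<lambda>n. - ((d gchoose Suc n) * (- ?y) ^ Suc n)) sums (1 - (1 - ?y) powr d)" by simp
  moreover have "- ((d gchoose Suc n) * (- ?y) ^ Suc n) = w n * exp (- (real (Suc n) * r * x))" for n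
  proof -
    have "(- ?y) ^ Suc n = (- 1) ^ Suc n * exp (- (real (Suc n) * r * x))"
      by (subst power_minus, subst exp_of_nat_mult[symmetric]) (simp add: mult.assoc)
    then show ?thesis unfolding w_def by simp
  qed
  ultimately show "(\<lambda>i. w i * exp (- (real (Suc i) * r * x))) sums (1 - (1 - exp (- (r * x))) powr d)"
    by simp
qed

text \<open>\<open>x powr d\<close> is the limit of \<open>n powr d * (1 - exp (- x / n)) powr d\<close>, which has the form
  \<open>M * (1 - L x)\<close> with a power mixture \<open>L\<close>.\<close>
lemma power_mixture_fractional_resolvent:
  assumes d: "0 < d" "d \<le> 1" and c: "c > 0"
  shows "power_mixture (\<lambda>x. c / (c + x powr d))"
proof (rule power_mixture_LIMSEQ)
  let ?s = "\<lambda>n x. real (Suc n) powr d * (1 - (1 - (1 - exp (- (1 / real (Suc n) * x))) powr d))"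
  show "power_mixture (\<lambda>x. c / (c + ?s n x))" for n
    by (intro power_mixture_resolvent power_mixture_binomial) (use assms in auto)
  fix x :: real assume x: "x > 0"
  have "((\<lambda>n. real n * (1 - exp (- (1 / real n * x)))) \<longlongrightarrow> x) sequentially"
    by real_asymp
  then have "(\<lambda>n. real (Suc n) * (1 - exp (- (1 / real (Suc n) * x)))) \<longlonglongrightarrow> x"
    by (rule LIMSEQ_Suc)
  then have "(\<lambda>n. (real (Suc n) * (1 - exp (- (1 / real (Suc n) * x)))) powr d) \<longlonglongrightarrow> x powr d"
    using x by (intro tendsto_powr tendsto_const) auto
  moreover have "(real (Suc n) * (1 - exp (- (1 / real (Suc n) * x)))) powr d = ?s n x" for n
    using x by (simp add: powr_mult)
  ultimately have "(\<lambda>n. ?s n x) \<longlonglongrightarrow> x powr d" by simp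
  then show "(\<lambda>n. c / (c + ?s n x)) \<longlonglongrightarrow> c / (c + x powr d)"
    using c by (intro tendsto_intros) (auto simp: add_pos_nonneg add_nonneg_eq_0_iff)
qed

section \<open>The backward Euler scheme\<close>

text \<open>Backward Euler scheme for \<open>(\<beta> + k*)(1 - s) = \<nu> (1 * s)\<close> with step \<open>h\<close>, where
  \<open>b = \<beta> / h\<close> and \<open>\<kappa>\<^sub>j\<close> is the mean of \<open>k\<close> over the \<open>j\<close>-th cell.\<close>
fun euler :: "real \<Rightarrow> (nat \<Rightarrow> real) \<Rightarrow> real \<Rightarrow> nat \<Rightarrow> real" where
  "euler b \<kappa> \<nu> 0 = 1"
| "euler b \<kappa> \<nu> (Suc n) =
     (b * euler b \<kappa> \<nu> n + (\<Sum>i<n. (\<kappa> i - \<kappa> (Suc i)) * euler b \<kappa> \<nu> (n - i)) + \<kappa> n) / (b + \<kappa> 0 + \<nu>)"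

locale euler_scheme =
  fixes b :: real and \<kappa> :: "nat \<Rightarrow> real"
  assumes b: "b \<ge> 0" and \<kappa>_nonneg: "\<And>n. \<kappa> n \<ge> 0" and \<kappa>_Suc: "\<And>n. \<kappa> (Suc n) \<le> \<kappa> n"
    and pos: "b + \<kappa> 0 > 0"
begin

lemma telescope: "(\<Sum>i<n. \<kappa> i - \<kappa> (Suc i)) = \<kappa> 0 - \<kappa> n"
  by (induction n) auto

lemma euler_power_mixture:
  assumes d: "0 < d" "d \<le> 1"
  shows "power_mixture (\<lambda>x. euler b \<kappa> (x powr d) n)"
proof (induction n rule: less_induct)
  case (less n)
  show ?case
  proof (cases n)
    case 0
    then show ?thesis by (simp add: power_mixture_one)
  next
    case (Suc m)
    let ?c = "b + \<kappa> 0"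
    let ?u = "\<lambda>n x. euler b \<kappa> (x powr d) n"
    \<comment> \<open>The slots below \<open>m\<close> hold the memory differences, slot
      \<open>m\<close> the term with \<open>b\<close>, and slot \<open>Suc m\<close> the initial
      value \<open>1\<close> with weight \<open>\<kappa> m\<close>. Monotonicity of \<kappa> gives
      the signs, and by \<open>telescope\<close> the total is exactly \<open>?c\<close>, the
      constant of the resolvent factor.\<close>
    let ?w = "\<lambda>i. if i < m then \<kappa> i - \<kappa> (Suc i) else if i = m then b else \<kappa> m"
    let ?f = "\<lambda>i. if i < m then ?u (m - i) else if i = m then ?u m else (\<lambda>x. 1)"
    have "power_mixture (\<lambda>x. \<Sum>i<Suc (Suc m). ?w i / ?c * ?f i x)"
    proof (rule power_mixture_sum)
      show "power_mixture (?f i)" for i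
        using less Suc by (auto intro: power_mixture_one)
      show "0 \<le> ?w i / ?c" for i
        using pos b \<kappa>_nonneg \<kappa>_Suc by (intro divide_nonneg_nonneg) auto
      have "(\<Sum>i<Suc (Suc m). ?w i) = ?c" using telescope[of m] by simp
      then show "(\<Sum>i<Suc (Suc m). ?w i / ?c) \<le> 1"
        using pos by (simp only: sum_divide_distrib[symmetric]) simp
    qed simp
    from power_mixture_mult[OF power_mixture_fractional_resolvent[OF d pos] this]
    show ?thesis
    proof (rule power_mixture_cong)
      fix x :: real
      have "(\<Sum>i<Suc (Suc m). ?w i / ?c * ?f i x)
          = (b * ?u m x + (\<Sum>i<m. (\<kappa> i - \<kappa> (Suc i)) * ?u (m - i) x) + \<kappa> m) / ?c"
        by (simp add: sum_divide_distrib add_divide_distrib)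
      moreover have "?c + x powr d > 0" using pos by (simp add: add_pos_nonneg)
      ultimately show "?c / (?c + x powr d) * (\<Sum>i<Suc (Suc m). ?w i / ?c * ?f i x) = ?u n x"
        using pos Suc by simp
    qed
  qed
qed

context
  fixes \<nu> :: real assumes \<nu>: "\<nu> \<ge> 0"
begin

abbreviation "u \<equiv> euler b \<kappa> \<nu>"

lemma euler_Suc:
  "(b + \<kappa> 0 + \<nu>) * u (Suc n) = b * u n + (\<Sum>i<n. (\<kappa> i - \<kappa> (Suc i)) * u (n - i)) + \<kappa> n"
  using pos \<nu> by simp

lemma euler_nonneg: "0 \<le> u n"
proof (induction n rule: less_induct)
  case (less n)
  show ?case
  proof (cases n)
    case (Suc m)
    then show ?thesis
      using less b \<kappa>_nonneg \<kappa>_Suc pos \<nu>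
      by (auto intro!: divide_nonneg_nonneg add_nonneg_nonneg mult_nonneg_nonneg sum_nonneg)
  qed auto
qed

text \<open>Subtracting consecutive steps gives the same recursion for the decrements, so
  nonnegativity propagates by strong induction. The extra term with \<open>1 - u 1\<close> collects
  the top summand of the longer memory sum and the change from \<open>\<kappa> m\<close> to
  \<open>\<kappa> (Suc m)\<close>.\<close>

lemma euler_mono: "u (Suc n) \<le> u n"
proof (induction n rule: less_induct)
  case (less n)
  show ?case
  proof (cases n)
    case 0
    then show ?thesis using pos \<nu> by simp
  next
    case (Suc m)
    have "(b + \<kappa> 0 + \<nu>) * (u (Suc m) - u (Suc (Suc m)))
       = b * (u m - u (Suc m)) + (\<Sum>i<m. (\<kappa> i - \<kappa> (Suc i)) * (u (m - i) - u (Suc (m - i))))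
         + (\<kappa> m - \<kappa> (Suc m)) * (1 - u 1)"
    proof -
      have "(\<Sum>i<m. (\<kappa> i - \<kappa> (Suc i)) * u (Suc m - i)) = (\<Sum>i<m. (\<kappa> i - \<kappa> (Suc i)) * u (Suc (m - i)))"
        by (rule sum.cong) (auto simp: Suc_diff_le)
      then show ?thesis
        unfolding right_diff_distrib euler_Suc sum_subtractf
        by (simp add: algebra_simps del: euler.simps(2))
    qed
    also have "\<dots> \<ge> 0"
    proof (intro add_nonneg_nonneg mult_nonneg_nonneg sum_nonneg)
      show "u m - u (Suc m) \<ge> 0" using less[of m] Suc by simp
      show "u (m - i) - u (Suc (m - i)) \<ge> 0" if "i \<in> {..<m}" for i 
        using less[of "m - i"] Suc by simp
      show "1 - u 1 \<ge> 0" using less[of 0] Suc by simp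
    qed (use b \<kappa>_Suc in auto)
    finally show ?thesis using Suc pos \<nu> by (simp add: zero_le_mult_iff del: euler.simps(2))
  qed
qed

lemma euler_antimono: "m \<le> n \<Longrightarrow> u n \<le> u m"
  by (rule lift_Suc_antimono_le[of u]) (use euler_mono in auto)

lemma euler_le_one: "u n \<le> 1"
  using euler_antimono[of 0 n] by simp

text \<open>This is the discrete equation itself; the recursion is its difference between
  \<open>Suc n\<close> and \<open>n\<close>, solved for the newest value. The sum on the right runs
  over \<open>u (Suc i)\<close>, that is over right endpoints, which makes the scheme
  implicit.\<close>

lemma euler_identity:
  "b * (1 - u n) + (\<Sum>j<n. \<kappa> j * (1 - u (n - j))) = \<nu> * (\<Sum>i<n. u (Suc i))"
proof (induction n)
  case 0
  then show ?case by simp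
next
  case (Suc n)
  have A: "(\<Sum>j<Suc n. \<kappa> j * (1 - u (Suc n - j)))
      = \<kappa> 0 * (1 - u (Suc n)) + (\<Sum>j<n. \<kappa> (Suc j) * (1 - u (n - j)))"
    by (subst sum.lessThan_Suc_shift) simp
  have B: "(\<Sum>i<n. (\<kappa> i - \<kappa> (Suc i)) * u (n - i)) 
     = (\<kappa> 0 - \<kappa> n) - (\<Sum>j<n. \<kappa> j * (1 - u (n - j))) + (\<Sum>j<n. \<kappa> (Suc j) * (1 - u (n - j)))"
    unfolding telescope[symmetric] sum_subtractf[symmetric] sum.distrib[symmetric]
    by (rule sum.cong) (auto simp: algebra_simps)
  show ?case
    unfolding A using Suc euler_Suc[of n] unfolding B
    by (simp add: algebra_simps del: euler.simps(2))
qed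

end

end

section \<open>Convolution on the line\<close>

text \<open>Taken over the whole line, so that commutativity is a reflection and associativity is
  plain Fubini. For factors vanishing on the negative axis the integrand lives on
  \<open>{0..t}\<close>, which links it to \<open>conv\<close> in \<open>conv_eq_cv\<close>.\<close>

definition cv :: "(real \<Rightarrow> real) \<Rightarrow> (real \<Rightarrow> real) \<Rightarrow> real \<Rightarrow> real" where
  "cv f g t = (LINT \<tau>|lborel. f (t - \<tau>) * g \<tau>)"

lemma integrable_reflect:
  fixes f :: "real \<Rightarrow> real"
  shows "integrable lborel f \<Longrightarrow> integrable lborel (\<lambda>\<tau>. f (t - \<tau>))"
  using lborel_integrable_real_affine[of f "-1" t] by simp

lemma integral_reflect:
  fixes f :: "real \<Rightarrow> real"
  shows "(LINT \<tau>|lborel. f (t - \<tau>)) = (LINT \<tau>|lborel. f \<tau>)"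
  using lborel_integral_real_affine[of "-1" f t] by simp

lemma cv_commute: "cv f g t = cv g f t"
  using integral_reflect[of "\<lambda>\<tau>. f (t - \<tau>) * g \<tau>" t] by (simp add: cv_def mult.commute)

lemma cv_measurable[measurable]:
  assumes [measurable]: "f \<in> borel_measurable borel" "g \<in> borel_measurable borel"
  shows "cv f g \<in> borel_measurable borel"
proof -
  have "(\<lambda>t. LINT \<tau>|lborel. f (t - \<tau>) * g \<tau>) \<in> borel_measurable borel" by measurable
  then show ?thesis by (simp add: cv_def[abs_def])
qed

lemma integrable_mult_bounded:
  fixes f g :: "real \<Rightarrow> real"
  assumes "integrable lborel f" and [measurable]: "g \<in> borel_measurable borel" and "\<And>x. \<bar>g x\<bar> \<le> B"
  shows "integrable lborel (\<lambda>x. f x * g x)"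
proof (rule Bochner_Integration.integrable_bound[where f="\<lambda>x. B * f x"])
  show "integrable lborel (\<lambda>x. B * f x)" using assms by simp
  have [measurable]: "f \<in> borel_measurable borel" using assms(1) by auto
  show "(\<lambda>x. f x * g x) \<in> borel_measurable lborel" by measurable
  show "AE x in lborel. norm (f x * g x) \<le> norm (B * f x)"
  proof (rule AE_I2)
    fix x
    have "\<bar>g x\<bar> * \<bar>f x\<bar> \<le> \<bar>B\<bar> * \<bar>f x\<bar>" using assms(3)[of x] by (intro mult_right_mono) auto
    then show "norm (f x * g x) \<le> norm (B * f x)" by (simp add: abs_mult mult.commute)
  qed
qed

lemma cv_integrable:
  fixes f g :: "real \<Rightarrow> real"
  assumes "integrable lborel f" "g \<in> borel_measurable borel" "\<And>x. \<bar>g x\<bar> \<le> B"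
  shows "integrable lborel (\<lambda>\<tau>. f (t - \<tau>) * g \<tau>)"
  by (rule integrable_mult_bounded[OF integrable_reflect[OF assms(1)] assms(2,3)])

lemma cv_abs_le:
  assumes f: "integrable lborel f" and g: "g \<in> borel_measurable borel" "\<And>x. \<bar>g x\<bar> \<le> B"
  shows "\<bar>cv f g t\<bar> \<le> (LINT x|lborel. \<bar>f x\<bar>) * B"
proof -
  have "\<bar>cv f g t\<bar> \<le> (LINT \<tau>|lborel. \<bar>f (t - \<tau>) * g \<tau>\<bar>)"
    unfolding cv_def by (rule integral_abs_bound)
  also have "\<dots> \<le> (LINT \<tau>|lborel. \<bar>f (t - \<tau>)\<bar> * B)"
    by (rule integral_mono) 
       (use f g integrable_abs[OF cv_integrable[OF f g]] integrable_reflect[OF f] in \<open>auto simp: abs_mult mult_left_mono\<close>)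
  also have "\<dots> = (LINT x|lborel. \<bar>f x\<bar>) * B"
    using integral_reflect[of "\<lambda>x. \<bar>f x\<bar>" t] by simp
  finally show ?thesis .
qed

lemma cv_cong:
  assumes "\<And>\<tau>. \<tau> < 0 \<Longrightarrow> f \<tau> = 0" "\<And>\<tau>. \<tau> \<le> t \<Longrightarrow> g \<tau> = g' \<tau>"
  shows "cv f g t = cv f g' t"
  unfolding cv_def
proof (rule Bochner_Integration.integral_cong[OF refl])
  fix \<tau> show "f (t - \<tau>) * g \<tau> = f (t - \<tau>) * g' \<tau>"
    using assms(1)[of "t - \<tau>"] assms(2)[of \<tau>] by (cases "\<tau> \<le> t") auto
qed

lemma cv_causal:
  assumes "\<And>\<tau>. \<tau> < 0 \<Longrightarrow> f \<tau> = 0" "\<And>\<tau>. \<tau> < 0 \<Longrightarrow> g \<tau> = 0" "t < 0"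
  shows "cv f g t = 0"
  using cv_cong[of f t g "\<lambda>_. 0"] assms by (simp add: cv_def)

lemma cv_add:
  assumes "integrable lborel f" "g \<in> borel_measurable borel" "\<And>x. \<bar>g x\<bar> \<le> B"
    "g' \<in> borel_measurable borel" "\<And>x. \<bar>g' x\<bar> \<le> B'"
  shows "cv f (\<lambda>x. c * g x + c' * g' x) t = c * cv f g t + c' * cv f g' t"
proof -
  have "cv f (\<lambda>x. c * g x + c' * g' x) t
     = (LINT \<tau>|lborel. c * (f (t - \<tau>) * g \<tau>) + c' * (f (t - \<tau>) * g' \<tau>))"
    unfolding cv_def by (rule Bochner_Integration.integral_cong) (auto simp: algebra_simps)
  also have "\<dots> = c * cv f g t + c' * cv f g' t"
    unfolding cv_def
    using cv_integrable[OF assms(1,2,3)] cv_integrable[OF assms(1,4,5)]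
    by (subst Bochner_Integration.integral_add) auto
  finally show ?thesis .
qed

text \<open>Because \<open>h\<close> is bounded, the double integral converges absolutely for each
  fixed \<open>t\<close>, and the identity holds at every \<open>t\<close>. Points where the
  integral defining \<open>cv f g\<close> does not exist cause no harm: they only appear under
  another integral.\<close>

lemma cv_assoc:
  assumes f: "integrable lborel f" and g: "integrable lborel g"
    and h: "h \<in> borel_measurable borel" "\<And>x. \<bar>h x\<bar> \<le> B"
  shows "cv f (cv g h) t = cv (cv f g) h t"
proof -
  note [measurable] = h(1)
  have [measurable]: "f \<in> borel_measurable borel" "g \<in> borel_measurable borel" using f g by auto
  define F where "F = (\<lambda>(\<tau>, \<sigma>). f (t - \<tau>) * (g (\<tau> - \<sigma>) * h \<sigma>))"
  have [measurable]: "F \<in> borel_measurable (lborel \<Otimes>\<^sub>M lborel)" unfolding F_def by measurable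
  have nF: "(LINT \<sigma>|lborel. norm (F (\<tau>, \<sigma>))) \<le> \<bar>f (t - \<tau>)\<bar> * ((LINT x|lborel. \<bar>g x\<bar>) * B)" for \<tau>
  proof -
    have "(LINT \<sigma>|lborel. norm (F (\<tau>, \<sigma>))) = \<bar>f (t - \<tau>)\<bar> * cv (\<lambda>x. \<bar>g x\<bar>) (\<lambda>x. \<bar>h x\<bar>) \<tau>"
      by (simp add: F_def cv_def abs_mult)
    also have "\<dots> \<le> \<bar>f (t - \<tau>)\<bar> * ((LINT x|lborel. \<bar>g x\<bar>) * B)"
      using cv_abs_le[of "\<lambda>x. \<bar>g x\<bar>" "\<lambda>x. \<bar>h x\<bar>" B \<tau>] g h by (intro mult_left_mono) auto
    finally show ?thesis .
  qed
  have int: "integrable (lborel \<Otimes>\<^sub>M lborel) F"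
  proof (rule lborel_pair.Fubini_integrable)
    show "integrable lborel (\<lambda>\<tau>. LINT \<sigma>|lborel. norm (F (\<tau>, \<sigma>)))"
    proof (rule Bochner_Integration.integrable_bound)
      show "integrable lborel (\<lambda>\<tau>. \<bar>f (t - \<tau>)\<bar> * ((LINT x|lborel. \<bar>g x\<bar>) * B))"
        using integrable_reflect[OF f, of t] by auto
      show "AE \<tau> in lborel. norm (LINT \<sigma>|lborel. norm (F (\<tau>, \<sigma>)))
          \<le> norm (\<bar>f (t - \<tau>)\<bar> * ((LINT x|lborel. \<bar>g x\<bar>) * B))"
        using nF by (intro AE_I2) (smt (verit) integral_nonneg_AE AE_I2 norm_ge_zero real_norm_def)
    qed measurable
    show "AE \<tau> in lborel. integrable lborel (\<lambda>\<sigma>. F (\<tau>, \<sigma>))"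
      using cv_integrable[OF g h] by (simp add: F_def)
  qed measurable
  have "cv f (cv g h) t = (LINT \<tau>|lborel. LINT \<sigma>|lborel. F (\<tau>, \<sigma>))"
    by (simp add: cv_def F_def)
  also have "\<dots> = (LINT \<sigma>|lborel. LINT \<tau>|lborel. F (\<tau>, \<sigma>))"
    using lborel_pair.Fubini_integral[of "\<lambda>\<tau> \<sigma>. F (\<tau>, \<sigma>)"] int by simp
  also have "\<dots> = (LINT \<sigma>|lborel. cv f g (t - \<sigma>) * h \<sigma>)"
  proof (rule Bochner_Integration.integral_cong[OF refl])
    fix \<sigma>
    have "(LINT \<tau>|lborel. F (\<tau>, \<sigma>)) = (LINT \<tau>|lborel. f (t - \<tau>) * g (\<tau> - \<sigma>)) * h \<sigma>"
      by (simp add: F_def mult.assoc[symmetric])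
    also have "(LINT \<tau>|lborel. f (t - \<tau>) * g (\<tau> - \<sigma>)) = cv f g (t - \<sigma>)"
      using lborel_integral_real_affine[of 1 "\<lambda>\<tau>. f (t - \<tau>) * g (\<tau> - \<sigma>)" \<sigma>]
      by (simp add: cv_def algebra_simps)
    finally show "(LINT \<tau>|lborel. F (\<tau>, \<sigma>)) = cv f g (t - \<sigma>) * h \<sigma>" .
  qed
  finally show ?thesis by (simp add: cv_def)
qed

lemma cv_exchange:
  assumes f: "integrable lborel f" and g: "integrable lborel g"
    and h: "h \<in> borel_measurable borel" "\<And>x. \<bar>h x\<bar> \<le> B"
  shows "cv f (cv g h) t = cv g (cv f h) t"
proof -
  have "cv f g = cv g f" using cv_commute by auto
  then show ?thesis using cv_assoc[OF f g h] cv_assoc[OF g f h] by simp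
qed

text \<open>Dominated convergence after moving the shift onto \<open>g\<close>. The exceptional set
  \<open>F\<close> accommodates the jumps that truncation to \<open>{0..T}\<close> produces at both
  ends.\<close>

lemma cv_continuous:
  assumes f: "integrable lborel f" and g: "g \<in> borel_measurable borel" "\<And>x. \<bar>g x\<bar> \<le> B"
    and F: "finite F" "\<And>x. x \<notin> F \<Longrightarrow> isCont g x"
  shows "continuous_on UNIV (cv f g)"
proof (rule continuous_on_sequentiallyI)
  note [measurable] = g(1)
  have [measurable]: "f \<in> borel_measurable borel" using f by auto
  fix X :: "nat \<Rightarrow> real" and t assume X: "X \<longlonglongrightarrow> t"
  have "(\<lambda>n. LINT \<tau>|lborel. g (X n - \<tau>) * f \<tau>) \<longlonglongrightarrow> (LINT \<tau>|lborel. g (t - \<tau>) * f \<tau>)"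
  proof (rule integral_dominated_convergence[where w="\<lambda>\<tau>. B * \<bar>f \<tau>\<bar>"])
    show "integrable lborel (\<lambda>\<tau>. B * \<bar>f \<tau>\<bar>)" using f by auto
    show "AE \<tau> in lborel. norm (g (X n - \<tau>) * f \<tau>) \<le> B * \<bar>f \<tau>\<bar>" for n
      using g(2) by (intro AE_I2) (auto simp: abs_mult mult_right_mono)
    have "countable ((\<lambda>x. t - x) ` F)" using F(1) by (simp add: countable_finite)
    then have "AE \<tau> in lborel. \<tau> \<notin> (\<lambda>x. t - x) ` F"
      using countable_imp_null_set_lborel AE_not_in by blast
    then show "AE \<tau> in lborel. (\<lambda>n. g (X n - \<tau>) * f \<tau>) \<longlonglongrightarrow> g (t - \<tau>) * f \<tau>"
    proof eventually_elim
      case (elim \<tau>)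
      then have "t - \<tau> \<notin> F" by force
      then show ?case using F(2) X
        by (intro tendsto_mult tendsto_const isCont_tendsto_compose[where g=g] tendsto_diff) auto
    qed
  qed measurable
  then show "(\<lambda>n. cv f g (X n)) \<longlonglongrightarrow> cv f g t"
    unfolding cv_commute[of f g] by (simp add: cv_def)
qed

section \<open>Exponential weights and stability of Volterra equations\<close>

text \<open>The weight tends to \<open>0\<close> pointwise on the positive axis and is at most
  \<open>1\<close> there, so dominated convergence shrinks the weighted mass of the kernel. This
  turns a Volterra operator into a contraction on an interval of any length.\<close>

lemma exp_weight_small:
  fixes a :: "real \<Rightarrow> real"
  assumes a: "integrable lborel a" "\<And>t. t < 0 \<Longrightarrow> a t = 0" and e: "e > 0"
  obtains w where "w \<ge> 0" "integrable lborel (\<lambda>\<tau>. \<bar>a \<tau>\<bar> * exp (- w * \<tau>))"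
    "(LINT \<tau>|lborel. \<bar>a \<tau>\<bar> * exp (- w * \<tau>)) < e"
proof -
  have [measurable]: "a \<in> borel_measurable borel" using a(1) by auto
  have bound: "\<bar>a \<tau>\<bar> * exp (- real n * \<tau>) \<le> \<bar>a \<tau>\<bar>" for n \<tau>
    using a(2)[of \<tau>] by (cases "\<tau> < 0") (auto intro!: mult_left_le)
  have "(\<lambda>n. LINT \<tau>|lborel. \<bar>a \<tau>\<bar> * exp (- real n * \<tau>)) \<longlonglongrightarrow> (LINT \<tau>::real|lborel. (0::real))"
  proof (rule integral_dominated_convergence[where w="\<lambda>\<tau>. \<bar>a \<tau>\<bar>"])
    show "AE \<tau> in lborel. (\<lambda>n. \<bar>a \<tau>\<bar> * exp (- real n * \<tau>)) \<longlonglongrightarrow> 0"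
      using AE_lborel_singleton[of "0::real"]
    proof eventually_elim
      case (elim \<tau>)
      show ?case
      proof (cases "\<tau> < 0")
        case False
        then have t: "\<tau> > 0" using elim by auto
        have "(\<lambda>n. exp (- real n * \<tau>)) \<longlonglongrightarrow> 0" using t by real_asymp
        from tendsto_mult_left[OF this, of "\<bar>a \<tau>\<bar>"] show ?thesis by simp
      qed (use a in auto)
    qed
  qed (use a bound in auto)
  then have "eventually (\<lambda>n. (LINT \<tau>|lborel. \<bar>a \<tau>\<bar> * exp (- real n * \<tau>)) < e) sequentially"
    using e by (simp add: order_tendstoD(2))
  then obtain n where "(LINT \<tau>|lborel. \<bar>a \<tau>\<bar> * exp (- real n * \<tau>)) < e"
    by (auto simp: eventually_sequentially)
  moreover have "integrable lborel (\<lambda>\<tau>. \<bar>a \<tau>\<bar> * exp (- real n * \<tau>))"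
    by (rule Bochner_Integration.integrable_bound[OF a(1)]) (use bound in \<open>auto simp: abs_mult\<close>)
  ultimately show ?thesis using that[of "real n"] by auto
qed

lemma cv_weighted_bound:
  assumes a: "integrable lborel a" "\<And>t. t < 0 \<Longrightarrow> a t = 0"
    and w: "integrable lborel (\<lambda>\<tau>. \<bar>a \<tau>\<bar> * exp (- w * \<tau>))"
    and d: "\<And>x. x < 0 \<Longrightarrow> d x = 0" "\<And>x. 0 \<le> x \<Longrightarrow> x \<le> t \<Longrightarrow> \<bar>d x\<bar> \<le> D * exp (w * x)" and D: "D \<ge> 0"
  shows "\<bar>cv a d t\<bar> \<le> D * exp (w * t) * (LINT \<tau>|lborel. \<bar>a \<tau>\<bar> * exp (- w * \<tau>))"
proof (cases "integrable lborel (\<lambda>\<tau>. d (t - \<tau>) * a \<tau>)")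
  case True
  have "\<bar>cv a d t\<bar> \<le> (LINT \<tau>|lborel. \<bar>d (t - \<tau>) * a \<tau>\<bar>)"
    unfolding cv_commute[of a d] unfolding cv_def by (rule integral_abs_bound)
  also have "\<dots> \<le> (LINT \<tau>|lborel. D * exp (w * t) * (\<bar>a \<tau>\<bar> * exp (- w * \<tau>)))"
  proof (rule integral_mono)
    fix \<tau>
    consider "\<tau> < 0" | "t < \<tau>" | "0 \<le> \<tau>" "\<tau> \<le> t" by linarith
    then show "\<bar>d (t - \<tau>) * a \<tau>\<bar> \<le> D * exp (w * t) * (\<bar>a \<tau>\<bar> * exp (- w * \<tau>))"
    proof cases
      case 3
      then have "\<bar>d (t - \<tau>)\<bar> * \<bar>a \<tau>\<bar> \<le> D * exp (w * (t - \<tau>)) * \<bar>a \<tau>\<bar>"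
        using d(2)[of "t - \<tau>"] by (intro mult_right_mono) auto
      also have "\<dots> = D * exp (w * t) * (\<bar>a \<tau>\<bar> * exp (- w * \<tau>))"
        by (simp add: right_diff_distrib exp_diff exp_minus field_simps)
      finally show ?thesis by (simp add: abs_mult)
    qed (use a d D in auto)
  qed (use True w in auto)
  also have "\<dots> = D * exp (w * t) * (LINT \<tau>|lborel. \<bar>a \<tau>\<bar> * exp (- w * \<tau>))" by simp
  finally show ?thesis .
next
  \<comment> \<open>\<open>d\<close> carries no measurability assumption; if the integrand is not
    integrable, its Bochner integral is \<open>0\<close> and the bound is trivial.\<close>
  case False
  then show ?thesis using D
    unfolding cv_commute[of a d] unfolding cv_def by (simp add: not_integrable_integral_eq integral_nonneg_AE)
qed

text \<open>In the norm given by the supremum of \<open>\<bar>d x\<bar> * exp (- w * x)\<close>, the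
  convolution times \<nu> has norm at most \<open>1/2\<close>, so it can be absorbed; undoing the
  weight costs \<open>exp (w * T)\<close>. The bound \<open>B\<close> only makes this supremum
  finite and does not enter \<open>C\<close>. Dividing by \<open>\<nu> + 1\<close> rather than \<nu>
  in the choice of \<open>w\<close> covers \<open>\<nu> = 0\<close>.\<close>

lemma volterra_stability:
  assumes a: "integrable lborel a" "\<And>t. t < 0 \<Longrightarrow> a t = 0" and \<nu>: "\<nu> \<ge> 0" and T: "T \<ge> 0"
  obtains C where "C \<ge> 0"
    "\<And>d B e t. \<lbrakk>\<And>x. \<bar>d x\<bar> \<le> B; \<And>x. x < 0 \<Longrightarrow> d x = 0;
       \<And>x. 0 \<le> x \<Longrightarrow> x \<le> T \<Longrightarrow> \<bar>d x + \<nu> * cv a d x\<bar> \<le> e; 0 \<le> t; t \<le> T\<rbrakk> \<Longrightarrow> \<bar>d t\<bar> \<le> C * e"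
proof -
  obtain w where w: "w \<ge> 0" and iw: "integrable lborel (\<lambda>\<tau>. \<bar>a \<tau>\<bar> * exp (- w * \<tau>))"
    and lw: "(LINT \<tau>|lborel. \<bar>a \<tau>\<bar> * exp (- w * \<tau>)) < 1 / (2 * (\<nu> + 1))" (is "?L < _")
    using exp_weight_small[OF a, of "1 / (2 * (\<nu> + 1))"] \<nu> by auto
  have L: "?L \<ge> 0" by (rule integral_nonneg_AE) auto
  have "\<nu> * ?L \<le> \<nu> * (1 / (2 * (\<nu> + 1)))" using lw \<nu> by (intro mult_left_mono) auto
  also have "\<dots> \<le> 1/2" using \<nu> by (simp add: field_simps)
  finally have nL: "\<nu> * ?L \<le> 1/2" .
  show ?thesis
  proof (rule that[of "2 * exp (w * T)"])
    fix d :: "real \<Rightarrow> real" and B e t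
    assume B: "\<And>x. \<bar>d x\<bar> \<le> B" and d0: "\<And>x. x < 0 \<Longrightarrow> d x = 0"
      and eq: "\<And>x. 0 \<le> x \<Longrightarrow> x \<le> T \<Longrightarrow> \<bar>d x + \<nu> * cv a d x\<bar> \<le> e" and t: "0 \<le> t" "t \<le> T"
    define D where "D = (SUP x\<in>{0..T}. \<bar>d x\<bar> * exp (- w * x))"
    have bdd: "bdd_above ((\<lambda>x. \<bar>d x\<bar> * exp (- w * x)) ` {0..T})"
    proof (rule bdd_aboveI2)
      fix x assume "x \<in> {0..T}"
      then show "\<bar>d x\<bar> * exp (- w * x) \<le> B * 1" using B[of x] w by (intro mult_mono) auto
    qed
    have le: "\<bar>d x\<bar> * exp (- w * x) \<le> D" if "0 \<le> x" "x \<le> T" for x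
      unfolding D_def using that by (intro cSUP_upper bdd) auto
    have D: "D \<ge> 0" using le[of 0] T abs_ge_zero[of "d 0"] by simp
    have le': "\<bar>d x\<bar> \<le> D * exp (w * x)" if "0 \<le> x" "x \<le> T" for x
      using le[OF that] by (simp add: exp_minus field_simps)
    have "\<bar>d x\<bar> * exp (- w * x) \<le> e + D / 2" if x: "0 \<le> x" "x \<le> T" for x
    proof -
      have "\<bar>cv a d x\<bar> \<le> D * exp (w * x) * ?L"
        using le' x by (intro cv_weighted_bound[OF a iw d0]) (auto simp: D)
      then have "\<nu> * \<bar>cv a d x\<bar> \<le> \<nu> * (D * exp (w * x) * ?L)" using \<nu> by (rule mult_left_mono)
      also have "\<dots> = D * exp (w * x) * (\<nu> * ?L)" by simp
      also have "\<dots> \<le> D * exp (w * x) * (1/2)" using nL D by (intro mult_left_mono) auto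
      finally have 1: "\<bar>\<nu> * cv a d x\<bar> \<le> D * exp (w * x) * (1/2)" using \<nu> by (simp add: abs_mult)
      have "\<bar>d x\<bar> \<le> e + D * exp (w * x) * (1/2)" using eq[OF x] 1 by linarith
      then have "\<bar>d x\<bar> * exp (- w * x) \<le> (e + D * exp (w * x) * (1/2)) * exp (- w * x)"
        by (intro mult_right_mono) auto
      also have "\<dots> = e * exp (- w * x) + D / 2" by (simp add: exp_minus field_simps)
      also have "e * exp (- w * x) \<le> e"
        using w x eq[of 0] T by (intro mult_left_le) auto
      finally show ?thesis by simp
    qed
    then have "D \<le> e + D / 2" unfolding D_def using T by (intro cSUP_least) auto
    then have De: "D \<le> 2 * e" by simp
    have "\<bar>d t\<bar> \<le> D * exp (w * t)" using le' t by auto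
    also have "\<dots> \<le> 2 * e * exp (w * T)" using De D t w by (intro mult_mono) (auto intro: mult_left_mono)
    finally show "\<bar>d t\<bar> \<le> 2 * exp (w * T) * e" by (simp add: mult_ac)
  qed simp
qed

section \<open>Volterra equations\<close>

lemma continuous_on_atLeastI:
  fixes f :: "real \<Rightarrow> real"
  assumes "\<And>T. T > 0 \<Longrightarrow> continuous_on {0..T} f"
  shows "continuous_on {0..} f"
  unfolding continuous_on_eq_continuous_within
proof
  fix x :: real assume x: "x \<in> {0..}"
  have "continuous (at x within {0..x+1}) f"
    using assms[of "x+1"] x by (auto simp: continuous_on_eq_continuous_within)
  moreover have "at x within {0..x+1} = at x within {0..}"
    by (rule at_within_nhd[where S="{..<x+1}"]) auto
  ultimately show "continuous (at x within {0..}) f" by simp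
qed

lemma isCont_truncate:
  fixes g :: "real \<Rightarrow> real"
  assumes "continuous_on {0..T} g" "x \<notin> {0, T}"
  shows "isCont (\<lambda>x. indicator {0..T} x * g x) x"
proof -
  consider "x < 0" | "x > T" | "0 < x" "x < T" using assms(2) by fastforce
  then show ?thesis
  proof cases
    case 1
    have "eventually (\<lambda>y. y \<in> {..<0}) (nhds x)" using 1 by (intro eventually_nhds_in_open) auto
    then have "eventually (\<lambda>y. indicator {0..T} y * g y = 0) (nhds x)" by eventually_elim auto
    then have "isCont (\<lambda>y. indicator {0..T} y * g y) x \<longleftrightarrow> isCont (\<lambda>_. 0::real) x" by (rule isCont_cong)
    then show ?thesis by simp
  next
    case 2
    have "eventually (\<lambda>y. y \<in> {T<..}) (nhds x)" using 2 by (intro eventually_nhds_in_open) auto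
    then have "eventually (\<lambda>y. indicator {0..T} y * g y = 0) (nhds x)" by eventually_elim auto
    then have "isCont (\<lambda>y. indicator {0..T} y * g y) x \<longleftrightarrow> isCont (\<lambda>_. 0::real) x" by (rule isCont_cong)
    then show ?thesis by simp
  next
    case 3
    have "eventually (\<lambda>y. y \<in> {0<..<T}) (nhds x)" using 3 by (intro eventually_nhds_in_open) auto
    then have "eventually (\<lambda>y. indicator {0..T} y * g y = g y) (nhds x)" by eventually_elim auto
    then have "isCont (\<lambda>y. indicator {0..T} y * g y) x \<longleftrightarrow> isCont g x" by (rule isCont_cong)
    moreover have "isCont g x"
      using assms(1) 3 continuous_on_interior[of "{0..T}" g x] by (simp add: interior_atLeastAtMost_real)
    ultimately show ?thesis by simp
  qed
qed

text \<open>Neumann series: the iterates are repeated convolutions of the unit step with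
  \<open>a\<close>, and an exponential weight makes the terms decay like \<open>(1/2) ^ n\<close> on
  each \<open>{0..T}\<close>. As \<open>a\<close> is only locally integrable, every estimate is made
  with kernel and iterates truncated at \<open>T\<close>. The partial sums satisfy an exact shifted
  identity, which passes to the limit by dominated convergence.\<close>

lemma volterra_exists:
  fixes a :: "real \<Rightarrow> real"
  assumes am[measurable]: "a \<in> borel_measurable borel" and a0: "\<And>t. t < 0 \<Longrightarrow> a t = 0"
    and loc: "\<And>T. integrable lborel (\<lambda>t. indicator {..T} t * a t)" and \<nu>: "\<nu> \<ge> 0"
  obtains s where "continuous_on {0..} s" "\<And>t. t \<ge> 0 \<Longrightarrow> s t + \<nu> * cv a (\<lambda>t. indicator {0..} t * s t) t = 1"
proof -
  define aT where "aT T = (\<lambda>t. indicator {..T} t * a t)" for T :: real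
  have aT: "integrable lborel (aT T)" "t < 0 \<Longrightarrow> aT T t = 0" for T t using loc a0 by (auto simp: aT_def)
  have trunc: "cv a g t = cv (aT T) g' t"
    if "\<And>x. x < 0 \<Longrightarrow> g x = 0" "\<And>x. 0 \<le> x \<Longrightarrow> x \<le> t \<Longrightarrow> g' x = g x" "\<And>x. x < 0 \<Longrightarrow> g' x = 0" "t \<le> T" for g g' t T
  proof -
    have "cv a g t = cv g (aT T) t"
      unfolding cv_commute[of a g] by (rule cv_cong) (use that in \<open>auto simp: aT_def\<close>)
    also have "\<dots> = cv (aT T) g' t"
      unfolding cv_commute[of g] 
      by (rule cv_cong) (use aT that in \<open>auto, metis not_less\<close>)
    finally show ?thesis .
  qed
  define A :: "nat \<Rightarrow> real \<Rightarrow> real" where "A = rec_nat (indicator {0..}) (\<lambda>_. cv a)"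
  have A0: "A 0 = indicator {0..}" and AS: "A (Suc n) = cv a (A n)" for n
    by (auto simp: A_def)
  have Am[measurable]: "A n \<in> borel_measurable borel" for n
    by (induction n) (auto simp: A0 AS)
  have Aneg: "A n t = 0" if "t < 0" for n t
    using that by (induction n arbitrary: t) (auto simp: A0 AS intro!: cv_causal a0)
  define B where "B T n = (\<lambda>x. indicator {0..T} x * A n x)" for T n
  have ABt: "cv a (A n) t = cv (aT T) (B T n) t" if "t \<le> T" for n t T
    by (rule trunc) (use Aneg that in \<open>auto simp: B_def\<close>)
  have Bm[measurable]: "B T n \<in> borel_measurable borel" for T n unfolding B_def by measurable
  have bdd: "\<exists>K. \<forall>x. \<bar>B T n x\<bar> \<le> K" if c: "continuous_on {0..T} (A n)" for T n
  proof -
    have "bounded (A n ` {0..T})" using c by (intro compact_imp_bounded compact_continuous_image) auto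
    then obtain K where "\<forall>x\<in>{0..T}. \<bar>A n x\<bar> \<le> K" by (auto simp: bounded_iff)
    then have "\<bar>B T n x\<bar> \<le> \<bar>K\<bar>" for x by (force simp: B_def indicator_def)
    then show ?thesis by blast
  qed
  have Ac: "continuous_on {0..T} (A n)" for n T
  proof (induction n)
    case 0
    show ?case unfolding A0 by (rule continuous_on_eq[OF continuous_on_const[of _ 1]]) auto
  next
    case (Suc n)
    obtain K where K: "\<And>x. \<bar>B T n x\<bar> \<le> K" using bdd[OF Suc] by blast
    have "continuous_on UNIV (cv (aT T) (B T n))"
      by (rule cv_continuous[OF aT(1) Bm K, where F="{0,T}"]) (auto simp: B_def intro!: isCont_truncate Suc)
    then have "continuous_on {0..T} (cv (aT T) (B T n))" by (rule continuous_on_subset) auto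
    then show ?case by (rule continuous_on_eq) (use ABt in \<open>auto simp: AS\<close>)
  qed
  have bddB: "\<exists>K. \<forall>x. \<bar>B T n x\<bar> \<le> K" for T n using bdd[OF Ac] .
  define S where "S N t = (\<Sum>n<N. (- \<nu>) ^ n * A n t)" for N t
  define s where "s t = (\<Sum>n. (- \<nu>) ^ n * A n t)" for t
  have Sm[measurable]: "S N \<in> borel_measurable borel" for N unfolding S_def by measurable
  have Sneg: "S N t = 0" if "t < 0" for N t using that by (simp add: S_def Aneg)
  have bound: "\<exists>C. \<forall>n. \<forall>t\<in>{0..T}. \<bar>(- \<nu>) ^ n * A n t\<bar> \<le> C * (1/2) ^ n" if T: "T > 0" for T
  proof -
    define e where "e = 1 / (2 * (\<nu> + 1))"
    have e: "e > 0" "\<nu> * e \<le> 1/2" using \<nu> by (auto simp: e_def field_simps)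
    obtain w where w: "w \<ge> 0" and iw: "integrable lborel (\<lambda>\<tau>. \<bar>aT T \<tau>\<bar> * exp (- w * \<tau>))"
      and lw: "(LINT \<tau>|lborel. \<bar>aT T \<tau>\<bar> * exp (- w * \<tau>)) < e" (is "?L < _")
      by (rule exp_weight_small[of "aT T" e, OF aT(1) aT(2) e(1)])
    have A: "\<bar>A n t\<bar> \<le> e ^ n * exp (w * t)" if "t \<in> {0..T}" for n t
      using that
    proof (induction n arbitrary: t)
      case 0
      then show ?case using w by (simp add: A0)
    next
      case (Suc n)
      have "\<bar>cv (aT T) (B T n) t\<bar> \<le> e ^ n * exp (w * t) * ?L"
        by (rule cv_weighted_bound[OF aT(1) aT(2) iw]) (use Suc e in \<open>auto simp: B_def\<close>)
      also have "\<dots> \<le> e ^ n * exp (w * t) * e" using lw e by (intro mult_left_mono) auto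
      finally show ?case using ABt[of t T n] Suc by (simp add: AS mult_ac)
    qed
    show ?thesis
    proof (intro exI allI ballI)
      fix n t assume t: "t \<in> {0..T}"
      have "\<bar>(- \<nu>) ^ n * A n t\<bar> \<le> \<nu> ^ n * (e ^ n * exp (w * t))"
        using A[OF t, of n] \<nu> by (simp add: abs_mult power_abs mult_left_mono)
      also have "\<dots> = (\<nu> * e) ^ n * exp (w * t)" by (simp add: power_mult_distrib)
      also have "\<dots> \<le> (1/2) ^ n * exp (w * T)" using t e w \<nu> 
        by (intro mult_mono power_mono) (auto intro: mult_left_mono)
      finally show "\<bar>(- \<nu>) ^ n * A n t\<bar> \<le> exp (w * T) * (1/2) ^ n" by (simp add: mult.commute)
    qed
  qed
  have unif: "uniform_limit {0..T} S s sequentially" if T: "T > 0" for T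
  proof -
    obtain C where C: "\<And>n t. t \<in> {0..T} \<Longrightarrow> \<bar>(- \<nu>) ^ n * A n t\<bar> \<le> C * (1/2) ^ n"
      using bound[OF T] by blast
    show ?thesis unfolding S_def s_def
      by (rule Weierstrass_m_test[where M="\<lambda>n. C * (1/2) ^ n"])
         (use C in \<open>auto intro!: summable_mult summable_geometric\<close>)
  qed
  have cont: "continuous_on {0..T} s" if T: "T > 0" for T
  proof (rule uniform_limit_theorem[OF _ unif[OF T]])
    show "\<forall>\<^sub>F n in sequentially. continuous_on {0..T} (S n)"
      unfolding S_def by (intro always_eventually allI continuous_intros Ac)
  qed simp
  show ?thesis
  proof (rule that[of s])
    show "continuous_on {0..} s" by (rule continuous_on_atLeastI[OF cont])
    fix t :: real assume t: "t \<ge> 0"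
    \<comment> \<open>A positive horizon also at \<open>t = 0\<close>, as the uniform bounds are
      stated for \<open>T > 0\<close>.\<close>
    define T where "T = t + 1"
    have T: "T > 0" "t \<le> T" using t by (auto simp: T_def)
    obtain C where C: "\<And>n t. t \<in> {0..T} \<Longrightarrow> \<bar>(- \<nu>) ^ n * A n t\<bar> \<le> C * (1/2) ^ n"
      using bound[OF T(1)] by blast
    let ?R = "\<lambda>N x. indicator {0..T} x * S N x"
    have step: "S (Suc N) t + \<nu> * cv (aT T) (?R N) t = 1" for N
    proof -
      have "cv (aT T) (?R N) t = (LINT \<tau>|lborel. (\<Sum>n<N. (- \<nu>) ^ n * (aT T (t - \<tau>) * B T n \<tau>)))"
        unfolding cv_def S_def B_def by (rule Bochner_Integration.integral_cong) (auto simp: sum_distrib_left mult_ac)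
      also have "\<dots> = (\<Sum>n<N. (- \<nu>) ^ n * cv (aT T) (B T n) t)"
      proof (subst Bochner_Integration.integral_sum)
        fix n
        obtain K where "\<And>x. \<bar>B T n x\<bar> \<le> K" using bddB by blast
        from cv_integrable[OF aT(1) Bm this]
        show "integrable lborel (\<lambda>\<tau>. (- \<nu>) ^ n * (aT T (t - \<tau>) * B T n \<tau>))" by auto
      qed (auto simp: cv_def)
      also have "\<dots> = (\<Sum>n<N. (- \<nu>) ^ n * A (Suc n) t)" using ABt[OF T(2)] by (simp add: AS)
      finally have 1: "cv (aT T) (?R N) t = (\<Sum>n<N. (- \<nu>) ^ n * A (Suc n) t)" .
      have 2: "S (Suc N) t = 1 + (\<Sum>n<N. (- \<nu>) ^ Suc n * A (Suc n) t)"
        unfolding S_def using t by (subst sum.lessThan_Suc_shift) (simp add: A0)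
      show ?thesis unfolding 1 2 by (simp add: sum_distrib_left sum_negf mult_ac)
    qed
    have Sb: "\<bar>?R N x\<bar> \<le> \<bar>C\<bar> * 2" for N x
    proof (cases "x \<in> {0..T}")
      case True
      have "\<bar>S N x\<bar> \<le> (\<Sum>n<N. \<bar>(- \<nu>) ^ n * A n x\<bar>)" unfolding S_def by (rule sum_abs)
      also have "\<dots> \<le> (\<Sum>n<N. \<bar>C\<bar> * (1/2) ^ n)"
        by (intro sum_mono order_trans[OF C[OF True]] mult_right_mono) auto
      also have "\<dots> \<le> \<bar>C\<bar> * 2"
        unfolding sum_distrib_left[symmetric]
        by (intro mult_left_mono) (auto simp: sum_gp_strict)
      finally show ?thesis using True by simp
    qed auto
    have lim: "(\<lambda>N. S N x) \<longlonglongrightarrow> s x" if "x \<in> {0..T}" for x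
      using tendsto_uniform_limitI[OF unif[OF T(1)] that] .
    have limR: "(\<lambda>N. ?R N x) \<longlonglongrightarrow> indicator {0..T} x * s x" for x
      using lim[of x] by (cases "x \<in> {0..T}") auto
    have "(\<lambda>N. cv (aT T) (?R N) t) \<longlonglongrightarrow> cv (aT T) (\<lambda>x. indicator {0..T} x * s x) t"
      unfolding cv_def
    proof (rule integral_dominated_convergence[where w="\<lambda>\<tau>. \<bar>aT T (t - \<tau>)\<bar> * (\<bar>C\<bar> * 2)"])
      have [measurable]: "aT T \<in> borel_measurable borel" using aT(1) by auto
      have sm: "(\<lambda>x. indicator {0..T} x * s x) \<in> borel_measurable lborel"
        using borel_measurable_continuous_on_indicator[OF _ cont[OF T(1)]] by simp
      show "(\<lambda>\<tau>. aT T (t - \<tau>) * (indicator {0..T} \<tau> * s \<tau>)) \<in> borel_measurable lborel"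
        by (rule borel_measurable_times[OF _ sm]) measurable
      show "(\<lambda>\<tau>. aT T (t - \<tau>) * ?R N \<tau>) \<in> borel_measurable lborel" for N by measurable
      show "integrable lborel (\<lambda>\<tau>. \<bar>aT T (t - \<tau>)\<bar> * (\<bar>C\<bar> * 2))"
        using integrable_reflect[OF aT(1)] by auto
      show "AE x in lborel. norm (aT T (t - x) * (?R N x)) \<le> \<bar>aT T (t - x)\<bar> * (\<bar>C\<bar> * 2)" for N
        unfolding real_norm_def abs_mult[of "aT T _"] using Sb[of _ N] by (intro AE_I2 mult_left_mono) auto
      show "AE x in lborel. (\<lambda>N. aT T (t - x) * ?R N x) \<longlonglongrightarrow> aT T (t - x) * (indicator {0..T} x * s x)"
        by (rule AE_I2, rule tendsto_mult[OF tendsto_const limR])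
    qed
    moreover have "(\<lambda>N. S (Suc N) t) \<longlonglongrightarrow> s t" using lim[of t] t T LIMSEQ_Suc by auto
    ultimately have "(\<lambda>N. S (Suc N) t + \<nu> * cv (aT T) (?R N) t) 
        \<longlonglongrightarrow> s t + \<nu> * cv (aT T) (\<lambda>x. indicator {0..T} x * s x) t"
      by (intro tendsto_intros)
    then have "s t + \<nu> * cv (aT T) (\<lambda>x. indicator {0..T} x * s x) t = 1"
      unfolding step using LIMSEQ_unique tendsto_const by blast
    moreover have "cv a (\<lambda>t. indicator {0..} t * s t) t = cv (aT T) (\<lambda>x. indicator {0..T} x * s x) t"
      by (rule trunc) (use T in auto)
    ultimately show "s t + \<nu> * cv a (\<lambda>t. indicator {0..} t * s t) t = 1" by simp
  qed
qed

section \<open>Borel representatives and the convolution on the half-line\<close>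

text \<open>\<open>L1_loc\<close> allows Lebesgue measurable functions, whereas joint measurability
  in convolutions calls for Borel ones. The completion provides a Borel function equal almost
  everywhere, and cutting it off on the negative axis makes it causal.\<close>

lemma L1_loc_representative:
  assumes "L1_loc f"
  obtains g where "g \<in> borel_measurable borel" "\<And>t. t < 0 \<Longrightarrow> g t = 0"
    "\<And>T. integrable lborel (\<lambda>t. indicator {..T} t * g t)" "AE t in lborel. 0 \<le> t \<longrightarrow> g t = f t"
proof -
  have int: "integrable lebesgue (\<lambda>t. indicator {0..T} t * f t)" if "T > 0" for T
    using assms that by (auto simp: L1_loc_def set_integrable_def)
  have "(\<lambda>t. indicator {0..} t * f t) \<in> borel_measurable lebesgue"
  proof (rule borel_measurable_LIMSEQ_real)
    show "(\<lambda>n. indicator {0..real (Suc n)} t * f t) \<longlonglongrightarrow> indicator {0..} t * f t" for t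
    proof (rule tendsto_eventually)
      obtain N :: nat where N: "t \<le> real N" using real_arch_simple by blast
      show "\<forall>\<^sub>F n in sequentially. indicator {0..real (Suc n)} t * f t = indicator {0..} t * f t"
        using eventually_ge_at_top[of N] by eventually_elim (use N in \<open>auto simp: indicator_def\<close>)
    qed
    show "(\<lambda>t. indicator {0..real (Suc n)} t * f t) \<in> borel_measurable lebesgue" for n
      using int[of "real (Suc n)"] by (intro borel_measurable_integrable) auto
  qed
  then obtain g' where g'[measurable]: "g' \<in> borel_measurable lborel"
    and ae: "AE t in lborel. indicator {0..} t * f t = g' t"
    using completion_ex_borel_measurable_real by blast
  define g where "g t = indicator {0..} t * g' t" for t
  have [measurable]: "g \<in> borel_measurable borel" unfolding g_def using g' by measurable
  have ae': "AE t in lborel. 0 \<le> t \<longrightarrow> g t = f t"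
    using ae by eventually_elim (auto simp: g_def)
  show ?thesis
  proof (rule that[of g])
    show "integrable lborel (\<lambda>t. indicator {..T} t * g t)" for T
    proof -
      \<comment> \<open>\<open>T\<close> may be nonpositive, but integrability is given on intervals
        of positive length. As \<open>g\<close> vanishes on the negative axis, the larger interval
        dominates.\<close>
      define T' where "T' = max T 1"
      have "integrable lebesgue (\<lambda>t. indicator {0..T'} t * g t) \<longleftrightarrow> integrable lebesgue (\<lambda>t. indicator {0..T'} t * f t)"
      proof (rule integrable_cong_AE)
        show "(\<lambda>t. indicator {0..T'} t * g t) \<in> borel_measurable lebesgue"
          by (intro measurable_completion) measurable
        show "(\<lambda>t. indicator {0..T'} t * f t) \<in> borel_measurable lebesgue"
          using int[of T'] by (intro borel_measurable_integrable) (auto simp: T'_def)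
        show "AE t in lebesgue. indicator {0..T'} t * g t = indicator {0..T'} t * f t"
          using AE_completion[OF ae'] by eventually_elim (auto simp: indicator_def)
      qed
      then have "integrable lebesgue (\<lambda>t. indicator {0..T'} t * g t)"
        using int[of T'] by (auto simp: T'_def)
      then have "integrable lborel (\<lambda>t. indicator {0..T'} t * g t)"
        by (subst (asm) integrable_completion) measurable
      then show ?thesis
        by (rule Bochner_Integration.integrable_bound)
           (auto simp: g_def T'_def indicator_def intro!: AE_I2)
    qed
  qed (use ae' in \<open>auto simp: g_def\<close>)
qed

lemma AE_reflect:
  fixes P :: "real \<Rightarrow> bool"
  assumes "AE x in lborel. P x"
  shows "AE x in lborel. P (t - x)"
proof -
  obtain N where N: "{x \<in> space lborel. \<not> P x} \<subseteq> N" "emeasure lborel N = 0" "N \<in> sets lborel"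
    by (rule AE_E[OF assms])
  then have N0: "N \<in> null_sets lborel" by auto
  have [measurable]: "N \<in> sets borel" using N by simp
  have "AE x in lborel. x \<notin> N" by (rule AE_not_in[OF N0])
  then have "AE x in lborel. t + (-1) * x \<notin> N" by (intro AE_borel_affine) auto
  then show ?thesis by eventually_elim (use N in auto)
qed

text \<open>This holds at every \<open>t\<close>: for fixed \<open>t\<close>, passing to
  representatives changes the integrand only on a null set of \<tau>, the exceptional set of the
  first factor being reflected.\<close>

lemma conv_eq_cv:
  assumes [measurable]: "g \<in> borel_measurable borel" "h \<in> borel_measurable borel"
    and g: "AE x in lborel. 0 \<le> x \<longrightarrow> g x = a x" "\<And>x. x < 0 \<Longrightarrow> g x = 0"
    and h: "AE x in lborel. 0 \<le> x \<longrightarrow> h x = b x" "\<And>x. x < 0 \<Longrightarrow> h x = 0"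
  shows "conv a b t = cv g h t"
proof -
  have ae: "AE \<tau> in lborel. g (t - \<tau>) * h \<tau> = indicator {0..t} \<tau> *\<^sub>R (a (t - \<tau>) * b \<tau>)"
    using AE_reflect[OF g(1), of t] h(1)
  proof eventually_elim
    case (elim \<tau>)
    then show ?case using g(2)[of "t - \<tau>"] h(2)[of \<tau>] by (auto simp: indicator_def)
  qed
  have m: "(\<lambda>\<tau>. g (t - \<tau>) * h \<tau>) \<in> borel_measurable lebesgue"
    by (intro measurable_completion) measurable
  have "conv a b t = (LINT \<tau>|lebesgue. g (t - \<tau>) * h \<tau>)"
    unfolding conv_def set_lebesgue_integral_def
  proof (rule integral_cong_AE)
    show "AE \<tau> in lebesgue. indicator {0..t} \<tau> *\<^sub>R (a (t - \<tau>) * b \<tau>) = g (t - \<tau>) * h \<tau>"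
      using AE_completion[OF ae] by eventually_elim simp
    show "(\<lambda>\<tau>. indicator {0..t} \<tau> *\<^sub>R (a (t - \<tau>) * b \<tau>)) \<in> borel_measurable lebesgue"
      by (rule borel_measurable_AE[OF m AE_completion[OF ae]])
  qed (rule m)
  also have "\<dots> = cv g h t" unfolding cv_def by (rule integral_completion) measurable
  finally show ?thesis .
qed

section \<open>Convergence of the scheme\<close>

declare euler.simps(2)[simp del]

lemma integrable_Ico:
  fixes k :: "real \<Rightarrow> real"
  shows "integrable lborel k \<Longrightarrow> integrable lborel (\<lambda>s. indicator {x..<y} s * k s)"
  using integrable_mult_indicator[of "{x..<y}" lborel k] by simp

lemma integrable_Icc: "integrable lborel (\<lambda>\<tau>::real. indicator {x..y} \<tau> * (c::real))"
  by (intro integrable_mult_left integrable_real_indicator) (auto simp: emeasure_lborel_Icc_eq)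

text \<open>Kernels \<open>a\<close> admitting such a pair of \<open>k\<close> and \<beta> are known
  as completely positive. A finite horizon \<open>T\<close> makes cut-off kernels integrable over
  the line; in exchange the identity is kept only below \<open>T\<close>.\<close>

locale cp_kernel =
  fixes a k :: "real \<Rightarrow> real" and \<beta> T :: real
  assumes a_int: "integrable lborel a" and a_neg: "\<And>t. t < 0 \<Longrightarrow> a t = 0"
    and k_int: "integrable lborel k" and k_nonneg: "\<And>t. 0 \<le> k t" and k_neg: "\<And>t. t \<le> 0 \<Longrightarrow> k t = 0"
    and k_antimono: "\<And>x y. 0 < x \<Longrightarrow> x \<le> y \<Longrightarrow> k y \<le> k x"
    and \<beta>: "\<beta> \<ge> 0" and T: "T > 0"
    and resolvent: "AE t in lborel. 0 < t \<and> t < T \<longrightarrow> \<beta> * a t + cv k a t = 1"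
begin

lemma a_meas[measurable]: "a \<in> borel_measurable borel"
  and k_meas[measurable]: "k \<in> borel_measurable borel"
  using a_int k_int by auto

definition \<kappa> :: "real \<Rightarrow> nat \<Rightarrow> real" where
  "\<kappa> h j = (LINT s|lborel. indicator {real j * h..<real (Suc j) * h} s * k s) / h"

text \<open>If \<open>k\<close> vanished almost everywhere near \<open>0\<close>, so would its
  convolution with \<open>a\<close>, and for \<open>\<beta> = 0\<close> the identity
  \<open>resolvent\<close> would read \<open>0 = 1\<close> there. This makes the denominator of the
  scheme positive when \<beta> does not.\<close>

lemma k_positive:
  assumes "h > 0" "\<beta> = 0"
  shows "(LINT s|lborel. indicator {0..<h} s * k s) \<noteq> 0"
proof
  assume "(LINT s|lborel. indicator {0..<h} s * k s) = 0"
  then have ae: "AE s in lborel. indicator {0..<h} s * k s = 0"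
    by (subst (asm) integral_nonneg_eq_0_iff_AE) (auto simp: integrable_Ico k_int k_nonneg)
  define r where "r = min h T"
  have r: "r > 0" using assms T by (simp add: r_def)
  have "AE t in lborel. \<not> (0 < t \<and> t < r)"
    using resolvent
  proof eventually_elim
    case (elim t)
    show ?case
    proof
      assume t: "0 < t \<and> t < r"
      have "cv k a t = 0" unfolding cv_commute[of k a] unfolding cv_def
      proof (rule integral_eq_zero_AE, use ae in eventually_elim)
        fix s assume "indicator {0..<h} s * k s = 0"
        then show "a (t - s) * k s = 0"
          using t k_neg[of s] a_neg[of "t - s"] by (cases "s \<le> t") (auto simp: r_def indicator_def split: if_splits)
      qed
      then show False using elim t assms by (auto simp: r_def)
    qed
  qed
  then have "AE t in lborel. t \<notin> {0<..<r}" by simp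
  then have "{0<..<r} \<in> null_sets lborel" by (subst (asm) AE_iff_null_sets[symmetric]) auto
  then show False using r by (simp add: null_sets_def)
qed

lemma euler_scheme_\<kappa>:
  assumes h: "h > 0"
  shows "euler_scheme (\<beta> / h) (\<kappa> h)"
proof
  show "0 \<le> \<beta> / h" using \<beta> h by simp
  show nn: "0 \<le> \<kappa> h n" for n
    unfolding \<kappa>_def using h k_nonneg by (intro divide_nonneg_pos integral_nonneg_AE) auto
  show "\<kappa> h (Suc n) \<le> \<kappa> h n" for n
  proof -
    have "(LINT s|lborel. indicator {real (Suc n) * h..<real (Suc (Suc n)) * h} s * k s)
       = (LINT s|lborel. indicator {real n * h..<real (Suc n) * h} s * k (h + s))"
      using lborel_integral_real_affine[of 1 "\<lambda>s. indicator {real (Suc n) * h..<real (Suc (Suc n)) * h} s * k s" h]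
      by (auto simp: algebra_simps indicator_def intro!: Bochner_Integration.integral_cong)
    also have "\<dots> \<le> (LINT s|lborel. indicator {real n * h..<real (Suc n) * h} s * k s)"
    proof (rule integral_mono_AE)
      have "integrable lborel (\<lambda>s. k (h + 1 * s))" by (rule lborel_integrable_real_affine[OF k_int]) simp
      then show "integrable lborel (\<lambda>s. indicator {real n * h..<real (Suc n) * h} s * k (h + s))"
        by (intro integrable_Ico) simp
      show "AE s in lborel. indicator {real n * h..<real (Suc n) * h} s * k (h + s) 
          \<le> indicator {real n * h..<real (Suc n) * h} s * k s"
        using AE_lborel_singleton[of "0::real"]
      proof eventually_elim
        case (elim s)
        have n0: "real n * h \<ge> 0" using h by simp
        show ?case
        proof (cases "s \<in> {real n * h..<real (Suc n) * h}")
          case True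
          then have "s > 0" using elim n0 by auto
          then show ?thesis using k_antimono[of s "h + s"] h True by simp
        qed simp
      qed
    qed (rule integrable_Ico[OF k_int])
    finally show ?thesis unfolding \<kappa>_def using h by (simp add: divide_right_mono)
  qed
  show "0 < \<beta> / h + \<kappa> h 0"
  proof (cases "\<beta> = 0")
    case True
    then have "\<kappa> h 0 \<noteq> 0" using k_positive[OF h] h by (simp add: \<kappa>_def)
    then show ?thesis using nn[of 0] True by simp
  next
    case False
    then show ?thesis using nn[of 0] \<beta> h by (simp add: add_pos_nonneg)
  qed
qed

text \<open>Each cell takes the value at its right end, so that integrating over cells reproduces
  the implicit sum exactly. For \<open>t \<le> 0\<close> the function \<open>nat\<close> returns
  \<open>0\<close> and the value is \<open>1\<close>.\<close>

definition step :: "real \<Rightarrow> real \<Rightarrow> real \<Rightarrow> real" where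
  "step h \<nu> t = euler (\<beta> / h) (\<kappa> h) \<nu> (nat \<lceil>t / h\<rceil>)"

lemma nat_ceiling_cell:
  assumes "h > 0" "real i * h < t" "t \<le> real (Suc i) * h"
  shows "nat \<lceil>t / h\<rceil> = Suc i"
proof -
  have "\<lceil>t / h\<rceil> = int (Suc i)"
    using assms by (intro ceiling_unique) (auto simp: field_simps)
  then show ?thesis by simp
qed

lemma nat_ceiling_upper: "h > 0 \<Longrightarrow> t \<le> real (nat \<lceil>t / h\<rceil>) * h"
  using of_nat_ceiling[of "t / h"] by (simp add: pos_divide_le_eq)

lemma nat_ceiling_lower: "h > 0 \<Longrightarrow> t > 0 \<Longrightarrow> real (nat \<lceil>t / h\<rceil> - 1) * h < t"
proof -
  assume *: "h > 0" "t > 0"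
  then have "\<lceil>t / h\<rceil> > 0" by simp
  then have "real (nat \<lceil>t / h\<rceil> - 1) = of_int \<lceil>t / h\<rceil> - 1" by (simp add: of_nat_diff nat_le_iff Suc_leI)
  also have "\<dots> < t / h" by linarith
  finally show ?thesis using * by (simp add: pos_less_divide_eq)
qed

lemma cells_indicator:
  assumes "h > 0"
  shows "(\<Sum>j<n. indicator {real j * h..<real (Suc j) * h} s * f j)
       = (if 0 \<le> s \<and> s < real n * h then f (nat \<lfloor>s / h\<rfloor>) else (0::real))"
proof (induction n)
  case (Suc n)
  show ?case
  proof (cases "real n * h \<le> s \<and> s < real (Suc n) * h")
    case True
    moreover have "real n * h \<ge> 0" using assms by simp
    moreover have "nat \<lfloor>s / h\<rfloor> = n"
    proof -
      have "\<lfloor>s / h\<rfloor> = int n" using True assms by (intro floor_unique) (auto simp: field_simps)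
      then show ?thesis by simp
    qed
    ultimately show ?thesis using Suc by simp
  next
    case False
    have "real n * h \<le> real (Suc n) * h" using assms by simp
    then show ?thesis using Suc False by auto
  qed
qed simp

section \<open>The interpolated scheme for one mesh size\<close>

context
  fixes h \<nu> :: real assumes h: "h > 0" and \<nu>: "\<nu> \<ge> 0"
begin

interpretation euler_scheme "\<beta> / h" "\<kappa> h" by (rule euler_scheme_\<kappa>[OF h])

abbreviation "U \<equiv> euler (\<beta> / h) (\<kappa> h) \<nu>"
definition "V t = 1 - step h \<nu> t"

lemma step_bounds: "0 \<le> step h \<nu> t" "step h \<nu> t \<le> 1"
  unfolding step_def using euler_nonneg[OF \<nu>] euler_le_one[OF \<nu>] by auto

lemma step_antimono: "x \<le> y \<Longrightarrow> step h \<nu> y \<le> step h \<nu> x"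
  unfolding step_def using h by (intro euler_antimono[OF \<nu>] nat_mono ceiling_mono divide_right_mono) auto

lemma V_bounds: "0 \<le> V t" "V t \<le> 1" "\<bar>V t\<bar> \<le> 1"
  using step_bounds[of t] by (auto simp: V_def)

lemma V_mono: "x \<le> y \<Longrightarrow> V x \<le> V y"
  using step_antimono by (simp add: V_def)

lemma V_neg: "t \<le> 0 \<Longrightarrow> V t = 0"
proof -
  assume "t \<le> 0"
  then have "\<lceil>t / h\<rceil> \<le> 0" using h by (simp add: divide_nonpos_pos)
  then show ?thesis by (simp add: V_def step_def)
qed

lemma V_meas[measurable]: "V \<in> borel_measurable borel"
  by (rule borel_measurable_mono) (auto simp: mono_def V_mono)

lemma step_meas[measurable]: "step h \<nu> \<in> borel_measurable borel"
proof -
  have "(\<lambda>t. 1 - V t) \<in> borel_measurable borel" by measurable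
  then show ?thesis by (simp add: V_def)
qed

definition "Z t = (LINT \<tau>|lborel. indicator {0..t} \<tau> * step h \<nu> \<tau>)"

lemma Z_integrable: "integrable lborel (\<lambda>\<tau>. indicator {x..y} \<tau> * step h \<nu> \<tau>)"
proof (rule integrable_mult_bounded[where B=1])
  show "\<bar>step h \<nu> x\<bar> \<le> 1" for x using step_bounds[of x] by simp
  show "integrable lborel (indicator {x..y} :: real \<Rightarrow> real)"
    by (rule integrable_real_indicator) (auto simp: emeasure_lborel_Icc_eq)
qed measurable

lemma Z_diff:
  assumes "0 \<le> x" "x \<le> y"
  shows "Z y - Z x = (LINT \<tau>|lborel. indicator {x..y} \<tau> * step h \<nu> \<tau>)"
proof -
  have "Z y - Z x = (LINT \<tau>|lborel. indicator {0..y} \<tau> * step h \<nu> \<tau> - indicator {0..x} \<tau> * step h \<nu> \<tau>)"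
    unfolding Z_def using Z_integrable by (subst Bochner_Integration.integral_diff) auto
  also have "\<dots> = (LINT \<tau>|lborel. indicator {x..y} \<tau> * step h \<nu> \<tau>)"
    by (rule integral_cong_AE)
       (use AE_lborel_singleton[of x] assms in \<open>auto elim!: eventually_mono simp: indicator_def\<close>)
  finally show ?thesis .
qed

text \<open>A nonincreasing function is at its right end at most its mean over an interval, and at
  its left end at least this mean (\<open>Z_upper\<close>). Both bounds later turn convergence of
  the integrals \<open>Z\<close> into convergence of \<open>step\<close>.\<close>

lemma Z_lower: assumes "0 \<le> x" "x \<le> y" shows "(y - x) * step h \<nu> y \<le> Z y - Z x"
proof -
  have "(y - x) * step h \<nu> y = (LINT \<tau>|lborel. indicator {x..y} \<tau> * step h \<nu> y)"
    using assms by simp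
  also have "\<dots> \<le> Z y - Z x" unfolding Z_diff[OF assms]
    by (rule integral_mono[OF integrable_Icc Z_integrable]) (auto simp: indicator_def step_antimono)
  finally show ?thesis .
qed

lemma Z_upper: assumes "0 \<le> x" "x \<le> y" shows "Z y - Z x \<le> (y - x) * step h \<nu> x"
proof -
  have "Z y - Z x \<le> (LINT \<tau>|lborel. indicator {x..y} \<tau> * step h \<nu> x)" unfolding Z_diff[OF assms]
    by (rule integral_mono[OF Z_integrable integrable_Icc]) (auto simp: indicator_def step_antimono)
  also have "\<dots> = (y - x) * step h \<nu> x" using assms by simp
  finally show ?thesis .
qed

lemma Z_grid: "Z (real n * h) = h * (\<Sum>i<n. U (Suc i))"
proof (induction n)
  case 0
  have "Z 0 = 0" unfolding Z_def
    by (rule integral_eq_zero_AE, rule eventually_mono[OF AE_lborel_singleton[of "0::real"]]) auto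
  then show ?case by simp
next
  case (Suc n)
  have "Z (real (Suc n) * h) - Z (real n * h) = (LINT \<tau>|lborel. indicator {real n * h..real (Suc n) * h} \<tau> * U (Suc n))"
  proof (subst Z_diff)
    show "(LINT \<tau>|lborel. indicator {real n * h..real (Suc n) * h} \<tau> * step h \<nu> \<tau>)
        = (LINT \<tau>|lborel. indicator {real n * h..real (Suc n) * h} \<tau> * U (Suc n))"
    proof (rule integral_cong_AE)
      show "AE \<tau> in lborel. indicator {real n * h..real (Suc n) * h} \<tau> * step h \<nu> \<tau>
          = indicator {real n * h..real (Suc n) * h} \<tau> * U (Suc n)"
        using AE_lborel_singleton[of "real n * h"]
      proof eventually_elim
        case (elim \<tau>)
        show ?case
        proof (cases "\<tau> \<in> {real n * h..real (Suc n) * h}")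
          case True
          then have "nat \<lceil>\<tau> / h\<rceil> = Suc n" using elim h by (intro nat_ceiling_cell) auto
          then show ?thesis by (simp add: step_def)
        qed simp
      qed
    qed measurable
  qed (use h in auto)
  also have "\<dots> = h * U (Suc n)" using h by (simp add: algebra_simps)
  finally show ?case using Suc by (simp add: algebra_simps)
qed

text \<open>For \<open>t\<close> on the grid, \<open>V (t - s)\<close> is constant while
  \<open>s\<close> runs through a cell, so only the mean of \<open>k\<close> over the cell matters
  and no quadrature error occurs.\<close>

lemma cv_grid: "cv k V (real n * h) = h * (\<Sum>j<n. \<kappa> h j * (1 - U (n - j)))"
proof -
  have "cv k V (real n * h) = (LINT s|lborel. V (real n * h - s) * k s)"
    unfolding cv_commute[of k V] unfolding cv_def ..
  also have "\<dots> = (LINT s|lborel. (\<Sum>j<n. indicator {real j * h..<real (Suc j) * h} s * (k s * (1 - U (n - j)))))"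
  proof (rule integral_cong_AE)
    show "AE s in lborel. V (real n * h - s) * k s
       = (\<Sum>j<n. indicator {real j * h..<real (Suc j) * h} s * (k s * (1 - U (n - j))))"
    proof (rule AE_I2)
      fix s
      show "V (real n * h - s) * k s
       = (\<Sum>j<n. indicator {real j * h..<real (Suc j) * h} s * (k s * (1 - U (n - j))))"
        unfolding cells_indicator[OF h]
      proof (cases "0 \<le> s \<and> s < real n * h")
        case False
        then show "V (real n * h - s) * k s = (if 0 \<le> s \<and> s < real n * h then k s * (1 - U (n - nat \<lfloor>s / h\<rfloor>)) else 0)"
          using k_neg[of s] V_neg[of "real n * h - s"] by auto
      next
        case True
        define j where "j = nat \<lfloor>s / h\<rfloor>"
        have j: "real j \<le> s / h" "s / h < real j + 1" using True h by (auto simp: j_def)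
        have jn: "j < n"
        proof (rule ccontr)
          assume "\<not> j < n"
          then have "real n \<le> s / h" using j by linarith
          then show False using True h by (simp add: pos_le_divide_eq)
        qed
        then obtain i where i: "n = Suc (i + j)" using less_imp_Suc_add[of j n] by (auto simp: add.commute)
        have "nat \<lceil>(real n * h - s) / h\<rceil> = Suc i"
          using j h i by (intro nat_ceiling_cell) (auto simp: field_simps)
        then have "V (real n * h - s) = 1 - U (n - j)" by (simp add: V_def step_def i)
        then show "V (real n * h - s) * k s = (if 0 \<le> s \<and> s < real n * h then k s * (1 - U (n - nat \<lfloor>s / h\<rfloor>)) else 0)"
          using True by (simp add: j_def)
      qed
    qed
  qed measurable
  also have "\<dots> = (\<Sum>j<n. LINT s|lborel. indicator {real j * h..<real (Suc j) * h} s * (k s * (1 - U (n - j))))"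
    using k_int by (intro Bochner_Integration.integral_sum integrable_Ico) auto
  also have "\<dots> = h * (\<Sum>j<n. \<kappa> h j * (1 - U (n - j)))"
    using h by (simp add: \<kappa>_def sum_distrib_left mult.assoc[symmetric])
  finally show ?thesis .
qed

lemma grid_identity: "\<beta> * V (real n * h) + cv k V (real n * h) = \<nu> * Z (real n * h)"
proof -
  have V: "V (real n * h) = 1 - U n" using h by (simp add: V_def step_def)
  have "h * (\<beta> / h * (1 - U n) + (\<Sum>j<n. \<kappa> h j * (1 - U (n - j)))) = h * (\<nu> * (\<Sum>i<n. U (Suc i)))"
    using euler_identity[OF \<nu>, of n] by simp
  then show ?thesis
    using h unfolding Z_grid cv_grid V by (simp add: distrib_left mult.left_commute)
qed

lemma cv_k_mono: "x \<le> y \<Longrightarrow> cv k V x \<le> cv k V y"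
  unfolding cv_commute[of k V] unfolding cv_def
proof (rule integral_mono)
  have int: "integrable lborel (\<lambda>\<tau>. V (t - \<tau>) * k \<tau>)" for t
    unfolding mult.commute[of "V _"] by (rule integrable_mult_bounded[OF k_int _ V_bounds(3)]) measurable
  show "integrable lborel (\<lambda>\<tau>. V (x - \<tau>) * k \<tau>)" "integrable lborel (\<lambda>\<tau>. V (y - \<tau>) * k \<tau>)"
    using int by auto
qed (auto intro!: mult_right_mono V_mono k_nonneg)

lemma Z_mono: "0 \<le> x \<Longrightarrow> x \<le> y \<Longrightarrow> Z x \<le> Z y"
  using Z_lower[of x y] step_bounds(1)[of y] by (smt (verit) mult_nonneg_nonneg)

text \<open>Off the grid the identity survives up to \<open>\<nu> h\<close>: all three terms are nondecreasing
  in \<open>t\<close>, and the right-hand side grows by at most \<open>\<nu> h\<close> over a cell.\<close>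
lemma defect:
  assumes t: "0 \<le> t"
  shows "\<bar>\<beta> * V t + cv k V t - \<nu> * Z t\<bar> \<le> \<nu> * h"
proof (cases "t = 0")
  case True
  then show ?thesis using grid_identity[of 0] h \<nu> by simp
next
  case False
  then have t: "t > 0" using t by simp
  define n where "n = nat \<lceil>t / h\<rceil> - 1"
  have "\<lceil>t / h\<rceil> > 0" using t h by simp
  then have n: "nat \<lceil>t / h\<rceil> = Suc n" unfolding n_def by simp
  have lo: "real n * h < t" using nat_ceiling_lower[OF h t] by (simp add: n_def)
  have up: "t \<le> real (Suc n) * h" using nat_ceiling_upper[OF h, of t] n by simp
  have Vt: "V t = V (real (Suc n) * h)" using n h by (simp add: V_def step_def del: of_nat_Suc)
  have nh: "real n * h \<ge> 0" using h by simp
  have "Z (real (Suc n) * h) - Z (real n * h) \<le> (real (Suc n) * h - real n * h) * step h \<nu> (real n * h)"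
    using h nh by (intro Z_upper) auto
  also have "\<dots> = h * step h \<nu> (real n * h)" by (simp add: algebra_simps)
  also have "\<dots> \<le> h" using h step_bounds(2)[of "real n * h"] by (intro mult_left_le) auto
  finally have Zn: "Z (real (Suc n) * h) - Z (real n * h) \<le> h" .
  then have Zn': "\<nu> * (Z (real (Suc n) * h) - Z (real n * h)) \<le> \<nu> * h" using \<nu> by (rule mult_left_mono)
  have Z: "Z (real n * h) \<le> Z t" "Z t \<le> Z (real (Suc n) * h)"
    using Z_mono nh lo up t by auto
  have Z': "\<nu> * Z (real n * h) \<le> \<nu> * Z t" "\<nu> * Z t \<le> \<nu> * Z (real (Suc n) * h)"
    using Z \<nu> by (auto intro: mult_left_mono)
  have C: "cv k V (real n * h) \<le> cv k V t" "cv k V t \<le> cv k V (real (Suc n) * h)"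
    using cv_k_mono lo up by auto
  have B: "\<beta> * V (real n * h) \<le> \<beta> * V (real (Suc n) * h)"
    using \<beta> h by (intro mult_left_mono V_mono) auto
  show ?thesis
    using Zn' Z' C B grid_identity[of n] grid_identity[of "Suc n"] unfolding Vt right_diff_distrib abs_le_iff
    by linarith
qed

text \<open>By monotonicity \<open>t * step h \<nu> t\<close> is at most \<open>Z\<close>, and
  \<open>defect\<close> bounds \<open>\<nu> * Z\<close> because \<open>V\<close> is at most
  \<open>1\<close>. The bound survives \<open>h \<rightarrow> 0\<close> as decay of order
  \<open>1 / \<nu>\<close>, which later excludes an atom at \<open>y = 1\<close>.\<close>

lemma step_decay: "t \<ge> 0 \<Longrightarrow> \<nu> * (t * step h \<nu> t) \<le> \<beta> + (LINT x|lborel. k x) + \<nu> * h"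
proof -
  assume t: "t \<ge> 0"
  have "Z 0 = 0" using Z_grid[of 0] by simp
  then have "t * step h \<nu> t \<le> Z t" using Z_lower[of 0 t] t by simp
  then have "\<nu> * (t * step h \<nu> t) \<le> \<nu> * Z t" using \<nu> by (rule mult_left_mono)
  also have "\<dots> \<le> \<beta> * V t + cv k V t + \<nu> * h" using defect[OF t] by linarith
  also have "\<beta> * V t \<le> \<beta>" using V_bounds \<beta> by (simp add: mult_left_le)
  also have "cv k V t \<le> (LINT x|lborel. k x)"
    using cv_abs_le[OF k_int V_meas V_bounds(3), of t] k_nonneg by simp
  finally show ?thesis by simp
qed

end

end

lemma cv_indicator:
  assumes "0 \<le> t" "t \<le> T" "\<And>\<tau>. \<tau> < 0 \<Longrightarrow> g \<tau> = 0"
  shows "cv (indicator {0..T}) g t = (LINT \<tau>|lborel. indicator {0..t} \<tau> * g \<tau>)"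
  unfolding cv_def
proof (rule Bochner_Integration.integral_cong[OF refl])
  fix \<tau> show "indicator {0..T} (t - \<tau>) * g \<tau> = indicator {0..t} \<tau> * g \<tau>"
    using assms by (cases "\<tau> < 0") (auto simp: indicator_def)
qed

lemma integrable_indicator_Icc: "integrable lborel (indicator {x..y::real} :: real \<Rightarrow> real)"
  by (rule integrable_real_indicator) (auto simp: emeasure_lborel_Icc_eq)

section \<open>Comparison of the integrated scheme with the solution\<close>

context cp_kernel
begin

text \<open>Associativity moves \<open>a\<close> next to \<open>k\<close>, so the identity
  \<open>resolvent\<close> applies under an integral, where almost everywhere is enough. Convolution
  with \<open>a\<close> thus inverts the operator built from \<beta> and \<open>k\<close>, up to one
  integration.\<close>

lemma cv_resolvent:
  assumes g[measurable]: "g \<in> borel_measurable borel" and B: "\<And>x. \<bar>g x\<bar> \<le> B"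
    and neg: "\<And>x. x < 0 \<Longrightarrow> g x = 0" and t: "0 \<le> t" "t \<le> T"
  shows "\<beta> * cv a g t + cv a (cv k g) t = (LINT \<tau>|lborel. indicator {0..t} \<tau> * g \<tau>)"
proof -
  let ?I = "indicator {0..t} :: real \<Rightarrow> real"
  have I: "integrable lborel ?I" by (rule integrable_indicator_Icc)
  have "cv a k = cv k a" using cv_commute by auto
  then have "cv a (cv k g) t = cv (cv k a) g t" using cv_assoc[OF a_int k_int g B] by simp
  also have "\<dots> = (LINT x|lborel. g (t - x) * cv k a x)"
    unfolding cv_commute[of "cv k a" g] unfolding cv_def[of g] ..
  also have "\<dots> = (LINT x|lborel. ?I x * g (t - x) - \<beta> * (a x * g (t - x)))"
  proof (rule integral_cong_AE)
    show "AE x in lborel. g (t - x) * cv k a x = ?I x * g (t - x) - \<beta> * (a x * g (t - x))"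
      using resolvent AE_lborel_singleton[of 0] AE_lborel_singleton[of T]
    proof eventually_elim
      case (elim x)
      consider "x < 0" | "t < x" | "0 < x" "x < T" "x \<le> t" using elim t by fastforce
      then show ?case
      proof cases
        case 1
        then have "cv k a x = 0" using k_neg a_neg by (intro cv_causal) auto
        then show ?thesis using 1 a_neg by simp
      next
        case 2
        then show ?thesis using neg by simp
      next
        case 3
        then have c: "cv k a x = 1 - \<beta> * a x" using elim by simp
        show ?thesis unfolding c using 3 by (simp add: algebra_simps)
      qed
    qed
  qed measurable
  also have "\<dots> = (LINT x|lborel. ?I x * g (t - x)) - \<beta> * (LINT x|lborel. a x * g (t - x))"
  proof -
    have "integrable lborel (\<lambda>x. ?I x * g (t - x))" "integrable lborel (\<lambda>x. a x * g (t - x))"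
      by (rule integrable_mult_bounded[OF I _ B] integrable_mult_bounded[OF a_int _ B]; measurable)+
    then show ?thesis by (subst Bochner_Integration.integral_diff) auto
  qed
  also have "(LINT x|lborel. a x * g (t - x)) = cv a g t"
    unfolding cv_commute[of a g] unfolding cv_def by (simp add: mult.commute)
  also have "(LINT x|lborel. ?I x * g (t - x)) = (LINT \<tau>|lborel. ?I \<tau> * g \<tau>)"
  proof -
    have "(LINT x|lborel. ?I x * g (t - x)) = cv g ?I t" by (simp add: cv_def mult.commute)
    also have "\<dots> = cv ?I g t" by (rule cv_commute)
    also have "\<dots> = (LINT \<tau>|lborel. ?I \<tau> * g \<tau>)" by (rule cv_indicator) (use t neg in auto)
    finally show ?thesis .
  qed
  finally show ?thesis by simp
qed

context
  fixes \<nu> :: real and s :: "real \<Rightarrow> real"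
  assumes \<nu>: "\<nu> \<ge> 0" and s_cont: "continuous_on {0..T} s"
    and s_eq: "\<And>t. 0 \<le> t \<Longrightarrow> t \<le> T \<Longrightarrow> s t + \<nu> * cv a (\<lambda>\<tau>. indicator {0..T} \<tau> * s \<tau>) t = 1"
begin

abbreviation "J \<equiv> cv (indicator {0..T})"
definition "s0 = (\<lambda>\<tau>. indicator {0..T} \<tau> * s \<tau>)"

lemma s0_meas[measurable]: "s0 \<in> borel_measurable borel"
  unfolding s0_def using borel_measurable_continuous_on_indicator[OF _ s_cont] by simp

lemma s0_bounded: obtains B where "B \<ge> 0" "\<And>x. \<bar>s0 x\<bar> \<le> B"
proof -
  have "bounded (s ` {0..T})" by (intro compact_imp_bounded compact_continuous_image s_cont) auto
  then obtain B where "\<forall>x\<in>{0..T}. \<bar>s x\<bar> \<le> B" by (auto simp: bounded_iff)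
  then have "\<bar>s0 x\<bar> \<le> \<bar>B\<bar>" for x by (force simp: s0_def indicator_def)
  then show ?thesis by (intro that[of "\<bar>B\<bar>"]) auto
qed

lemma s0_neg: "x < 0 \<Longrightarrow> s0 x = 0" by (simp add: s0_def)

lemma J_bounded:
  assumes "g \<in> borel_measurable borel" "\<And>x. \<bar>g x\<bar> \<le> B"
  shows "\<bar>J g t\<bar> \<le> T * B"
  using cv_abs_le[OF integrable_indicator_Icc assms, of 0 T t] T by simp

lemma J_neg: "(\<And>x. x < 0 \<Longrightarrow> g x = 0) \<Longrightarrow> t < 0 \<Longrightarrow> J g t = 0"
  by (rule cv_causal) auto

text \<open>For \<open>t \<le> T\<close>, \<open>J\<close> integrates a causal function from
  \<open>0\<close> to \<open>t\<close>; applied to the equation it commutes with \<open>cv a\<close>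
  and sends the constant \<open>1\<close> to \<open>t\<close>.\<close>

lemma integrated_equation:
  assumes t: "0 \<le> t" "t \<le> T"
  shows "J s0 t + \<nu> * cv a (J s0) t = t"
proof -
  obtain B where B: "B \<ge> 0" "\<And>x. \<bar>s0 x\<bar> \<le> B" using s0_bounded by blast
  have aB: "\<bar>cv a s0 x\<bar> \<le> (LINT x|lborel. \<bar>a x\<bar>) * B" for x by (rule cv_abs_le[OF a_int s0_meas B(2)])
  have ex: "cv a (J s0) t = J (cv a s0) t"
    by (rule cv_exchange[OF a_int integrable_indicator_Icc s0_meas B(2)])
  have "J s0 t + \<nu> * cv a (J s0) t = J s0 t + \<nu> * J (cv a s0) t" by (simp only: ex)
  also have "\<dots> = J (\<lambda>x. 1 * s0 x + \<nu> * cv a s0 x) t"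
  proof -
    have "cv a s0 \<in> borel_measurable borel" by measurable
    from cv_add[OF integrable_indicator_Icc s0_meas B(2) this aB, where c=1 and c'=\<nu>]
    show ?thesis by (simp only: mult_1)
  qed
  also have "\<dots> = J (indicator {0..T}) t"
  proof (rule cv_cong)
    fix x assume x: "x \<le> t"
    show "1 * s0 x + \<nu> * cv a s0 x = indicator {0..T} x"
    proof (cases "x < 0")
      case True
      then show ?thesis using cv_causal[OF a_neg s0_neg True] s0_neg by simp
    next
      case False
      then show ?thesis using s_eq[of x] x t by (simp add: s0_def)
    qed
  qed auto
  also have "\<dots> = (LINT \<tau>|lborel. indicator {0..t} \<tau> * indicator {0..T} \<tau>)" by (rule cv_indicator) (use t in auto)
  also have "\<dots> = (LINT \<tau>|lborel. indicator {0..t} \<tau>)"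
    by (rule Bochner_Integration.integral_cong) (use t in \<open>auto simp: indicator_def\<close>)
  also have "\<dots> = t" using t by simp
  finally show ?thesis .
qed

text \<open>Convolve the defect of the scheme, at most \<open>\<nu> * h\<close>, with
  \<open>a\<close>. By \<open>cv_resolvent\<close> the terms with \<beta> and \<open>k\<close>
  become the integral of \<open>V\<close>, which is \<open>t - Z\<close>, and what remains is the
  residual of the integrated Volterra equation.\<close>

lemma scheme_equation:
  assumes h: "h > 0" and t: "0 \<le> t" "t \<le> T"
  defines "Y \<equiv> \<lambda>\<tau>. indicator {0..T} \<tau> * step h \<nu> \<tau>"
  shows "J Y t = Z h \<nu> t" and "\<bar>J Y t + \<nu> * cv a (J Y) t - t\<bar> \<le> (LINT x|lborel. \<bar>a x\<bar>) * (\<nu> * h)"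
proof -
  note [measurable] = V_meas[OF h \<nu>] step_meas[OF h \<nu>]
  have Ym[measurable]: "Y \<in> borel_measurable borel" unfolding Y_def by measurable
  have Yb: "\<bar>Y x\<bar> \<le> 1" for x using step_bounds[OF h \<nu>, of x] by (auto simp: Y_def indicator_def)
  have Yneg: "x < 0 \<Longrightarrow> Y x = 0" for x by (simp add: Y_def)
  let ?V = "V h \<nu>"
  have JY: "J Y x = Z h \<nu> x" if "0 \<le> x" "x \<le> T" for x
  proof -
    have "J Y x = (LINT \<tau>|lborel. indicator {0..x} \<tau> * Y \<tau>)" by (rule cv_indicator) (use that Yneg in auto)
    also have "\<dots> = Z h \<nu> x" unfolding Z_def[OF h \<nu>]
      by (rule Bochner_Integration.integral_cong) (use that in \<open>auto simp: indicator_def Y_def\<close>)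
    finally show ?thesis .
  qed
  show "J Y t = Z h \<nu> t" using JY t by simp
  have JYm[measurable]: "J Y \<in> borel_measurable borel" by measurable
  have JYb: "\<bar>J Y x\<bar> \<le> T * 1" for x by (rule J_bounded[OF Ym Yb])
  have kVm[measurable]: "cv k ?V \<in> borel_measurable borel" by measurable
  have kVb: "\<bar>cv k ?V x\<bar> \<le> (LINT x|lborel. \<bar>k x\<bar>) * 1" for x
    by (rule cv_abs_le[OF k_int _ V_bounds(3)[OF h \<nu>]]) measurable
  define W where "W = (\<lambda>x. 1 * (\<beta> * ?V x + 1 * cv k ?V x) + (- \<nu>) * J Y x)"
  have bVk: "\<bar>\<beta> * ?V x + 1 * cv k ?V x\<bar> \<le> \<beta> + (LINT x|lborel. \<bar>k x\<bar>) * 1" for x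
  proof -
    have "\<bar>\<beta> * ?V x\<bar> \<le> \<beta>" using V_bounds[OF h \<nu>, of x] \<beta> by (simp add: abs_mult mult_left_le)
    then show ?thesis using kVb[of x] by linarith
  qed
  have "cv a W t = 1 * cv a (\<lambda>x. \<beta> * ?V x + 1 * cv k ?V x) t + (- \<nu>) * cv a (J Y) t"
    unfolding W_def by (rule cv_add[OF a_int _ bVk JYm JYb]) measurable
  also have "cv a (\<lambda>x. \<beta> * ?V x + 1 * cv k ?V x) t = \<beta> * cv a ?V t + 1 * cv a (cv k ?V) t"
    by (rule cv_add[OF a_int V_meas[OF h \<nu>] V_bounds(3)[OF h \<nu>] kVm kVb])
  finally have cvW: "cv a W t = (\<beta> * cv a ?V t + cv a (cv k ?V) t) - \<nu> * cv a (J Y) t" by simp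
  have "\<beta> * cv a ?V t + cv a (cv k ?V) t = (LINT \<tau>|lborel. indicator {0..t} \<tau> * ?V \<tau>)"
    by (rule cv_resolvent[OF V_meas[OF h \<nu>] V_bounds(3)[OF h \<nu>] _ t]) (auto intro: V_neg[OF h \<nu>])
  also have "\<dots> = (LINT \<tau>|lborel. indicator {0..t} \<tau> - indicator {0..t} \<tau> * step h \<nu> \<tau>)"
    by (rule Bochner_Integration.integral_cong) (auto simp: V_def[OF h \<nu>] algebra_simps)
  also have "\<dots> = t - Z h \<nu> t"
    unfolding Z_def[OF h \<nu>] using integrable_indicator_Icc Z_integrable[OF h \<nu>] t
    by (subst Bochner_Integration.integral_diff) auto
  finally have *: "cv a W t = t - J Y t - \<nu> * cv a (J Y) t" using cvW JY t by simp
  \<comment> \<open>\<open>defect\<close> controls \<open>W\<close> only on \<open>{0..T}\<close>,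
    where \<open>J Y\<close> equals \<open>Z\<close>. Cutting off is harmless at \<open>t\<close>:
    \<open>W\<close> vanishes on the negative axis, and later values do not reach back to
    \<open>t\<close>.\<close>
  let ?W = "\<lambda>x. indicator {0..T} x * W x"
  have "cv a W t = cv a ?W t"
  proof (rule cv_cong)
    fix x assume "x \<le> t"
    show "W x = ?W x"
    proof (cases "x < 0")
      case True
      have "cv k ?V x = 0" using k_neg V_neg[OF h \<nu>] True by (intro cv_causal) auto
      then show ?thesis using True V_neg[OF h \<nu>, of x] J_neg[OF Yneg True] by (simp add: W_def)
    qed (use \<open>x \<le> t\<close> t in auto)
  qed (rule a_neg)
  also have "\<bar>\<dots>\<bar> \<le> (LINT x|lborel. \<bar>a x\<bar>) * (\<nu> * h)"
  proof (rule cv_abs_le[OF a_int])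
    have [measurable]: "W \<in> borel_measurable borel" unfolding W_def by measurable
    show "?W \<in> borel_measurable borel" by measurable
    show "\<bar>?W x\<bar> \<le> \<nu> * h" for x
      using defect[OF h \<nu>, of x] JY[of x] h \<nu> by (auto simp: W_def indicator_def)
  qed
  finally show "\<bar>J Y t + \<nu> * cv a (J Y) t - t\<bar> \<le> (LINT x|lborel. \<bar>a x\<bar>) * (\<nu> * h)"
    unfolding * by linarith
qed

lemma Z_convergence:
  obtains C where "C \<ge> 0" "\<And>h t. h > 0 \<Longrightarrow> 0 \<le> t \<Longrightarrow> t \<le> T \<Longrightarrow> \<bar>Z h \<nu> t - J s0 t\<bar> \<le> C * h"
proof -
  show thesis
  proof (rule volterra_stability[OF a_int a_neg \<nu> less_imp_le[OF T]])
    fix C assume C: "C \<ge> 0"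
      "\<And>d B e t. \<lbrakk>\<And>x. \<bar>d x\<bar> \<le> B; \<And>x. x < 0 \<Longrightarrow> d x = 0;
         \<And>x. 0 \<le> x \<Longrightarrow> x \<le> T \<Longrightarrow> \<bar>d x + \<nu> * cv a d x\<bar> \<le> e; 0 \<le> t; t \<le> T\<rbrakk> \<Longrightarrow> \<bar>d t\<bar> \<le> C * e"
    let ?N = "LINT x|lborel. \<bar>a x\<bar>"
    obtain B where B: "B \<ge> 0" "\<And>x. \<bar>s0 x\<bar> \<le> B" using s0_bounded by blast
    show thesis
    proof (rule that[of "C * (?N * \<nu>)"])
      show "C * (?N * \<nu>) \<ge> 0" using C \<nu> by (intro mult_nonneg_nonneg integral_nonneg_AE) auto
      fix h t assume h: "h > (0::real)" and t: "0 \<le> t" "t \<le> T"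
      define Y where "Y = (\<lambda>\<tau>. indicator {0..T} \<tau> * step h \<nu> \<tau>)"
      note [measurable] = step_meas[OF h \<nu>]
      have Ym[measurable]: "Y \<in> borel_measurable borel" unfolding Y_def by measurable
      have Yb: "\<bar>Y x\<bar> \<le> 1" for x using step_bounds[OF h \<nu>, of x] by (auto simp: Y_def indicator_def)
      have bY: "\<bar>J Y x\<bar> \<le> T * 1" and bs: "\<bar>J s0 x\<bar> \<le> T * B" for x
        by (rule J_bounded[OF Ym Yb], rule J_bounded[OF s0_meas B(2)])
      define d where "d = (\<lambda>x. 1 * J Y x + (-1) * J s0 x)"
      have "\<bar>d t\<bar> \<le> C * (?N * (\<nu> * h))"
      proof (rule C(2)[of d "T * 1 + T * B"])
        show "\<bar>d x\<bar> \<le> T * 1 + T * B" for x using bY[of x] bs[of x] by (auto simp: d_def)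
        show "d x = 0" if "x < 0" for x
        proof -
          have "J Y x = 0" by (rule J_neg[OF _ that]) (auto simp: Y_def)
          then show ?thesis using J_neg[OF s0_neg that] by (simp add: d_def)
        qed
        fix x assume x: "0 \<le> x" "x \<le> T"
        have "cv a d x = 1 * cv a (J Y) x + (-1) * cv a (J s0) x"
          unfolding d_def by (rule cv_add[OF a_int _ bY _ bs]; measurable)
        then have "d x + \<nu> * cv a d x = (J Y x + \<nu> * cv a (J Y) x) - (J s0 x + \<nu> * cv a (J s0) x)"
          by (simp only: d_def) (simp add: algebra_simps)
        then show "\<bar>d x + \<nu> * cv a d x\<bar> \<le> ?N * (\<nu> * h)"
          using scheme_equation(2)[OF h x] integrated_equation[OF x] by (simp add: Y_def)
      qed (use t in auto)
      then show "\<bar>Z h \<nu> t - J s0 t\<bar> \<le> C * (?N * \<nu>) * h"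
        using scheme_equation(1)[OF h t] by (simp add: d_def Y_def mult_ac)
    qed
  qed
qed

lemma J_diff:
  assumes "0 \<le> x" "x \<le> y" "y \<le> T"
  shows "J s0 y - J s0 x = (LINT \<tau>|lborel. indicator {x..y} \<tau> * s0 \<tau>)"
    and "integrable lborel (\<lambda>\<tau>. indicator {x..y} \<tau> * s0 \<tau>)"
proof -
  obtain B where B: "B \<ge> 0" "\<And>x. \<bar>s0 x\<bar> \<le> B" using s0_bounded by blast
  have int: "integrable lborel (\<lambda>\<tau>. indicator {x..y} \<tau> * s0 \<tau>)" for x y :: real
    by (rule integrable_mult_bounded[OF integrable_indicator_Icc s0_meas B(2)])
  then show "integrable lborel (\<lambda>\<tau>. indicator {x..y} \<tau> * s0 \<tau>)" .
  have "J s0 y - J s0 x = (LINT \<tau>|lborel. indicator {0..y} \<tau> * s0 \<tau> - indicator {0..x} \<tau> * s0 \<tau>)"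
    using assms s0_neg int by (simp add: cv_indicator)
  also have "\<dots> = (LINT \<tau>|lborel. indicator {x..y} \<tau> * s0 \<tau>)"
    by (rule integral_cong_AE)
       (use AE_lborel_singleton[of x] assms in \<open>auto elim!: eventually_mono simp: indicator_def\<close>)
  finally show "J s0 y - J s0 x = (LINT \<tau>|lborel. indicator {x..y} \<tau> * s0 \<tau>)" .
qed

text \<open>Monotonicity in time squeezes \<open>step\<close> at \<open>t\<close> between the
  difference quotients of \<open>Z\<close> over the windows to the right and to the left of
  \<open>t\<close>. The window is fixed first, by continuity of \<open>s\<close>, and only then
  \<open>h\<close> tends to \<open>0\<close>.\<close>

lemma step_LIMSEQ:
  assumes t: "0 < t" "t < T"
  shows "(\<lambda>n. step (1 / real (Suc n)) \<nu> t) \<longlonglongrightarrow> s t"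
proof (rule LIMSEQ_I)
  fix r :: real assume r: "r > 0"
  define e where "e = r / 3"
  have e: "e > 0" using r by (simp add: e_def)
  obtain C where C: "C \<ge> 0" "\<And>h t. h > 0 \<Longrightarrow> 0 \<le> t \<Longrightarrow> t \<le> T \<Longrightarrow> \<bar>Z h \<nu> t - J s0 t\<bar> \<le> C * h"
    using Z_convergence by blast
  have "continuous (at t within {0..T}) s" using s_cont t by (auto simp: continuous_on_eq_continuous_within)
  then obtain d where d: "d > 0" "\<And>x. x \<in> {0..T} \<Longrightarrow> dist x t < d \<Longrightarrow> dist (s x) (s t) < e"
    using e unfolding continuous_within_eps_delta by blast
  define \<eta> where "\<eta> = Min {d / 2, t, T - t}"
  have \<eta>: "\<eta> > 0" "\<eta> < d" "\<eta> \<le> t" "t + \<eta> \<le> T" using d t by (auto simp: \<eta>_def)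
  have near: "\<bar>s x - s t\<bar> < e" if "t - \<eta> \<le> x" "x \<le> t + \<eta>" for x
    using d(2)[of x] that \<eta> by (auto simp: dist_real_def)
  have up: "J s0 t - J s0 (t - \<eta>) \<le> \<eta> * (s t + e)"
  proof -
    have "J s0 t - J s0 (t - \<eta>) = (LINT \<tau>|lborel. indicator {t-\<eta>..t} \<tau> * s0 \<tau>)"
      by (rule J_diff(1)) (use \<eta> t in auto)
    also have "\<dots> \<le> (LINT \<tau>|lborel. indicator {t-\<eta>..t} \<tau> * (s t + e))"
    proof (rule integral_mono)
      show "integrable lborel (\<lambda>\<tau>. indicator {t-\<eta>..t} \<tau> * s0 \<tau>)" by (rule J_diff(2)) (use \<eta> t in auto)
      show "integrable lborel (\<lambda>\<tau>. indicator {t-\<eta>..t} \<tau> * (s t + e))" by (rule integrable_Icc)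
      show "indicator {t-\<eta>..t} \<tau> * s0 \<tau> \<le> indicator {t-\<eta>..t} \<tau> * (s t + e)" for \<tau>
        using near[of \<tau>] \<eta> t by (auto simp: indicator_def s0_def)
    qed
    also have "\<dots> = \<eta> * (s t + e)" using \<eta> by simp
    finally show ?thesis .
  qed
  have lo: "\<eta> * (s t - e) \<le> J s0 (t + \<eta>) - J s0 t"
  proof -
    have "\<eta> * (s t - e) = (LINT \<tau>|lborel. indicator {t..t+\<eta>} \<tau> * (s t - e))" using \<eta> by simp
    also have "\<dots> \<le> (LINT \<tau>|lborel. indicator {t..t+\<eta>} \<tau> * s0 \<tau>)"
    proof (rule integral_mono)
      show "integrable lborel (\<lambda>\<tau>. indicator {t..t+\<eta>} \<tau> * s0 \<tau>)" by (rule J_diff(2)) (use \<eta> t in auto)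
      show "integrable lborel (\<lambda>\<tau>. indicator {t..t+\<eta>} \<tau> * (s t - e))" by (rule integrable_Icc)
      show "indicator {t..t+\<eta>} \<tau> * (s t - e) \<le> indicator {t..t+\<eta>} \<tau> * s0 \<tau>" for \<tau>
        using near[of \<tau>] \<eta> t by (auto simp: indicator_def s0_def)
    qed
    also have "\<dots> = J s0 (t + \<eta>) - J s0 t"
      by (rule J_diff(1)[symmetric]) (use \<eta> t in auto)
    finally show ?thesis .
  qed
  \<comment> \<open>An increment of \<open>Z\<close> carries two errors of size
    \<open>C * h\<close>, and the window length \<eta> is divided out afterwards.\<close>
  have "(\<lambda>n. 2 * C * (1 / real (Suc n))) \<longlonglongrightarrow> 2 * C * 0" by (intro tendsto_mult tendsto_const LIMSEQ_Suc lim_1_over_n)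
  then have "eventually (\<lambda>n. 2 * C * (1 / real (Suc n)) < \<eta> * e) sequentially"
    using \<eta> e by (intro order_tendstoD(2)) auto
  then obtain N where N: "\<And>n. n \<ge> N \<Longrightarrow> 2 * C * (1 / real (Suc n)) < \<eta> * e"
    by (auto simp: eventually_sequentially)
  show "\<exists>no. \<forall>n\<ge>no. norm (step (1 / real (Suc n)) \<nu> t - s t) < r"
  proof (intro exI allI impI)
    fix n assume n: "n \<ge> N"
    define h where "h = 1 / real (Suc n)"
    have h: "h > 0" by (simp add: h_def)
    have h2: "2 * (C * h) < \<eta> * e" using N[OF n] by (simp add: h_def)
    have zt: "\<bar>Z h \<nu> t - J s0 t\<bar> \<le> C * h" "\<bar>Z h \<nu> (t - \<eta>) - J s0 (t - \<eta>)\<bar> \<le> C * h"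
      "\<bar>Z h \<nu> (t + \<eta>) - J s0 (t + \<eta>)\<bar> \<le> C * h"
      using C(2)[OF h] t \<eta> by auto
    have 1: "\<eta> * step h \<nu> t \<le> Z h \<nu> t - Z h \<nu> (t - \<eta>)"
      using Z_lower[OF h \<nu>, of "t - \<eta>" t] \<eta> by simp
    have 2: "Z h \<nu> (t + \<eta>) - Z h \<nu> t \<le> \<eta> * step h \<nu> t"
      using Z_upper[OF h \<nu>, of t "t + \<eta>"] \<eta> t by simp
    have "\<eta> * step h \<nu> t \<le> \<eta> * (s t + e) + \<eta> * e" using 1 up zt h2 by linarith
    then have "\<eta> * step h \<nu> t \<le> \<eta> * (s t + 2 * e)" by (simp add: algebra_simps)
    then have 3: "step h \<nu> t \<le> s t + 2 * e" using \<eta> by simp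
    have "\<eta> * (s t - e) - \<eta> * e \<le> \<eta> * step h \<nu> t" using 2 lo zt h2 by linarith
    then have "\<eta> * (s t - 2 * e) \<le> \<eta> * step h \<nu> t" by (simp add: algebra_simps)
    then have 4: "s t - 2 * e \<le> step h \<nu> t" using \<eta> by simp
    have "\<bar>step h \<nu> t - s t\<bar> \<le> 2 * e" using 3 4 by linarith
    also have "\<dots> < r" using e by (simp add: e_def)
    finally show "norm (step (1 / real (Suc n)) \<nu> t - s t) < r" by (simp add: h_def)
  qed
qed

lemma solution_bounds:
  assumes t: "0 < t" "t < T"
  shows "0 \<le> s t" "s t \<le> 1"
proof -
  have "0 \<le> step (1 / real (Suc n)) \<nu> t" "step (1 / real (Suc n)) \<nu> t \<le> 1" for n
    by (rule step_bounds[OF _ \<nu>]; simp)+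
  then show "0 \<le> s t" "s t \<le> 1"
    using LIMSEQ_le_const[OF step_LIMSEQ[OF t]] LIMSEQ_le_const2[OF step_LIMSEQ[OF t]] by blast+
qed

lemma solution_decay:
  assumes t: "0 < t" "t < T"
  shows "\<nu> * (t * s t) \<le> \<beta> + (LINT x|lborel. k x)"
proof (rule LIMSEQ_le)
  show "(\<lambda>n. \<nu> * (t * step (1 / real (Suc n)) \<nu> t)) \<longlonglongrightarrow> \<nu> * (t * s t)"
    by (intro tendsto_mult tendsto_const step_LIMSEQ[OF t])
  have "(\<lambda>n. \<beta> + (LINT x|lborel. k x) + \<nu> * (1 / real (Suc n))) \<longlonglongrightarrow> \<beta> + (LINT x|lborel. k x) + \<nu> * 0"
    by (intro tendsto_intros LIMSEQ_Suc lim_1_over_n)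
  then show "(\<lambda>n. \<beta> + (LINT x|lborel. k x) + \<nu> * (1 / real (Suc n))) \<longlonglongrightarrow> \<beta> + (LINT x|lborel. k x)" by simp
  show "\<exists>N. \<forall>n\<ge>N. \<nu> * (t * step (1 / real (Suc n)) \<nu> t) \<le> \<beta> + (LINT x|lborel. k x) + \<nu> * (1 / real (Suc n))"
    using t by (intro exI[of _ 0] allI impI step_decay[OF _ \<nu>]) auto
qed

end

lemma power_mixture_solution:
  assumes t: "0 < t" "t < T" and d: "0 < d" "d \<le> 1"
    and c: "\<And>\<nu>. \<nu> \<ge> 0 \<Longrightarrow> continuous_on {0..T} (s \<nu>)"
    and e: "\<And>\<nu> t. \<nu> \<ge> 0 \<Longrightarrow> 0 \<le> t \<Longrightarrow> t \<le> T \<Longrightarrow> s \<nu> t + \<nu> * cv a (\<lambda>\<tau>. indicator {0..T} \<tau> * s \<nu> \<tau>) t = 1"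
  shows "power_mixture (\<lambda>x. s (x powr d) t)"
proof (rule power_mixture_LIMSEQ)
  show "power_mixture (\<lambda>x. step (1 / real (Suc n)) (x powr d) t)" for n
    unfolding step_def
    by (intro euler_scheme.euler_power_mixture euler_scheme_\<kappa> d) simp
  show "(\<lambda>n. step (1 / real (Suc n)) (x powr d) t) \<longlonglongrightarrow> s (x powr d) t" for x
    by (rule step_LIMSEQ[OF _ c e t]) auto
qed

end

section \<open>The relaxation function\<close>

locale relaxation_kernel =
  fixes \<gamma> :: real and m g :: "real \<Rightarrow> real"
  assumes g_meas[measurable]: "g \<in> borel_measurable borel" and g_neg: "\<And>t. t < 0 \<Longrightarrow> g t = 0"
    and g_loc: "\<And>T. integrable lborel (\<lambda>t. indicator {..T} t * g t)"
    and g_AE: "AE t in lborel. 0 \<le> t \<longrightarrow> g t = m_gamma \<gamma> m t"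
    and m_loc: "L1_loc m"
    and cp: "\<And>T. T > 0 \<Longrightarrow> \<exists>k \<beta>. cp_kernel (\<lambda>t. indicator {..T} t * g t) k \<beta> T"
begin

lemma cv_truncate:
  assumes "t \<le> T" "\<And>\<tau>. \<tau> < 0 \<Longrightarrow> b \<tau> = 0"
  shows "cv g b t = cv (\<lambda>t. indicator {..T} t * g t) (\<lambda>\<tau>. indicator {0..T} \<tau> * b \<tau>) t"
  unfolding cv_def
proof (rule Bochner_Integration.integral_cong[OF refl])
  fix \<tau>
  show "g (t - \<tau>) * b \<tau> = indicator {..T} (t - \<tau>) * g (t - \<tau>) * (indicator {0..T} \<tau> * b \<tau>)"
    using assms g_neg[of "t - \<tau>"] by (cases "\<tau> < 0"; cases "\<tau> \<le> t") auto
qed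

lemma conv_m_gamma:
  assumes "continuous_on {0..} s"
  shows "conv (m_gamma \<gamma> m) s t = cv g (\<lambda>\<tau>. indicator {0..} \<tau> * s \<tau>) t"
proof (rule conv_eq_cv[OF g_meas _ g_AE g_neg])
  show "(\<lambda>\<tau>. indicator {0..} \<tau> * s \<tau>) \<in> borel_measurable borel"
    using borel_measurable_continuous_on_indicator[OF _ assms] by simp
qed auto

lemma conv_m_gamma':
  assumes "continuous_on {0..} s" "t \<le> T"
  shows "conv (m_gamma \<gamma> m) s t
    = cv (\<lambda>t. indicator {..T} t * g t) (\<lambda>\<tau>. indicator {0..T} \<tau> * s \<tau>) t"
proof -
  have "(\<lambda>\<tau>. indicator {0..T} \<tau> * (indicator {0..} \<tau> * s \<tau>)) = (\<lambda>\<tau>. indicator {0..T} \<tau> * s \<tau> :: real)"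
    by (auto simp: indicator_def)
  then show ?thesis
    unfolding conv_m_gamma[OF assms(1)]
    using cv_truncate[OF assms(2), of "\<lambda>\<tau>. indicator {0..} \<tau> * s \<tau>"] by simp
qed

lemma trunc_int: "integrable lborel (\<lambda>t. indicator {..T} t * g t)"
  and trunc_neg: "t < 0 \<Longrightarrow> indicator {..T} t * g t = 0"
  using g_loc g_neg by auto

lemma truncated_bounded:
  fixes s :: "real \<Rightarrow> real"
  assumes "continuous_on {0..} s"
  shows "\<exists>B. \<forall>x. \<bar>indicator {0..T} x * s x\<bar> \<le> B"
proof -
  have "continuous_on {0..T} s" using assms by (rule continuous_on_subset) auto
  then have "bounded (s ` {0..T})" by (intro compact_imp_bounded compact_continuous_image) auto
  then obtain B where "\<forall>x\<in>{0..T}. \<bar>s x\<bar> \<le> B" by (auto simp: bounded_iff)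
  then have "\<bar>indicator {0..T} x * s x\<bar> \<le> \<bar>B\<bar>" for x by (force simp: indicator_def)
  then show ?thesis by blast
qed

lemma truncated_measurable:
  fixes s :: "real \<Rightarrow> real"
  assumes "continuous_on {0..} s"
  shows "(\<lambda>x. indicator {0..T} x * s x) \<in> borel_measurable borel"
proof -
  have "continuous_on {0..T} s" using assms by (rule continuous_on_subset) auto
  then show ?thesis using borel_measurable_continuous_on_indicator[of "{0..T}" s] by simp
qed

lemma solution_exists: "\<nu> \<ge> 0 \<Longrightarrow> \<exists>s. relaxation_solution \<gamma> m \<nu> s"
proof -
  assume "\<nu> \<ge> 0"
  show ?thesis
  proof (rule volterra_exists[OF g_meas g_neg g_loc \<open>\<nu> \<ge> 0\<close>])
    fix s assume "continuous_on {0..} s"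
      "\<And>t. t \<ge> 0 \<Longrightarrow> s t + \<nu> * cv g (\<lambda>t. indicator {0..} t * s t) t = 1"
    then show ?thesis
      by (auto simp: relaxation_solution_def conv_m_gamma intro!: exI[of _ s])
  qed
qed

text \<open>The difference of two solutions has residual \<open>0\<close>, so the stability bound
  with \<open>e = 0\<close> applies. It justifies the definite description in
  \<open>s_gamma\<close>.\<close>

lemma solution_unique:
  assumes s: "relaxation_solution \<gamma> m \<nu> s" and s': "relaxation_solution \<gamma> m \<nu> s'"
    and \<nu>: "\<nu> \<ge> 0" and t: "t \<ge> 0"
  shows "s t = s' t"
proof (rule volterra_stability[OF trunc_int[of t] trunc_neg \<nu> t])
  let ?a = "\<lambda>x. indicator {..t} x * g x" and ?r = "\<lambda>s x. indicator {0..t} x * s x :: real"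
  fix C assume "C \<ge> 0" and C: "\<And>d B e x. \<lbrakk>\<And>x. \<bar>d x\<bar> \<le> B; \<And>x. x < 0 \<Longrightarrow> d x = 0;
       \<And>x. 0 \<le> x \<Longrightarrow> x \<le> t \<Longrightarrow> \<bar>d x + \<nu> * cv ?a d x\<bar> \<le> e; 0 \<le> x; x \<le> t\<rbrakk> \<Longrightarrow> \<bar>d x\<bar> \<le> C * e"
  have c: "continuous_on {0..} s" "continuous_on {0..} s'"
    using s s' by (auto simp: relaxation_solution_def)
  obtain B where B: "\<And>x. \<bar>?r s x\<bar> \<le> B" using truncated_bounded[OF c(1)] by blast
  obtain B' where B': "\<And>x. \<bar>?r s' x\<bar> \<le> B'" using truncated_bounded[OF c(2)] by blast
  define d where "d = (\<lambda>x. 1 * ?r s x + (-1) * ?r s' x)"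
  have "\<bar>d t\<bar> \<le> C * 0"
  proof (rule C[of d "B + B'"])
    show "\<bar>d x\<bar> \<le> B + B'" for x using B[of x] B'[of x] by (simp add: d_def)
    show "d x = 0" if "x < 0" for x using that by (simp add: d_def)
    fix x assume x: "0 \<le> x" "x \<le> t"
    have "s x + \<nu> * cv ?a (?r s) x = 1" "s' x + \<nu> * cv ?a (?r s') x = 1"
      using s s' x conv_m_gamma'[OF c(1) x(2)] conv_m_gamma'[OF c(2) x(2)]
      by (auto simp: relaxation_solution_def)
    moreover have cvd: "cv ?a d x = 1 * cv ?a (?r s) x + (-1) * cv ?a (?r s') x"
      unfolding d_def
      by (rule cv_add[OF trunc_int truncated_measurable[OF c(1)] B truncated_measurable[OF c(2)] B'])
    have "\<nu> * cv ?a d x = \<nu> * cv ?a (?r s) x - \<nu> * cv ?a (?r s') x"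
      by (simp only: cvd) (simp add: right_diff_distrib)
    moreover have "d x = s x - s' x" using x by (simp add: d_def)
    ultimately have "d x + \<nu> * cv ?a d x = 0" by linarith
    then show "\<bar>d x + \<nu> * cv ?a d x\<bar> \<le> 0" by simp
  qed (use t in auto)
  then show "s t = s' t" using t by (simp add: d_def)
qed

lemma s_gamma_eq:
  assumes "relaxation_solution \<gamma> m \<nu> s" "\<nu> \<ge> 0" "t \<ge> 0"
  shows "s_gamma \<gamma> m t \<nu> = s t"
  unfolding s_gamma_def
  by (rule the_equality) (use assms solution_unique in blast)+

definition sol :: "real \<Rightarrow> real \<Rightarrow> real" where
  "sol \<nu> = (SOME s. relaxation_solution \<gamma> m \<nu> s)"

lemma sol: "\<nu> \<ge> 0 \<Longrightarrow> relaxation_solution \<gamma> m \<nu> (sol \<nu>)"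
  unfolding sol_def using solution_exists by (rule someI_ex)

lemma s_gamma_sol: "\<nu> \<ge> 0 \<Longrightarrow> t \<ge> 0 \<Longrightarrow> s_gamma \<gamma> m t \<nu> = sol \<nu> t"
  using s_gamma_eq sol by blast

lemma sol_cont: "\<nu> \<ge> 0 \<Longrightarrow> continuous_on {0..} (sol \<nu>)"
  using sol by (auto simp: relaxation_solution_def)

lemma sol_equation:
  assumes "\<nu> \<ge> 0" "0 \<le> t" "t \<le> T"
  shows "sol \<nu> t + \<nu> * cv (\<lambda>t. indicator {..T} t * g t) (\<lambda>\<tau>. indicator {0..T} \<tau> * sol \<nu> \<tau>) t = 1"
  using sol[OF assms(1)] conv_m_gamma'[OF sol_cont[OF assms(1)] assms(3)] assms(2)
  by (auto simp: relaxation_solution_def)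

lemma sol_cont_Icc: "\<nu> \<ge> 0 \<Longrightarrow> continuous_on {0..T} (sol \<nu>)"
  by (rule continuous_on_subset[OF sol_cont]) auto

lemma s_gamma_zero: "t \<ge> 0 \<Longrightarrow> s_gamma \<gamma> m t 0 = 1"
  using s_gamma_sol[of 0 t] sol_equation[of 0 t t] by simp

lemma s_gamma_bounds:
  assumes "\<nu> \<ge> 0" "t > 0"
  shows "0 \<le> s_gamma \<gamma> m t \<nu>" "s_gamma \<gamma> m t \<nu> \<le> 1"
proof -
  \<comment> \<open>The scheme is shown to converge strictly inside the horizon, hence
    \<open>t+1\<close> instead of \<open>t\<close>.\<close>
  obtain k \<beta> where "cp_kernel (\<lambda>x. indicator {..t+1} x * g x) k \<beta> (t+1)"
    using cp[of "t+1"] assms by auto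
  then interpret cp_kernel "\<lambda>x. indicator {..t+1} x * g x" k \<beta> "t+1" .
  show "0 \<le> s_gamma \<gamma> m t \<nu>" "s_gamma \<gamma> m t \<nu> \<le> 1"
    using solution_bounds[OF assms(1) sol_cont_Icc[OF assms(1)] sol_equation[OF assms(1)], of t] assms
      s_gamma_sol by auto
qed

lemma s_gamma_decay:
  assumes "t > 0"
  obtains K where "\<And>\<nu>. \<nu> \<ge> 0 \<Longrightarrow> \<nu> * s_gamma \<gamma> m t \<nu> \<le> K"
proof -
  obtain k \<beta> where "cp_kernel (\<lambda>x. indicator {..t+1} x * g x) k \<beta> (t+1)"
    using cp[of "t+1"] assms by auto
  then interpret cp_kernel "\<lambda>x. indicator {..t+1} x * g x" k \<beta> "t+1" .
  show ?thesis
  proof (rule that)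
    fix \<nu> :: real assume "\<nu> \<ge> 0"
    then have "\<nu> * (t * s_gamma \<gamma> m t \<nu>) \<le> \<beta> + integral\<^sup>L lborel k"
      using solution_decay[OF _ sol_cont_Icc sol_equation, of \<nu> t] assms s_gamma_sol by auto
    then show "\<nu> * s_gamma \<gamma> m t \<nu> \<le> (\<beta> + integral\<^sup>L lborel k) / t"
      using assms by (simp add: field_simps)
  qed
qed

lemma power_mixture_s_gamma:
  assumes "t > 0" "0 < d" "d \<le> 1"
  shows "power_mixture (\<lambda>x. s_gamma \<gamma> m t (x powr d))"
proof -
  obtain k \<beta> where "cp_kernel (\<lambda>x. indicator {..t+1} x * g x) k \<beta> (t+1)"
    using cp[of "t+1"] assms by auto
  then interpret cp_kernel "\<lambda>x. indicator {..t+1} x * g x" k \<beta> "t+1" .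
  have "power_mixture (\<lambda>x. sol (x powr d) t)"
    by (rule power_mixture_solution[OF assms(1) _ assms(2,3) sol_cont_Icc sol_equation]) auto
  then show ?thesis using assms s_gamma_sol by simp
qed

lemma integral_m_gamma:
  assumes t: "t > 0"
  shows "cv g (indicator {0..}) t = t + \<gamma> * conv (\<lambda>_. 1) m t"
proof -
  have m: "integrable lebesgue (\<lambda>x. indicator {0..t} x * m x)"
    using m_loc t by (auto simp: L1_loc_def set_integrable_def)
  have i: "integrable lebesgue (indicator {0..t} :: real \<Rightarrow> real)"
    by (rule integrable_real_indicator) (auto simp: emeasure_lborel_Icc_eq)
  have "t + \<gamma> * conv (\<lambda>_. 1) m t
      = (LINT x|lebesgue. indicator {0..t} x) + \<gamma> * (LINT x|lebesgue. indicator {0..t} x * m x)"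
    using t by (simp add: conv_def set_lebesgue_integral_def)
  also have "\<dots> = (LINT x|lebesgue. indicator {0..t} x + \<gamma> * (indicator {0..t} x * m x))"
    using m i by (subst Bochner_Integration.integral_add) auto
  also have "\<dots> = conv (\<lambda>_. 1) (m_gamma \<gamma> m) t"
    unfolding conv_def set_lebesgue_integral_def
    by (rule Bochner_Integration.integral_cong) (auto simp: m_gamma_def indicator_def)
  also have "\<dots> = cv (indicator {0..}) g t"
    by (rule conv_eq_cv) (use g_AE g_neg in auto)
  finally show ?thesis by (simp add: cv_commute)
qed

text \<open>The quotient is exactly the convolution of the kernel with the solution. As the solution
  lies between \<open>0\<close> and \<open>1\<close>, its equation gives a deviation from
  \<open>1\<close> of order \<nu>, uniformly on \<open>{0..t}\<close>, and a second convolution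
  yields the rate with the squared norm of the kernel.\<close>

lemma s_gamma_derivative_at_zero:
  assumes t: "t > 0"
  obtains K where "\<And>\<nu>. \<nu> > 0 \<Longrightarrow> \<bar>(1 - s_gamma \<gamma> m t \<nu>) / \<nu> - (t + \<gamma> * conv (\<lambda>_. 1) m t)\<bar> \<le> K * \<nu>"
proof -
  let ?a = "\<lambda>x. indicator {..t} x * g x" and ?r = "\<lambda>s x. indicator {0..t} x * s x :: real"
  let ?N = "LINT x|lborel. \<bar>?a x\<bar>"
  show ?thesis
  proof (rule that[of "?N * ?N"])
    fix \<nu> :: real assume \<nu>: "\<nu> > 0"
    have N: "?N \<ge> 0" by (rule integral_nonneg_AE) auto
    have s01: "0 \<le> sol \<nu> x \<and> sol \<nu> x \<le> 1" if "x \<ge> 0" for x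
      using s_gamma_bounds[of \<nu> x] s_gamma_sol[of \<nu> x] \<nu> that sol_equation[of \<nu> 0 0]
    proof (cases "x = 0")
      case True
      have "cv (\<lambda>t. indicator {..0} t * g t) (\<lambda>\<tau>. indicator {0..0} \<tau> * sol \<nu> \<tau>) 0 = 0"
        unfolding cv_def
        by (rule integral_eq_zero_AE, rule eventually_mono[OF AE_lborel_singleton[of "0::real"]]) auto
      then show ?thesis using sol_equation[of \<nu> 0 0] \<nu> True by simp
    qed auto
    have rm: "?r s \<in> borel_measurable borel" if "continuous_on {0..} s" for s
      by (rule truncated_measurable[OF that])
    have rb: "\<bar>?r (sol \<nu>) x\<bar> \<le> 1" for x using s01[of x] by (auto simp: indicator_def)
    have dev: "\<bar>1 - sol \<nu> x\<bar> \<le> \<nu> * ?N" if "0 \<le> x" "x \<le> t" for x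
    proof -
      have "\<bar>cv ?a (?r (sol \<nu>)) x\<bar> \<le> ?N * 1"
        by (rule cv_abs_le[OF trunc_int rm[OF sol_cont] rb]) (use \<nu> in auto)
      then have "\<nu> * \<bar>cv ?a (?r (sol \<nu>)) x\<bar> \<le> \<nu> * ?N" using \<nu> by simp
      moreover have "1 - sol \<nu> x = \<nu> * cv ?a (?r (sol \<nu>)) x" using sol_equation[OF _ that] \<nu> by (simp add: algebra_simps)
      ultimately show ?thesis using \<nu> by (simp add: abs_mult)
    qed
    have "(1 - s_gamma \<gamma> m t \<nu>) / \<nu> = cv ?a (?r (sol \<nu>)) t"
      using sol_equation[of \<nu> t t] s_gamma_sol[of \<nu> t] \<nu> t by (simp add: field_simps)
    moreover have "t + \<gamma> * conv (\<lambda>_. 1) m t = cv ?a (?r (indicator {0..})) t"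
      unfolding integral_m_gamma[OF t, symmetric] by (rule cv_truncate) auto
    moreover have "cv ?a (?r (sol \<nu>)) t - cv ?a (?r (indicator {0..})) t
        = cv ?a (\<lambda>x. 1 * ?r (sol \<nu>) x + (-1) * ?r (indicator {0..}) x) t"
    proof -
      have "\<bar>?r (indicator {0..}) x\<bar> \<le> 1" for x by (auto simp: indicator_def)
      from cv_add[OF trunc_int rm[OF sol_cont] rb _ this, where c=1 and c'="-1"] \<nu>
      show ?thesis by simp
    qed
    moreover have "\<bar>cv ?a (\<lambda>x. 1 * ?r (sol \<nu>) x + (-1) * ?r (indicator {0..}) x) t\<bar> \<le> ?N * (\<nu> * ?N)"
    proof (rule cv_abs_le[OF trunc_int])
      show "(\<lambda>x. 1 * ?r (sol \<nu>) x + (-1) * ?r (indicator {0..}) x) \<in> borel_measurable borel"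
        using rm[OF sol_cont, of \<nu>] \<nu> by auto
      show "\<bar>1 * ?r (sol \<nu>) x + (-1) * ?r (indicator {0..}) x\<bar> \<le> \<nu> * ?N" for x
        using dev[of x] N \<nu> by (auto simp: indicator_def)
    qed
    ultimately show "\<bar>(1 - s_gamma \<gamma> m t \<nu>) / \<nu> - (t + \<gamma> * conv (\<lambda>_. 1) m t)\<bar> \<le> ?N * ?N * \<nu>"
      by (simp add: mult_ac)
  qed
qed

end

section \<open>From the hypothesis on \<open>m\<close> to truncated kernels\<close>

lemma L1_loc_m_gamma: "L1_loc m \<Longrightarrow> L1_loc (m_gamma \<gamma> m)"
  unfolding L1_loc_def m_gamma_def
  by (intro allI impI set_integral_add set_integrable_mult_right) 
     (auto simp: set_integrable_def intro!: integrable_real_indicator simp: emeasure_lborel_Icc_eq)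

lemma antimono_measurable:
  assumes "antimono_on {0<..} (k :: real \<Rightarrow> real)"
  shows "(\<lambda>t. indicator {0<..} t * k t) \<in> borel_measurable borel"
proof -
  have "mono_on {0<..} (\<lambda>x. - k x)" using assms by (auto simp: monotone_on_def)
  then have "(\<lambda>x. - k x) \<in> borel_measurable (restrict_space borel {0<..})"
    by (rule borel_measurable_mono_on_fnc)
  then have "(\<lambda>x. - (- k x)) \<in> borel_measurable (restrict_space borel {0<..})"
    by (rule borel_measurable_uminus)
  then show ?thesis
    by (subst (asm) borel_measurable_restrict_space_iff) (auto simp: mult.commute)
qed

lemma condition_H_kernel:
  assumes "condition_H \<gamma> m"
  obtains g where "relaxation_kernel \<gamma> m g"
proof -
  from assms obtain k \<beta> where m: "L1_loc m" and k: "L1_loc k" "\<And>t. t > 0 \<Longrightarrow> 0 \<le> k t"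
    "antimono_on {0<..} k" and \<beta>: "0 \<le> \<beta>"
    and ae: "AE t in lebesgue. t > 0 \<longrightarrow> \<beta> * m_gamma \<gamma> m t + conv k (m_gamma \<gamma> m) t = 1"
    unfolding condition_H_def by blast
  have ae: "AE t in lborel. t > 0 \<longrightarrow> \<beta> * m_gamma \<gamma> m t + conv k (m_gamma \<gamma> m) t = 1"
    using ae by (simp add: AE_completion_iff)
  obtain g where g: "g \<in> borel_measurable borel" "\<And>t. t < 0 \<Longrightarrow> g t = 0"
    "\<And>T. integrable lborel (\<lambda>t. indicator {..T} t * g t)" "AE t in lborel. 0 \<le> t \<longrightarrow> g t = m_gamma \<gamma> m t"
    using L1_loc_representative[OF L1_loc_m_gamma[OF m]] by blast
  obtain kr where kr: "kr \<in> borel_measurable borel" "\<And>t. t < 0 \<Longrightarrow> kr t = 0"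
    "\<And>T. integrable lborel (\<lambda>t. indicator {..T} t * kr t)" "AE t in lborel. 0 \<le> t \<longrightarrow> kr t = k t"
    using L1_loc_representative[OF k(1)] by blast
  \<comment> \<open>Monotonicity has to hold at every point, which a representative equal only
    almost everywhere would not keep. On the positive axis \<open>k\<close> itself is Borel, being
    monotone; \<open>kr\<close> only supplies integrability.\<close>
  define k0 where "k0 = (\<lambda>t. indicator {0<..} t * k t)"
  have k0m: "k0 \<in> borel_measurable borel" unfolding k0_def by (rule antimono_measurable[OF k(3)])
  have k0k: "AE t in lborel. 0 \<le> t \<longrightarrow> k0 t = k t"
    using AE_lborel_singleton[of "0::real"] by eventually_elim (auto simp: k0_def)
  have conv: "conv k (m_gamma \<gamma> m) t = cv k0 g t" for t
    by (rule conv_eq_cv[OF k0m g(1) k0k _ g(4,2)]) (auto simp: k0_def)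
  show ?thesis
  proof (rule that[of g], unfold_locales)
    fix T :: real assume T: "T > 0"
    let ?k = "\<lambda>t. indicator {..T} t * k0 t" and ?a = "\<lambda>t. indicator {..T} t * g t"
    have kint: "integrable lborel ?k"
    proof -
      have "integrable lborel ?k \<longleftrightarrow> integrable lborel (\<lambda>t. indicator {..T} t * kr t)"
      proof (rule integrable_cong_AE)
        show "AE t in lborel. indicator {..T} t * k0 t = indicator {..T} t * kr t"
          using k0k kr(4) 
        proof eventually_elim
          case (elim t)
          then show ?case using kr(2)[of t] by (cases "t < 0") (auto simp: k0_def)
        qed
      qed (use k0m kr(1) in measurable)
      then show ?thesis using kr(3) by simp
    qed
    have "cp_kernel ?a ?k \<beta> T"
    proof
      show "AE t in lborel. 0 < t \<and> t < T \<longrightarrow> \<beta> * ?a t + cv ?k ?a t = 1"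
        using ae g(4)
      proof eventually_elim
        case (elim t)
        show ?case
        proof
          assume t: "0 < t \<and> t < T"
          have "cv ?k ?a t = cv k0 g t" unfolding cv_def
          proof (rule Bochner_Integration.integral_cong[OF refl])
            fix \<tau>
            show "indicator {..T} (t - \<tau>) * k0 (t - \<tau>) * (indicator {..T} \<tau> * g \<tau>) = k0 (t - \<tau>) * g \<tau>"
              using t g(2)[of \<tau>] by (cases "\<tau> < 0"; cases "\<tau> \<le> t") (auto simp: k0_def)
          qed
          then show "\<beta> * ?a t + cv ?k ?a t = 1" using elim t conv[of t] by simp
        qed
      qed
      show "?k y \<le> ?k x" if "0 < x" "x \<le> y" for x y
        using that k(2)[of x] k(3) by (auto simp: k0_def indicator_def monotone_on_def)
    qed (use g kint k T \<beta> in \<open>auto simp: k0_def indicator_def\<close>)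
    then show "\<exists>k \<beta>. cp_kernel ?a k \<beta> T" by blast
  qed (use g m in auto)
qed

section \<open>Gaussians and uniqueness of the Fourier transform\<close>

text \<open>A product over coordinates, so that integrals and Fourier transforms factor; \<sigma> is
  the standard deviation in each coordinate, and \<open>gaussian_eq\<close> is the radial
  form.\<close>

definition gaussian :: "real \<Rightarrow> 'a::euclidean_space \<Rightarrow> real" where
  "gaussian \<sigma> x = (\<Prod>b\<in>Basis. normal_density 0 \<sigma> (x \<bullet> b))"

lemma gaussian_measurable[measurable]: "gaussian \<sigma> \<in> borel_measurable borel"
  unfolding gaussian_def by measurable

lemma gaussian_nonneg: "0 \<le> gaussian \<sigma> x"
  unfolding gaussian_def by (intro prod_nonneg) auto

lemma gaussian_eq:
  "gaussian \<sigma> (x::'a::euclidean_space) = (1 / sqrt (2 * pi * \<sigma>\<^sup>2)) ^ DIM('a) * exp (- (norm x)\<^sup>2 / (2 * \<sigma>\<^sup>2))"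
proof -
  have "(\<Prod>b\<in>Basis. exp (- (x \<bullet> b)\<^sup>2 / (2 * \<sigma>\<^sup>2))) = exp (\<Sum>b\<in>Basis. - (x \<bullet> b)\<^sup>2 / (2 * \<sigma>\<^sup>2))"
    by (rule exp_sum[symmetric]) simp
  also have "(\<Sum>b\<in>Basis. - (x \<bullet> b)\<^sup>2 / (2 * \<sigma>\<^sup>2)) = - (norm x)\<^sup>2 / (2 * \<sigma>\<^sup>2)"
    unfolding power2_norm_eq_inner euclidean_inner[of x x]
    by (simp add: sum_negf sum_divide_distrib power2_eq_square)
  finally show ?thesis
    by (simp only: gaussian_def normal_density_def diff_0_right prod.distrib prod_constant)
qed

lemma integral_lborel_prod:
  fixes f :: "'a::euclidean_space \<Rightarrow> real \<Rightarrow> complex"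
  assumes "\<And>b. b \<in> Basis \<Longrightarrow> integrable lborel (f b)"
  shows "(LINT x|lborel. (\<Prod>b\<in>Basis. f b (x \<bullet> b))) = (\<Prod>b\<in>Basis. LINT x|lborel. f b x)"
    and "integrable lborel (\<lambda>x::'a. \<Prod>b\<in>Basis. f b (x \<bullet> b))"
proof -
  interpret product_sigma_finite "\<lambda>_::'a. lborel :: real measure" by standard
  have [measurable]: "f b \<in> borel_measurable borel" if "b \<in> Basis" for b using assms[OF that] by auto
  have m: "(\<lambda>x::'a. \<Prod>b\<in>Basis. f b (x \<bullet> b)) \<in> borel_measurable borel" by measurable
  have comp: "(\<Prod>b\<in>Basis. f b ((\<Sum>c\<in>Basis. y c *\<^sub>R c) \<bullet> b)) = (\<Prod>b\<in>Basis. f b (y b))" for y :: "'a \<Rightarrow> real"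
    by (rule prod.cong) auto
  have m2: "(\<lambda>y. \<Sum>b\<in>Basis. y b *\<^sub>R b) \<in> (\<Pi>\<^sub>M b\<in>(Basis::'a set). lborel) \<rightarrow>\<^sub>M borel" by measurable
  show "(LINT x|lborel. (\<Prod>b\<in>Basis. f b (x \<bullet> b))) = (\<Prod>b\<in>Basis. LINT x|lborel. f b x)"
    by (subst lborel_eq, subst integral_distr[OF m2 m], unfold comp)
       (rule product_integral_prod, use assms in auto)
  show "integrable lborel (\<lambda>x::'a. \<Prod>b\<in>Basis. f b (x \<bullet> b))"
    by (subst lborel_eq, subst integrable_distr_eq[OF m2 m], unfold comp)
       (rule product_integrable_prod, use assms in auto)
qed

lemma fourier_normal_density:
  assumes \<sigma>: "\<sigma> > 0"
  shows "(LINT x|lborel. exp (- (\<i> * complex_of_real (x * t))) * complex_of_real (normal_density 0 \<sigma> x))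
       = complex_of_real (exp (- (\<sigma>\<^sup>2 * t\<^sup>2) / 2))"
    and "integrable lborel (\<lambda>x. exp (- (\<i> * complex_of_real (x * t))) * complex_of_real (normal_density 0 \<sigma> x))"
proof -
  have "integrable lborel (\<lambda>x. complex_of_real (normal_density 0 \<sigma> x))"
    using integrable_normal_moment[OF \<sigma>, of 0 0] by simp
  then show i: "integrable lborel (\<lambda>x. exp (- (\<i> * complex_of_real (x * t))) * complex_of_real (normal_density 0 \<sigma> x))"
    by (rule Bochner_Integration.integrable_bound) (auto simp: norm_mult)
  have "(LINT x|lborel. exp (- (\<i> * complex_of_real (x * t))) * complex_of_real (normal_density 0 \<sigma> x))
     = \<sigma> *\<^sub>R (LINT x|lborel. exp (- (\<i> * complex_of_real (\<sigma> * x * t))) * complex_of_real (normal_density 0 \<sigma> (\<sigma> * x)))"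
    using lborel_integral_real_affine[of \<sigma> "\<lambda>x. exp (- (\<i> * complex_of_real (x * t))) * complex_of_real (normal_density 0 \<sigma> x)" 0] \<sigma>
    by simp
  also have "\<dots> = (LINT x|lborel. \<sigma> *\<^sub>R (exp (- (\<i> * complex_of_real (\<sigma> * x * t))) * complex_of_real (normal_density 0 \<sigma> (\<sigma> * x))))"
    by simp
  also have "\<dots> = (LINT x|lborel. std_normal_density x *\<^sub>R iexp ((- \<sigma> * t) * x))"
  proof (rule Bochner_Integration.integral_cong[OF refl])
    fix x
    have "\<sigma> * normal_density 0 \<sigma> (\<sigma> * x) = std_normal_density x"
      using \<sigma> by (simp add: normal_density_def real_sqrt_mult power_mult_distrib)
    then show "\<sigma> *\<^sub>R (exp (- (\<i> * complex_of_real (\<sigma> * x * t))) * complex_of_real (normal_density 0 \<sigma> (\<sigma> * x)))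
        = std_normal_density x *\<^sub>R iexp ((- \<sigma> * t) * x)"
      by (simp add: scaleR_conv_of_real mult_ac flip: of_real_mult)
  qed
  also have "\<dots> = char std_normal_distribution (- \<sigma> * t)"
    unfolding char_def by (subst integral_density) auto
  also have "\<dots> = complex_of_real (exp (- (\<sigma>\<^sup>2 * t\<^sup>2) / 2))"
    by (simp add: char_std_normal_distribution power_mult_distrib)
  finally show "(LINT x|lborel. exp (- (\<i> * complex_of_real (x * t))) * complex_of_real (normal_density 0 \<sigma> x))
       = complex_of_real (exp (- (\<sigma>\<^sup>2 * t\<^sup>2) / 2))" .
qed

lemma fourier_gaussian:
  fixes \<xi> :: "'a::euclidean_space"
  assumes \<sigma>: "\<sigma> > 0"
  shows "fourier (\<lambda>x. complex_of_real (gaussian \<sigma> x)) \<xi> = complex_of_real (exp (- (\<sigma>\<^sup>2 * (norm \<xi>)\<^sup>2) / 2))"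
    and "integrable lborel (\<lambda>x. exp (- (\<i> * complex_of_real (x \<bullet> \<xi>))) * complex_of_real (gaussian \<sigma> x))"
proof -
  let ?f = "\<lambda>b x. exp (- (\<i> * complex_of_real (x * (\<xi> \<bullet> b)))) * complex_of_real (normal_density 0 \<sigma> x)"
  have eq: "exp (- (\<i> * complex_of_real (x \<bullet> \<xi>))) * complex_of_real (gaussian \<sigma> x) = (\<Prod>b\<in>Basis. ?f b (x \<bullet> b))" for x
  proof -
    have "exp (- (\<i> * complex_of_real (x \<bullet> \<xi>))) = exp (\<Sum>b\<in>Basis. - (\<i> * complex_of_real ((x \<bullet> b) * (\<xi> \<bullet> b))))"
      unfolding euclidean_inner[of x \<xi>] by (simp add: sum_negf sum_distrib_left)
    also have "\<dots> = (\<Prod>b\<in>Basis. exp (- (\<i> * complex_of_real ((x \<bullet> b) * (\<xi> \<bullet> b)))))"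
      by (rule exp_sum) simp
    finally show ?thesis by (simp add: gaussian_def prod.distrib)
  qed
  have "fourier (\<lambda>x. complex_of_real (gaussian \<sigma> x)) \<xi> = (\<Prod>b\<in>Basis. LINT x|lborel. ?f b x)"
    unfolding fourier_def eq by (rule integral_lborel_prod(1)) (rule fourier_normal_density(2)[OF \<sigma>])
  also have "\<dots> = (\<Prod>b\<in>Basis. complex_of_real (exp (- (\<sigma>\<^sup>2 * (\<xi> \<bullet> b)\<^sup>2) / 2)))"
    by (simp only: fourier_normal_density(1)[OF \<sigma>])
  also have "\<dots> = complex_of_real (exp (\<Sum>b\<in>Basis. - (\<sigma>\<^sup>2 * (\<xi> \<bullet> b)\<^sup>2) / 2))"
    by (simp only: exp_sum[OF finite_Basis] of_real_prod)
  also have "(\<Sum>b\<in>Basis. - (\<sigma>\<^sup>2 * (\<xi> \<bullet> b)\<^sup>2) / 2) = - (\<sigma>\<^sup>2 * (norm \<xi>)\<^sup>2) / 2"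
    unfolding power2_norm_eq_inner euclidean_inner[of \<xi> \<xi>]
    by (simp add: sum_negf sum_divide_distrib sum_distrib_left power2_eq_square)
  finally show "fourier (\<lambda>x. complex_of_real (gaussian \<sigma> x)) \<xi> = complex_of_real (exp (- (\<sigma>\<^sup>2 * (norm \<xi>)\<^sup>2) / 2))" .
  show "integrable lborel (\<lambda>x. exp (- (\<i> * complex_of_real (x \<bullet> \<xi>))) * complex_of_real (gaussian \<sigma> x))"
    unfolding eq by (rule integral_lborel_prod(2)) (rule fourier_normal_density(2)[OF \<sigma>])
qed

lemma gaussian_integrable:
  assumes "\<sigma> > 0"
  shows "integrable lborel (gaussian \<sigma> :: 'a::euclidean_space \<Rightarrow> real)"
    and "(LINT x|lborel. gaussian \<sigma> (x::'a)) = 1"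
proof -
  show i: "integrable lborel (gaussian \<sigma> :: 'a \<Rightarrow> real)"
    using integrable_norm[OF fourier_gaussian(2)[OF assms, of "0::'a"]]
    by (simp add: abs_of_nonneg[OF gaussian_nonneg])
  have "complex_of_real (LINT x|lborel. gaussian \<sigma> (x::'a)) = 1"
    using fourier_gaussian(1)[OF assms, of "0::'a"] by (simp add: fourier_def)
  then show "(LINT x|lborel. gaussian \<sigma> (x::'a)) = 1" by (simp only: of_real_eq_1_iff)
qed

text \<open>Self-duality: up to a constant, the Gaussian is its own Fourier transform, so a convolution
  with a Gaussian only sees the Fourier transform of the other factor.\<close>
lemma gaussian_smoothing_zero:
  fixes f :: "'a::euclidean_space \<Rightarrow> real"
  assumes f: "integrable lborel f" and F: "\<And>\<xi>. fourier (\<lambda>x. complex_of_real (f x)) \<xi> = 0" and \<sigma>: "\<sigma> > 0"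
  shows "(LINT x|lborel. f x * gaussian \<sigma> (x - y)) = 0"
proof -
  note [measurable] = borel_measurable_integrable[OF f]
  let ?H = "\<lambda>(x, \<eta>). (complex_of_real (f x) * exp (- (\<i> * complex_of_real ((x - y) \<bullet> \<eta>)))) * complex_of_real (gaussian (1/\<sigma>) \<eta>)"
  have intg: "integrable lborel (gaussian (1/\<sigma>) :: 'a \<Rightarrow> real)" using gaussian_integrable(1)[of "1/\<sigma>"] \<sigma> by simp
  have int: "integrable (lborel \<Otimes>\<^sub>M lborel) ?H"
  proof (rule Bochner_Integration.integrable_bound)
    have "integrable (lborel \<Otimes>\<^sub>M lborel) (\<lambda>(x::'a, \<eta>::'a). f x * gaussian (1/\<sigma>) \<eta>)"
    proof (rule lborel_pair.Fubini_integrable)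
      show "integrable lborel (\<lambda>x. LINT \<eta>|lborel. norm (case (x, \<eta>) of (x, \<eta>::'a) \<Rightarrow> f x * gaussian (1/\<sigma>) \<eta>))"
        using f by (simp add: abs_mult)
    qed (use intg in auto)
    then show "integrable (lborel \<Otimes>\<^sub>M lborel) (\<lambda>p. f (fst p) * gaussian (1/\<sigma>) (snd p :: 'a))"
      by (simp add: case_prod_beta')
  qed (auto simp: norm_mult split_beta)
  have "(LINT x|lborel. LINT \<eta>|lborel. ?H (x, \<eta>)) = (LINT \<eta>|lborel. LINT x|lborel. ?H (x, \<eta>))"
    using lborel_pair.Fubini_integral[of "\<lambda>x \<eta>. ?H (x, \<eta>)"] int by simp
  also have "\<dots> = 0"
  proof -
    have "(LINT x|lborel. ?H (x, \<eta>)) = 0" for \<eta>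
    proof -
      have "(LINT x|lborel. ?H (x, \<eta>)) = (LINT x|lborel. exp (- (\<i> * complex_of_real (x \<bullet> \<eta>))) * complex_of_real (f x)
          * (exp (\<i> * complex_of_real (y \<bullet> \<eta>)) * complex_of_real (gaussian (1/\<sigma>) \<eta>)))"
        by (rule Bochner_Integration.integral_cong)
           (simp_all add: inner_diff_left right_diff_distrib exp_diff exp_minus field_simps exp_add[symmetric])
      also have "\<dots> = fourier (\<lambda>x. complex_of_real (f x)) \<eta> * (exp (\<i> * complex_of_real (y \<bullet> \<eta>)) * complex_of_real (gaussian (1/\<sigma>) \<eta>))"
        unfolding fourier_def by (rule integral_mult_left_zero)
      finally show ?thesis using F by simp
    qed
    then show ?thesis by (simp only: integral_zero)
  qed
  finally have 0: "(LINT x|lborel. LINT \<eta>|lborel. ?H (x, \<eta>)) = 0" .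
  define c where "c = (1 / sqrt (2 * pi * \<sigma>\<^sup>2)) ^ DIM('a)"
  have c: "c > 0" using \<sigma> by (simp add: c_def)
  have "(LINT \<eta>|lborel. ?H (x, \<eta>)) = complex_of_real (f x * gaussian \<sigma> (x - y) / c)" for x
  proof -
    have "(LINT \<eta>|lborel. ?H (x, \<eta>)) = (LINT \<eta>|lborel. complex_of_real (f x) * (exp (- (\<i> * complex_of_real (\<eta> \<bullet> (x - y)))) * complex_of_real (gaussian (1/\<sigma>) \<eta>)))"
      by (simp add: mult.assoc inner_commute)
    also have "\<dots> = complex_of_real (f x) * fourier (\<lambda>x. complex_of_real (gaussian (1/\<sigma>) x)) (x - y)"
      unfolding fourier_def by (rule integral_mult_right_zero)
    also have "\<dots> = complex_of_real (f x * gaussian \<sigma> (x - y) / c)"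
    proof -
      have "gaussian \<sigma> (x - y) = c * exp (- ((1/\<sigma>)\<^sup>2 * (norm (x - y))\<^sup>2) / 2)"
        unfolding gaussian_eq c_def[symmetric] using \<sigma> by (simp add: power_divide mult.commute)
      then have "exp (- ((1/\<sigma>)\<^sup>2 * (norm (x - y))\<^sup>2) / 2) = gaussian \<sigma> (x - y) / c" using c by simp
      moreover have "1 / \<sigma> > 0" using \<sigma> by simp
      ultimately show ?thesis by (simp only: fourier_gaussian(1) of_real_mult of_real_divide times_divide_eq_right)
    qed
    finally show ?thesis .
  qed
  then have "complex_of_real (LINT x|lborel. f x * gaussian \<sigma> (x - y) / c) = 0"
    using 0 by (simp only: integral_complex_of_real)
  then show ?thesis using c by simp
qed

section \<open>Approximate identity and uniqueness of the transform\<close>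

lemma gaussian_rescale:
  fixes z :: "'a::euclidean_space"
  assumes "\<sigma> > 0"
  shows "\<sigma> ^ DIM('a) * gaussian \<sigma> (\<sigma> *\<^sub>R z) = gaussian 1 z"
  using assms
  by (simp add: gaussian_eq power_mult_distrib real_sqrt_mult power_divide)

text \<open>Substituting \<open>y = x - \<sigma> *\<^sub>R z\<close> moves \<sigma> into the
  argument of \<phi>, so that one fixed Gaussian dominates as \<sigma> tends to
  \<open>0\<close>.\<close>

lemma gaussian_average:
  fixes \<phi> :: "'a::euclidean_space \<Rightarrow> real"
  assumes [measurable]: "\<phi> \<in> borel_measurable borel" and \<sigma>: "\<sigma> > 0"
  shows "(LINT y|lborel. \<phi> y * gaussian \<sigma> (x - y)) = (LINT z|lborel. \<phi> (x - \<sigma> *\<^sub>R z) * gaussian 1 z)"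
proof -
  let ?F = "\<lambda>y. \<phi> y * gaussian \<sigma> (x - y)"
  have "(LINT y|lborel. ?F y)
      = (LINT y|density (distr lborel borel (\<lambda>z::'a. x + (- \<sigma>) *\<^sub>R z)) (\<lambda>_. ennreal (\<bar>- \<sigma>\<bar> ^ DIM('a))). ?F y)"
    using lborel_affine[of "- \<sigma>" x] \<sigma> by simp
  also have "\<dots> = (LINT z|lborel. \<sigma> ^ DIM('a) *\<^sub>R ?F (x + (- \<sigma>) *\<^sub>R z))"
    using \<sigma> by (subst integral_density, simp_all, subst integral_distr) auto
  also have "\<dots> = (LINT z|lborel. \<phi> (x - \<sigma> *\<^sub>R z) * gaussian 1 z)"
    by (rule Bochner_Integration.integral_cong) (auto simp: gaussian_rescale[OF \<sigma>, symmetric])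
  finally show ?thesis .
qed

lemma AE_not_box_boundary:
  "AE x in lborel. x \<notin> cbox a b - box a (b::'a::euclidean_space)"
proof (rule AE_not_in)
  have "cbox a b - box a b \<in> null_sets lebesgue"
    using negligible_frontier_interval[of a b] by (simp only: negligible_iff_null_sets)
  then show "cbox a b - box a b \<in> null_sets lborel"
    by (subst (asm) null_sets_completion_iff) auto
qed

text \<open>By Fubini, pairing \<open>f\<close> with the smoothed indicator equals integrating the
  smoothed \<open>f\<close> over the box, which gives \<open>0\<close>. As \<sigma> tends to
  \<open>0\<close> the smoothed indicator converges off the boundary of the box, a null set.\<close>

lemma integral_box_zero:
  fixes f :: "'a::euclidean_space \<Rightarrow> real"
  assumes f: "integrable lborel f" and F: "\<And>\<xi>. fourier (\<lambda>x. complex_of_real (f x)) \<xi> = 0"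
  shows "(LINT x|lborel. f x * indicator (box a b) x) = 0"
proof -
  note [measurable] = borel_measurable_integrable[OF f]
  let ?\<phi> = "indicator (box a b) :: 'a \<Rightarrow> real"
  define P where "P \<sigma> x = (LINT z|lborel. ?\<phi> (x - \<sigma> *\<^sub>R z) * gaussian 1 z)" for \<sigma> :: real and x
  have g1: "integrable lborel (gaussian 1 :: 'a \<Rightarrow> real)" "(LINT z|lborel. gaussian 1 (z::'a)) = 1"
    using gaussian_integrable[of 1] by auto
  have intphi: "integrable lborel (\<lambda>z. ?\<phi> (x - \<sigma> *\<^sub>R z) * gaussian 1 z)" for \<sigma> x
    by (rule Bochner_Integration.integrable_bound[OF g1(1)])
       (auto intro!: AE_I2 simp: gaussian_nonneg indicator_def)
  have P01: "0 \<le> P \<sigma> x" "P \<sigma> x \<le> 1" for \<sigma> x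
  proof -
    show "0 \<le> P \<sigma> x" unfolding P_def by (rule integral_nonneg_AE) (auto simp: gaussian_nonneg)
    have "P \<sigma> x \<le> (LINT z|lborel. gaussian 1 (z::'a))" unfolding P_def
      by (rule integral_mono[OF intphi g1(1)]) (auto simp: gaussian_nonneg indicator_def)
    then show "P \<sigma> x \<le> 1" using g1 by simp
  qed
  have [measurable]: "P \<sigma> \<in> borel_measurable borel" for \<sigma> unfolding P_def by measurable
  have zero: "(LINT x|lborel. f x * P \<sigma> x) = 0" if \<sigma>: "\<sigma> > 0" for \<sigma>
  proof -
    let ?H = "\<lambda>(x, y). f x * (?\<phi> y * gaussian \<sigma> (x - y))"
    have gs: "integrable lborel (\<lambda>y. ?\<phi> y * gaussian \<sigma> (x - y))" for x
    proof -
      have "integrable lborel (\<lambda>y. indicator (box a b) y *\<^sub>R (1::real))"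
        using emeasure_lborel_box_finite[of a b] by auto
      then have "integrable lborel (\<lambda>y. ?\<phi> y * (1 / sqrt (2 * pi * \<sigma>\<^sup>2)) ^ DIM('a))"
        by (intro integrable_mult_left) simp
      then show ?thesis
        by (rule Bochner_Integration.integrable_bound)
           (auto intro!: AE_I2 simp: gaussian_eq indicator_def abs_mult mult_left_le)
    qed
    have inner: "(LINT y|lborel. ?\<phi> y * gaussian \<sigma> (x - y)) = P \<sigma> x" for x
      unfolding P_def by (rule gaussian_average[OF _ \<sigma>]) measurable
    have int: "integrable (lborel \<Otimes>\<^sub>M lborel) ?H"
    proof (rule lborel_pair.Fubini_integrable)
      have "(LINT y|lborel. norm (?H (x, y))) = \<bar>f x\<bar> * P \<sigma> x" for x
      proof -
        have "(LINT y|lborel. norm (?H (x, y))) = (LINT y|lborel. \<bar>f x\<bar> * (?\<phi> y * gaussian \<sigma> (x - y)))"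
          by (rule Bochner_Integration.integral_cong) (auto simp: abs_mult gaussian_nonneg)
        then show ?thesis by (simp add: inner)
      qed
      moreover have "integrable lborel (\<lambda>x. \<bar>f x\<bar> * P \<sigma> x)"
        by (rule Bochner_Integration.integrable_bound[OF f])
           (use P01 in \<open>auto intro!: AE_I2 simp: abs_mult mult_left_le\<close>)
      ultimately show "integrable lborel (\<lambda>x. LINT y|lborel. norm (?H (x, y)))" by simp
      show "AE x in lborel. integrable lborel (\<lambda>y. ?H (x, y))" using gs by auto
    qed measurable
    have "(LINT x|lborel. f x * P \<sigma> x) = (LINT x|lborel. LINT y|lborel. ?H (x, y))"
      by (simp add: inner)
    also have "\<dots> = (LINT y|lborel. LINT x|lborel. ?H (x, y))"
      using lborel_pair.Fubini_integral[of "\<lambda>x y. ?H (x, y)"] int by simp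
    also have "\<dots> = (LINT y|lborel. ?\<phi> y * (LINT x|lborel. f x * gaussian \<sigma> (x - y)))"
      by (subst integral_mult_right_zero[symmetric]) (simp add: mult_ac)
    also have "\<dots> = 0" by (simp add: gaussian_smoothing_zero[OF f F \<sigma>])
    finally show ?thesis .
  qed
  let ?s = "\<lambda>n. 1 / real (Suc n)"
  have s0: "?s \<longlonglongrightarrow> 0" by (intro LIMSEQ_Suc lim_1_over_n)
  have Plim: "(\<lambda>n. P (?s n) x) \<longlonglongrightarrow> ?\<phi> x" if x: "x \<notin> cbox a b - box a b" for x
  proof -
    have "(\<lambda>n. P (?s n) x) \<longlonglongrightarrow> (LINT z|lborel. ?\<phi> x * gaussian 1 (z::'a))"
      unfolding P_def
    proof (rule integral_dominated_convergence[OF _ _ g1(1)])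
      show "AE z in lborel. (\<lambda>n. ?\<phi> (x - ?s n *\<^sub>R z) * gaussian 1 z) \<longlonglongrightarrow> ?\<phi> x * gaussian 1 z"
      proof (rule AE_I2, rule tendsto_mult[OF _ tendsto_const], rule tendsto_eventually)
        fix z :: 'a
        have "(\<lambda>n. x - ?s n *\<^sub>R z) \<longlonglongrightarrow> x - 0 *\<^sub>R z"
          by (intro tendsto_diff tendsto_scaleR tendsto_const s0)
        then have lim: "(\<lambda>n. x - ?s n *\<^sub>R z) \<longlonglongrightarrow> x" by simp
        show "\<forall>\<^sub>F n in sequentially. ?\<phi> (x - ?s n *\<^sub>R z) = ?\<phi> x"
        proof (cases "x \<in> box a b")
          case True
          show ?thesis
            by (rule eventually_mono[OF topological_tendstoD[OF lim open_box True]]) (use True in auto)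
        next
          case False
          then have "x \<in> - cbox a b" using x by auto
          from topological_tendstoD[OF lim _ this] have "\<forall>\<^sub>F n in sequentially. x - ?s n *\<^sub>R z \<in> - cbox a b"
            by (simp add: open_Compl closed_cbox)
          then show ?thesis
            by (rule eventually_mono) (use False box_subset_cbox[of a b] in \<open>auto simp: indicator_def\<close>)
        qed
      qed
      show "AE z in lborel. norm (?\<phi> (x - ?s n *\<^sub>R z) * gaussian 1 z) \<le> gaussian 1 z" for n
        by (rule AE_I2) (auto simp: indicator_def gaussian_nonneg)
    qed measurable
    then show ?thesis using g1(2) by simp
  qed
  have "(\<lambda>n. LINT x|lborel. f x * P (?s n) x) \<longlonglongrightarrow> (LINT x|lborel. f x * ?\<phi> x)"
  proof (rule integral_dominated_convergence[where w="\<lambda>x. \<bar>f x\<bar>"])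
    show "AE x in lborel. (\<lambda>n. f x * P (?s n) x) \<longlonglongrightarrow> f x * ?\<phi> x"
      using AE_not_box_boundary[of a b] by eventually_elim (intro tendsto_mult tendsto_const Plim)
    show "AE x in lborel. norm (f x * P (?s n) x) \<le> \<bar>f x\<bar>" for n
      using P01 by (intro AE_I2) (auto simp: abs_mult mult_left_le)
  qed (use f in auto)
  moreover have "(\<lambda>n. LINT x|lborel. f x * P (?s n) x) = (\<lambda>n. 0)" using zero by auto
  ultimately show ?thesis using LIMSEQ_unique[OF _ tendsto_const] by metis
qed

text \<open>Positive and negative part of \<open>f\<close> have equal integrals over every box, and
  boxes generate the Borel sets, so the two measures coincide and so do their densities. Since
  \<open>ennreal\<close> sends negative numbers to \<open>0\<close>,
  \<open>ennreal (f x) = ennreal (- f x)\<close> leaves only \<open>f x = 0\<close>.\<close>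

lemma fourier_zero_AE:
  fixes f :: "'a::euclidean_space \<Rightarrow> real"
  assumes f: "integrable lborel f" and F: "\<And>\<xi>. fourier (\<lambda>x. complex_of_real (f x)) \<xi> = 0"
  shows "AE x in lborel. f x = 0"
proof -
  note [measurable] = borel_measurable_integrable[OF f]
  let ?M = "density lborel (\<lambda>x. ennreal (f x))" and ?N = "density lborel (\<lambda>x. ennreal (- f x))"
  have pos: "integrable lborel (\<lambda>x. max 0 (f x) * indicator (box a b) x)"
    and neg: "integrable lborel (\<lambda>x. max 0 (- f x) * indicator (box a b) x)" for a b :: 'a
    by (rule Bochner_Integration.integrable_bound[OF f]; auto simp: indicator_def)+
  have emM: "emeasure ?M (box a b) = ennreal (LINT x|lborel. max 0 (f x) * indicator (box a b) x)"
    and emN: "emeasure ?N (box a b) = ennreal (LINT x|lborel. max 0 (- f x) * indicator (box a b) x)" for a b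
    by (subst emeasure_density; (simp; fail)?; subst nn_integral_eq_integral[OF pos, symmetric] nn_integral_eq_integral[OF neg, symmetric];
        auto simp: indicator_def max_def ennreal_neg intro!: nn_integral_cong)+
  have "?M = ?N"
  proof (rule measure_eqI_generator_eq)
    let ?E = "range (\<lambda>(a, b). box a b::'a set)"
    show "Int_stable ?E" by (auto simp: Int_stable_def box_Int_box)
    show "?E \<subseteq> Pow UNIV" "sets ?M = sigma_sets UNIV ?E" "sets ?N = sigma_sets UNIV ?E"
      by (simp_all add: borel_eq_box)
    let ?A = "\<lambda>n::nat. box (- (real n *\<^sub>R One)) (real n *\<^sub>R One) :: 'a set"
    show "range ?A \<subseteq> ?E" "(\<Union>i. ?A i) = UNIV" unfolding UN_box_eq_UNIV by auto
    show "emeasure ?M (?A i) \<noteq> \<infinity>" for i unfolding emM by simp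
    fix X assume "X \<in> ?E"
    then obtain a b where X: "X = box a b" by auto
    have "(LINT x|lborel. max 0 (f x) * indicator (box a b) x) - (LINT x|lborel. max 0 (- f x) * indicator (box a b) x)
        = (LINT x|lborel. max 0 (f x) * indicator (box a b) x - max 0 (- f x) * indicator (box a b) x)"
      by (rule Bochner_Integration.integral_diff[symmetric, OF pos neg])
    also have "\<dots> = (LINT x|lborel. f x * indicator (box a b) x)"
      by (rule Bochner_Integration.integral_cong) (auto simp: indicator_def)
    also have "\<dots> = 0" by (rule integral_box_zero[OF f F])
    finally show "emeasure ?M X = emeasure ?N X" unfolding X emM emN by simp
  qed
  from sigma_finite_measure.density_unique[OF sigma_finite_lborel _ _ this]
  have "AE x in lborel. ennreal (f x) = ennreal (- f x)" by auto
  then show ?thesis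
    by eventually_elim (metis ennreal_eq_0_iff ennreal_inj linear neg_0_le_iff_le neg_equal_0_iff_equal neg_le_0_iff_le order_antisym)
qed

lemma fourier_unique:
  fixes f g :: "'a::euclidean_space \<Rightarrow> real"
  assumes f: "integrable lborel f" and g: "integrable lborel g"
    and F: "\<And>\<xi>. fourier (\<lambda>x. complex_of_real (f x)) \<xi> = fourier (\<lambda>x. complex_of_real (g x)) \<xi>"
  shows "AE x in lborel. f x = g x"
proof -
  have i: "integrable lborel (\<lambda>x. exp (- (\<i> * complex_of_real (x \<bullet> \<xi>))) * complex_of_real (h x))"
    if "integrable lborel h" for h :: "'a \<Rightarrow> real" and \<xi>
    by (rule Bochner_Integration.integrable_bound[OF that]) (use that in \<open>auto simp: norm_mult\<close>)
  have "AE x in lborel. f x - g x = 0"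
  proof (rule fourier_zero_AE)
    show "integrable lborel (\<lambda>x. f x - g x)" using f g by simp
    show "fourier (\<lambda>x. complex_of_real (f x - g x)) \<xi> = 0" for \<xi>
      using F[of \<xi>] i[OF f, of \<xi>] i[OF g, of \<xi>]
      by (simp add: fourier_def right_diff_distrib)
  qed
  then show ?thesis by simp
qed

section \<open>Subordination of the heat kernel\<close>

text \<open>On the unit interval \<open>y powr x\<close> tends to the indicator of
  \<open>y > 0\<close> as \<open>x\<close> tends to \<open>0\<close>, and to that of
  \<open>y = 1\<close> as \<open>x\<close> grows; the limits of \<open>f\<close> therefore read off
  the two boundary masses. An atom at \<open>y = 1\<close> would contribute a Dirac measure to the
  mixture instead of a Gaussian, one at \<open>y = 0\<close> a loss of mass.\<close>

lemma power_mixture_open_unit: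
  assumes N: "real_distribution N" and ae: "AE y in N. 0 \<le> y \<and> y \<le> 1"
    and fN: "\<And>x. x > 0 \<Longrightarrow> f x = (LINT y|N. y powr x)"
    and f0: "(f \<longlongrightarrow> 1) (at_right 0)" and finf: "(f \<longlongrightarrow> 0) at_top"
  shows "AE y in N. 0 < y \<and> y < 1"
proof -
  interpret real_distribution N by fact
  have p0: "(\<lambda>n. y powr (1 / real (Suc n))) \<longlonglongrightarrow> indicator {0<..} y" if "0 \<le> y" for y :: real
  proof (cases "y = 0")
    case False
    then have "(\<lambda>n. y powr (1 / real (Suc n))) \<longlonglongrightarrow> y powr 0"
      by (intro tendsto_powr tendsto_const LIMSEQ_Suc lim_1_over_n) auto
    then show ?thesis using False that by simp
  qed simp
  have p1: "(\<lambda>n. y powr real (Suc n)) \<longlonglongrightarrow> indicator {1} y" if "0 \<le> y" "y \<le> 1" for y :: real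
  proof (cases "y = 1")
    case False
    have "(\<lambda>n. y powr real (Suc n)) = (\<lambda>n. y ^ Suc n)"
    proof (cases "y = 0")
      case False
      then show ?thesis using that by (auto simp: powr_realpow simp del: of_nat_Suc power_Suc)
    qed auto
    moreover have "(\<lambda>n. y ^ Suc n) \<longlonglongrightarrow> 0" using that False by (intro LIMSEQ_Suc LIMSEQ_power_zero) auto
    ultimately show ?thesis using False by simp
  qed simp
  have "(\<lambda>n. LINT y|N. y powr (1 / real (Suc n))) \<longlonglongrightarrow> (LINT y|N. indicator {0<..} y)"
  proof (rule integral_dominated_convergence[where w="\<lambda>_. 1"])
    show "AE y in N. (\<lambda>n. y powr (1 / real (Suc n))) \<longlonglongrightarrow> indicator {0<..} y"
      using ae by (rule eventually_mono) (use p0 in auto)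
    show "AE y in N. norm (y powr (1 / real (Suc n))) \<le> 1" for n
      using ae by (rule eventually_mono) (auto simp: powr_le_one')
  qed auto
  moreover have "(\<lambda>n. LINT y|N. y powr (1 / real (Suc n))) = (\<lambda>n. f (1 / real (Suc n)))"
    using fN by (auto simp del: of_nat_Suc)
  moreover have "filterlim (\<lambda>n. 1 / real (Suc n)) (at_right 0) sequentially"
    by real_asymp
  then have "(\<lambda>n. f (1 / real (Suc n))) \<longlonglongrightarrow> 1" by (rule filterlim_compose[OF f0])
  ultimately have "prob {0<..} = 1" using LIMSEQ_unique by fastforce
  then have a: "AE y in N. y \<in> {0<..}" by (subst prob_eq_1[symmetric]) auto
  have "(\<lambda>n. LINT y|N. y powr (real (Suc n))) \<longlonglongrightarrow> (LINT y|N. indicator {1} y)"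
  proof (rule integral_dominated_convergence[where w="\<lambda>_. 1"])
    show "AE y in N. (\<lambda>n. y powr real (Suc n)) \<longlonglongrightarrow> indicator {1} y"
      using ae by (rule eventually_mono) (use p1 in auto)
    show "AE y in N. norm (y powr (real (Suc n))) \<le> 1" for n
      using ae by (rule eventually_mono) (auto simp: powr_le_one')
  qed auto
  moreover have "(\<lambda>n. LINT y|N. y powr (real (Suc n))) = (\<lambda>n. f (real (Suc n)))"
    using fN by (auto simp del: of_nat_Suc)
  moreover have "filterlim (\<lambda>n. real (Suc n)) at_top sequentially"
    by real_asymp
  then have "(\<lambda>n. f (real (Suc n))) \<longlonglongrightarrow> 0" by (rule filterlim_compose[OF finf])
  ultimately have "prob {1} = 0" using LIMSEQ_unique by fastforce
  then have b: "AE y in N. y \<notin> {1}" by (intro AE_not_in) (auto simp: null_sets_def emeasure_eq_measure)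
  show ?thesis using ae a b
  proof eventually_elim
    case (elim y)
    then show ?case by auto
  qed
qed

text \<open>The subordinated heat kernel: the weight \<open>y\<close> stands for \<open>exp (- r)\<close>, and the heat kernel
  at time \<open>r\<close> is the Gaussian with variance \<open>2 r = - 2 ln y\<close> in each coordinate.\<close>
lemma subordinated_gaussian:
  assumes pm: "power_mixture f" and f0: "(f \<longlongrightarrow> 1) (at_right 0)" and finf: "(f \<longlongrightarrow> 0) at_top"
  obtains q :: "'a::euclidean_space \<Rightarrow> real" where "\<And>x. 0 \<le> q x" "integrable lborel q"
    "\<And>\<xi>. \<xi> \<noteq> 0 \<Longrightarrow> fourier (\<lambda>x. complex_of_real (q x)) \<xi> = complex_of_real (f ((norm \<xi>)\<^sup>2))"
    "fourier (\<lambda>x. complex_of_real (q x)) 0 = 1"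
proof -
  obtain N where N: "real_distribution N" and ae: "AE y in N. 0 \<le> y \<and> y \<le> 1"
    and fN: "\<And>x. x > 0 \<Longrightarrow> f x = (LINT y|N. y powr x)"
    using pm unfolding power_mixture_def by blast
  interpret real_distribution N by fact
  have ae: "AE y in N. 0 < y \<and> y < 1" by (rule power_mixture_open_unit[OF N ae fN f0 finf])
  interpret P: pair_sigma_finite N "lborel :: 'a measure" ..
  define \<sigma> where "\<sigma> y = sqrt (- 2 * ln y)" for y :: real
  have \<sigma>: "\<sigma> y > 0" "(\<sigma> y)\<^sup>2 = - 2 * ln y" if "0 < y \<and> y < 1" for y using that by (auto simp: \<sigma>_def)
  have [measurable]: "(\<lambda>p. gaussian (\<sigma> (fst p)) (snd p :: 'a)) \<in> borel_measurable (N \<Otimes>\<^sub>M lborel)"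
    unfolding gaussian_def normal_density_def \<sigma>_def by measurable
  define e where "e \<xi> x = exp (- (\<i> * complex_of_real (x \<bullet> \<xi>)))" for \<xi> x :: 'a
  have [measurable]: "e \<xi> \<in> borel_measurable borel" for \<xi> unfolding e_def by measurable
  have ne: "norm (e \<xi> x) = 1" for \<xi> x by (simp add: e_def)
  have int: "integrable (N \<Otimes>\<^sub>M lborel) (\<lambda>(y, x). e \<xi> x * complex_of_real (gaussian (\<sigma> y) x))" for \<xi>
  proof (rule P.Fubini_integrable)
    have "AE y in N. (LINT x|lborel. norm (case (y, x::'a) of (y, x) \<Rightarrow> e \<xi> x * complex_of_real (gaussian (\<sigma> y) x))) = 1"
      using ae by (rule eventually_mono)
        (use gaussian_integrable(2)[OF \<sigma>(1)] in \<open>simp add: norm_mult ne abs_of_nonneg[OF gaussian_nonneg]\<close>)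
    then show "integrable N (\<lambda>y. LINT x|lborel. norm (case (y, x::'a) of (y, x) \<Rightarrow> e \<xi> x * complex_of_real (gaussian (\<sigma> y) x)))"
      by (subst integrable_cong_AE[where g="\<lambda>_. 1"]) (auto simp: split_beta)
    show "AE y in N. integrable lborel (\<lambda>x. case (y, x::'a) of (y, x) \<Rightarrow> e \<xi> x * complex_of_real (gaussian (\<sigma> y) x))"
      using ae by (rule eventually_mono) (use fourier_gaussian(2)[OF \<sigma>(1)] in \<open>simp add: e_def\<close>)
  qed (simp add: split_beta)
  have int': "integrable (N \<Otimes>\<^sub>M lborel) (\<lambda>(y, x::'a). gaussian (\<sigma> y) x)"
    using integrable_norm[OF int[of 0]] by (simp add: case_prod_beta' norm_mult ne abs_of_nonneg[OF gaussian_nonneg])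
  define q where "q x = (LINT y|N. gaussian (\<sigma> y) (x::'a))" for x
  have F: "fourier (\<lambda>x. complex_of_real (q x)) \<xi> = (LINT y|N. complex_of_real (y powr (norm \<xi>)\<^sup>2))" for \<xi>
  proof -
    have "fourier (\<lambda>x. complex_of_real (q x)) \<xi> = (LINT x|lborel. LINT y|N. e \<xi> x * complex_of_real (gaussian (\<sigma> y) x))"
      unfolding fourier_def q_def e_def[symmetric] by simp
    also have "\<dots> = (LINT y|N. LINT x|lborel. e \<xi> x * complex_of_real (gaussian (\<sigma> y) x))"
      by (rule P.Fubini_integral) (rule int)
    also have "\<dots> = (LINT y|N. complex_of_real (y powr (norm \<xi>)\<^sup>2))"
    proof (rule integral_cong_AE)
      show "AE y in N. (LINT x|lborel. e \<xi> x * complex_of_real (gaussian (\<sigma> y) x)) = complex_of_real (y powr (norm \<xi>)\<^sup>2)"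
        using ae
      proof (rule eventually_mono)
        fix y :: real assume y: "0 < y \<and> y < 1"
        have "(LINT x|lborel. e \<xi> x * complex_of_real (gaussian (\<sigma> y) x)) = complex_of_real (exp (- ((\<sigma> y)\<^sup>2 * (norm \<xi>)\<^sup>2) / 2))"
          using fourier_gaussian(1)[OF \<sigma>(1)[OF y], of \<xi>] by (simp add: fourier_def e_def)
        also have "\<dots> = complex_of_real (y powr (norm \<xi>)\<^sup>2)"
          unfolding \<sigma>(2)[OF y] using y by (simp add: powr_def mult.commute)
        finally show "(LINT x|lborel. e \<xi> x * complex_of_real (gaussian (\<sigma> y) x)) = complex_of_real (y powr (norm \<xi>)\<^sup>2)" .
      qed
      have [measurable]: "(\<lambda>(y, x). e \<xi> x * complex_of_real (gaussian (\<sigma> y) x)) \<in> borel_measurable (N \<Otimes>\<^sub>M lborel)"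
        using int by auto
      show "(\<lambda>y. LINT x|lborel. e \<xi> x * complex_of_real (gaussian (\<sigma> y) x)) \<in> borel_measurable N" by measurable
    qed measurable
    finally show ?thesis .
  qed
  show ?thesis
  proof (rule that[of q])
    show "0 \<le> q x" for x unfolding q_def by (rule integral_nonneg_AE) (simp add: gaussian_nonneg)
    show "integrable lborel q" unfolding q_def by (rule P.integrable_snd[OF int'])
    show "fourier (\<lambda>x. complex_of_real (q x)) \<xi> = complex_of_real (f ((norm \<xi>)\<^sup>2))" if "\<xi> \<noteq> 0" for \<xi>
      using that by (simp add: F fN)
    have "(LINT y|N. y powr 0) = (LINT y|N. 1)"
      by (rule integral_cong_AE) (use ae in \<open>auto elim!: eventually_mono simp del: AE_conj_iff\<close>)
    then have "(LINT y|N. y powr 0) = 1" using prob_space by simp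
    then show "fourier (\<lambda>x. complex_of_real (q x)) 0 = 1" by (simp add: F)
  qed
qed

section \<open>Moments and the fundamental solution\<close>

lemma one_minus_cos_le: "1 - cos y \<le> y\<^sup>2 / (2::real)"
proof -
  have "cos y = 1 - 2 * (sin (y/2))\<^sup>2" using cos_double_sin[of "y/2"] by simp
  moreover have "(sin (y/2))\<^sup>2 \<le> (y/2)\<^sup>2"
    using abs_sin_x_le_abs_x[of "y/2"] by (metis abs_le_square_iff)
  ultimately show ?thesis by (simp add: power2_eq_square)
qed

lemma one_minus_cos_limit: "(\<lambda>n. (1 - cos (y / real (Suc n))) / (1 / real (Suc n))\<^sup>2) \<longlonglongrightarrow> y\<^sup>2 / (2::real)"
  by real_asymp (simp add: power2_eq_square)

text \<open>Along the axis \<open>b\<close>, the real part of the transform turns the quotient of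
  \<open>F\<close> at \<open>h\<^sup>2\<close> into the integral of
  \<open>(1 - cos (h * (x \<bullet> b))) / h\<^sup>2\<close> against \<open>q\<close>, which tends
  to \<open>D\<close>. The integrand is at most its limit
  \<open>(x \<bullet> b)\<^sup>2 / 2 * q x\<close>. Integrability of this limit is not known
  beforehand, so Fatou provides it, and dominated convergence then gives equality.\<close>

lemma coordinate_second_moment:
  fixes q :: "'a::euclidean_space \<Rightarrow> real"
  assumes q: "integrable lborel q" "AE x in lborel. 0 \<le> q x"
    and F: "\<And>\<xi>. fourier (\<lambda>x. complex_of_real (q x)) \<xi> = complex_of_real (F ((norm \<xi>)\<^sup>2))" and F0: "F 0 = 1"
    and D: "\<And>\<nu>. \<nu> > 0 \<Longrightarrow> \<bar>(1 - F \<nu>) / \<nu> - D\<bar> \<le> K * \<nu>"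
    and b: "b \<in> Basis"
  shows "integrable lborel (\<lambda>x. (x \<bullet> b)\<^sup>2 * q x)" "(LINT x|lborel. (x \<bullet> b)\<^sup>2 * q x) = 2 * D"
proof -
  note [measurable] = borel_measurable_integrable[OF q(1)]
  let ?h = "\<lambda>n. 1 / real (Suc n)"
  define u where "u n x = (1 - cos ((x \<bullet> b) / real (Suc n))) / (?h n)\<^sup>2 * q x" for n x
  have [measurable]: "u n \<in> borel_measurable borel" for n unfolding u_def by measurable
  have icos: "integrable lborel (\<lambda>x. cos ((x \<bullet> b) * h) * q x)" for h
    by (rule Bochner_Integration.integrable_bound[OF q(1)])
       (auto intro!: AE_I2 mult_left_le_one_le simp: abs_mult)
  have iu: "integrable lborel (u n)" for n
  proof -
    have "integrable lborel (\<lambda>x. (q x - cos ((x \<bullet> b) * ?h n) * q x) / (?h n)\<^sup>2)"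
      using icos[of "?h n"] q(1) by (intro integrable_divide Bochner_Integration.integrable_diff) auto
    then show ?thesis unfolding u_def by (simp add: algebra_simps diff_divide_distrib)
  qed
  have reF: "(LINT x|lborel. cos ((x \<bullet> b) * h) * q x) = F (h\<^sup>2)" for h
  proof -
    have i: "integrable lborel (\<lambda>x. exp (- (\<i> * complex_of_real (x \<bullet> (h *\<^sub>R b)))) * complex_of_real (q x))"
      by (rule Bochner_Integration.integrable_bound[OF q(1)]) (auto simp: norm_mult)
    have "F (h\<^sup>2) = Re (fourier (\<lambda>x. complex_of_real (q x)) (h *\<^sub>R b))"
      using b by (simp add: F)
    also have "\<dots> = (LINT x|lborel. Re (exp (- (\<i> * complex_of_real (x \<bullet> (h *\<^sub>R b)))) * complex_of_real (q x)))"
      unfolding fourier_def by (rule integral_Re[OF i, symmetric])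
    also have "\<dots> = (LINT x|lborel. cos ((x \<bullet> b) * h) * q x)"
      by (rule Bochner_Integration.integral_cong) (auto simp: Re_exp mult.commute)
    finally show ?thesis by simp
  qed
  have Iu: "(LINT x|lborel. u n x) = (1 - F ((?h n)\<^sup>2)) / (?h n)\<^sup>2" for n
  proof -
    have "(LINT x|lborel. u n x) = (LINT x|lborel. (q x - cos ((x \<bullet> b) * ?h n) * q x) / (?h n)\<^sup>2)"
      unfolding u_def by (rule Bochner_Integration.integral_cong) (auto simp: algebra_simps diff_divide_distrib)
    also have "\<dots> = ((LINT x|lborel. q x) - F ((?h n)\<^sup>2)) / (?h n)\<^sup>2"
      using reF[of "?h n"] icos[of "?h n"] q(1) by simp
    also have "(LINT x|lborel. q x) = 1" using reF[of 0] F0 by simp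
    finally show ?thesis .
  qed
  have lim: "(\<lambda>n. LINT x|lborel. u n x) \<longlonglongrightarrow> D"
  proof -
    have "(\<lambda>n. K * (?h n)\<^sup>2) \<longlonglongrightarrow> 0" by real_asymp
    then have "(\<lambda>n. (LINT x|lborel. u n x) - D) \<longlonglongrightarrow> 0"
      by (rule Lim_null_comparison[rotated]) (use D in \<open>auto simp: Iu simp del: of_nat_Suc\<close>)
    then show ?thesis by (simp add: LIM_zero_iff)
  qed
  have ulim: "(\<lambda>n. u n x) \<longlonglongrightarrow> (x \<bullet> b)\<^sup>2 / 2 * q x" for x
    unfolding u_def by (intro tendsto_mult tendsto_const one_minus_cos_limit)
  have ule: "AE x in lborel. 0 \<le> u n x \<and> u n x \<le> (x \<bullet> b)\<^sup>2 / 2 * q x" for n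
    using q(2)
  proof eventually_elim
    case (elim x)
    have h: "(?h n)\<^sup>2 > 0" by simp
    have "(1 - cos ((x \<bullet> b) / real (Suc n))) / (?h n)\<^sup>2 \<le> ((x \<bullet> b) / real (Suc n))\<^sup>2 / 2 / (?h n)\<^sup>2"
      by (intro divide_right_mono one_minus_cos_le) simp
    also have "\<dots> = (x \<bullet> b)\<^sup>2 / 2" by (simp add: power_divide field_simps)
    finally have "(1 - cos ((x \<bullet> b) / real (Suc n))) / (?h n)\<^sup>2 * q x \<le> (x \<bullet> b)\<^sup>2 / 2 * q x"
      using elim by (rule mult_right_mono)
    then show ?case unfolding u_def using elim by simp
  qed
  have "(\<integral>\<^sup>+x. ennreal ((x \<bullet> b)\<^sup>2 / 2 * q x) \<partial>lborel) = (\<integral>\<^sup>+x. liminf (\<lambda>n. ennreal (u n x)) \<partial>lborel)"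
    by (intro nn_integral_cong lim_imp_Liminf[symmetric] tendsto_ennrealI ulim) simp
  also have "\<dots> \<le> liminf (\<lambda>n. \<integral>\<^sup>+x. ennreal (u n x) \<partial>lborel)"
    by (rule nn_integral_liminf) measurable
  also have "\<dots> = liminf (\<lambda>n. ennreal (LINT x|lborel. u n x))"
  proof -
    have "(\<integral>\<^sup>+x. ennreal (u n x) \<partial>lborel) = ennreal (LINT x|lborel. u n x)" for n
      by (rule nn_integral_eq_integral[OF iu]) (use ule[of n] in \<open>rule eventually_mono\<close>, simp)
    then show ?thesis by simp
  qed
  also have "\<dots> = ennreal D"
    by (intro lim_imp_Liminf tendsto_ennrealI lim) simp
  finally have fin: "(\<integral>\<^sup>+x. ennreal ((x \<bullet> b)\<^sup>2 / 2 * q x) \<partial>lborel) < \<infinity>"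
    by (rule le_less_trans) simp
  have int: "integrable lborel (\<lambda>x. (x \<bullet> b)\<^sup>2 / 2 * q x)"
    by (rule integrableI_nonneg) (use fin q(2) in \<open>auto elim!: eventually_mono\<close>)
  have "(\<lambda>n. LINT x|lborel. u n x) \<longlonglongrightarrow> (LINT x|lborel. (x \<bullet> b)\<^sup>2 / 2 * q x)"
  proof (rule integral_dominated_convergence[OF _ _ int])
    show "AE x in lborel. (\<lambda>n. u n x) \<longlonglongrightarrow> (x \<bullet> b)\<^sup>2 / 2 * q x" using ulim by simp
    show "AE x in lborel. norm (u n x) \<le> (x \<bullet> b)\<^sup>2 / 2 * q x" for n
      using ule[of n] by (rule eventually_mono) simp
  qed measurable
  then have "(LINT x|lborel. (x \<bullet> b)\<^sup>2 / 2 * q x) = D" using lim LIMSEQ_unique by blast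
  then show "(LINT x|lborel. (x \<bullet> b)\<^sup>2 * q x) = 2 * D"
    by (simp add: integral_divide_zero)
  show "integrable lborel (\<lambda>x. (x \<bullet> b)\<^sup>2 * q x)"
    using integrable_mult_right[OF int, of 2] by simp
qed

text \<open>The transform is radial, so every coordinate contributes the same \<open>2 * D\<close>;
  hence the dimension factor.\<close>

lemma second_moment:
  fixes q :: "'a::euclidean_space \<Rightarrow> real"
  assumes "integrable lborel q" "AE x in lborel. 0 \<le> q x"
    and "\<And>\<xi>. fourier (\<lambda>x. complex_of_real (q x)) \<xi> = complex_of_real (F ((norm \<xi>)\<^sup>2))" and "F 0 = 1"
    and "\<And>\<nu>. \<nu> > 0 \<Longrightarrow> \<bar>(1 - F \<nu>) / \<nu> - D\<bar> \<le> K * \<nu>"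
  shows "integrable lborel (\<lambda>x. (norm x)\<^sup>2 * q x)" "(LINT x|lborel. (norm x)\<^sup>2 * q x) = 2 * real DIM('a) * D"
proof -
  note c = coordinate_second_moment[OF assms]
  have eq: "(norm x)\<^sup>2 * q x = (\<Sum>b\<in>Basis. (x \<bullet> b)\<^sup>2 * q x)" for x
    unfolding power2_norm_eq_inner euclidean_inner[of x x] by (simp add: sum_distrib_right power2_eq_square)
  show "integrable lborel (\<lambda>x. (norm x)\<^sup>2 * q x)"
    unfolding eq by (intro Bochner_Integration.integrable_sum c(1))
  show "(LINT x|lborel. (norm x)\<^sup>2 * q x) = 2 * real DIM('a) * D"
    unfolding eq by (subst Bochner_Integration.integral_sum) (auto simp: c)
qed

text \<open>Only the law at each single time is prescribed, so the coordinate process on the product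
  of these laws suffices.\<close>

lemma independent_process_exists:
  fixes Q :: "real \<Rightarrow> 'a::euclidean_space \<Rightarrow> real"
  assumes "\<And>t. t > 0 \<Longrightarrow> integrable lborel (Q t)" "\<And>t. t > 0 \<Longrightarrow> AE x in lborel. 0 \<le> Q t x"
    "\<And>t. t > 0 \<Longrightarrow> (LINT x|lborel. Q t x) = 1"
  shows "\<exists>(M :: (real \<Rightarrow> 'a) measure) Y. prob_space M \<and> (\<forall>t>0. distributed M lborel (Y t) (\<lambda>x. ennreal (Q t x)))"
proof -
  \<comment> \<open>The product runs over all real times, so \<open>t \<le> 0\<close> needs some
    probability measure too; a Dirac measure fills in.\<close>
  define \<mu> where "\<mu> t = (if t > 0 then density lborel (\<lambda>x. ennreal (Q t x)) else return lborel 0)" for t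
  have prob: "prob_space (\<mu> t)" for t
  proof (cases "t > 0")
    case True
    have "emeasure (density lborel (\<lambda>x. ennreal (Q t x))) UNIV = (\<integral>\<^sup>+x. ennreal (Q t x) \<partial>lborel)"
      using assms(1)[OF True] by (subst emeasure_density) auto
    also have "\<dots> = 1" using nn_integral_eq_integral[OF assms(1,2)[OF True]] assms(3)[OF True] by simp
    finally show ?thesis using True by (auto simp: \<mu>_def intro!: prob_spaceI)
  qed (auto simp: \<mu>_def intro!: prob_space_return)
  show ?thesis
  proof (intro exI conjI allI impI)
    show "prob_space (PiM UNIV \<mu>)" by (rule prob_space_PiM[OF prob])
    fix t :: real assume t: "t > 0"
    have sets: "sets (\<mu> t) = sets lborel" using t by (simp add: \<mu>_def)
    have m: "(\<lambda>\<omega>. \<omega> t) \<in> PiM UNIV \<mu> \<rightarrow>\<^sub>M lborel"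
      by (subst measurable_cong_sets[OF refl sets, symmetric]) (rule measurable_component_singleton, simp)
    have "distr (PiM UNIV \<mu>) lborel (\<lambda>\<omega>. \<omega> t) = distr (PiM UNIV \<mu>) (\<mu> t) (\<lambda>\<omega>. \<omega> t)"
      by (rule distr_cong) (auto simp: sets)
    also have "\<dots> = \<mu> t" by (rule distr_PiM_component[OF prob]) simp
    finally show "distributed (PiM UNIV \<mu>) lborel (\<lambda>\<omega>. \<omega> t) (\<lambda>x. ennreal (Q t x))"
      using m t assms(1)[OF t] by (simp add: distributed_def \<mu>_def)
  qed
qed

context relaxation_kernel
begin

text \<open>The Gaussians supply the squared norm of \<xi>, so the exponent of the mixture is
  \<open>\<alpha> / 2\<close>, and \<open>\<alpha> \<le> 2\<close> becomes \<open>d \<le> 1\<close>.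
  The expansion at \<open>\<nu> = 0\<close> and the decay of order \<open>1 / \<nu>\<close> give the
  two limits required for subordination.\<close>

lemma fundamental_solution_exists:
  assumes \<alpha>: "0 < \<alpha>" "\<alpha> \<le> 2"
  shows "\<exists>Q :: real \<Rightarrow> real ^ 'n \<Rightarrow> real. fundamental_solution \<gamma> m \<alpha> Q \<and> (\<forall>t>0. \<forall>x. 0 \<le> Q t x)"
proof -
  have "\<exists>q :: real ^ 'n \<Rightarrow> real. (\<forall>x. 0 \<le> q x) \<and> integrable lborel q \<and>
      (\<forall>\<xi>. fourier (\<lambda>x. complex_of_real (q x)) \<xi> = complex_of_real (s_gamma \<gamma> m t (norm \<xi> powr \<alpha>)))" if t: "t > 0" for t
  proof -
    let ?f = "\<lambda>x. s_gamma \<gamma> m t (x powr (\<alpha> / 2))"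
    have d: "0 < \<alpha> / 2" "\<alpha> / 2 \<le> 1" using \<alpha> by auto
    obtain K where K: "\<And>\<nu>. \<nu> > 0 \<Longrightarrow> \<bar>(1 - s_gamma \<gamma> m t \<nu>) / \<nu> - (t + \<gamma> * conv (\<lambda>_. 1) m t)\<bar> \<le> K * \<nu>"
      using s_gamma_derivative_at_zero[OF t] by blast
    let ?D = "t + \<gamma> * conv (\<lambda>_. 1) m t"
    have "(?f \<longlongrightarrow> 1) (at_right 0)"
    proof -
      have x0: "((\<lambda>x. x powr (\<alpha> / 2)) \<longlongrightarrow> 0) (at_right 0)"
        using \<alpha> by (intro tendsto_zero_powrI[of _ _ _ "\<alpha>/2"] tendsto_const tendsto_ident_at) (auto simp: eventually_at_filter)
      have "((\<lambda>x. (\<bar>?D\<bar> + \<bar>K\<bar> * x powr (\<alpha> / 2)) * x powr (\<alpha> / 2)) \<longlongrightarrow> (\<bar>?D\<bar> + \<bar>K\<bar> * 0) * 0) (at_right 0)"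
        by (intro tendsto_intros x0)
      then have lim: "((\<lambda>x. (\<bar>?D\<bar> + \<bar>K\<bar> * x powr (\<alpha> / 2)) * x powr (\<alpha> / 2)) \<longlongrightarrow> 0) (at_right 0)" by simp
      have "((\<lambda>x. ?f x - 1) \<longlongrightarrow> 0) (at_right 0)"
      proof (rule Lim_null_comparison[OF _ lim])
        have "norm (?f x - 1) \<le> (\<bar>?D\<bar> + \<bar>K\<bar> * x powr (\<alpha> / 2)) * x powr (\<alpha> / 2)" if "x > 0" for x
        proof -
          let ?n = "x powr (\<alpha> / 2)"
          have n: "?n > 0" using that by simp
          have "\<bar>(1 - ?f x) / ?n\<bar> \<le> \<bar>?D\<bar> + \<bar>K\<bar> * ?n"
            using K[OF n] n mult_right_mono[of K "\<bar>K\<bar>" ?n] by linarith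
          then show ?thesis using n by (simp add: abs_divide pos_divide_le_eq abs_minus_commute)
        qed
        then show "\<forall>\<^sub>F x in at_right 0. norm (?f x - 1) \<le> (\<bar>?D\<bar> + \<bar>K\<bar> * x powr (\<alpha> / 2)) * x powr (\<alpha> / 2)"
          by (auto simp: eventually_at_filter)
      qed
      then show ?thesis by (simp add: LIM_zero_iff)
    qed
    moreover have "(?f \<longlongrightarrow> 0) at_top"
    proof -
      obtain K where K: "\<And>\<nu>. \<nu> \<ge> 0 \<Longrightarrow> \<nu> * s_gamma \<gamma> m t \<nu> \<le> K" using s_gamma_decay[OF t] by blast
      have "((\<lambda>x. K * x powr (- (\<alpha> / 2))) \<longlongrightarrow> K * 0) at_top"
        using \<alpha> by (intro tendsto_mult tendsto_const tendsto_neg_powr filterlim_ident) auto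
      then have lim: "((\<lambda>x. K * x powr (- (\<alpha> / 2))) \<longlongrightarrow> 0) at_top" by simp
      show ?thesis
      proof (rule Lim_null_comparison[OF _ lim])
        show "\<forall>\<^sub>F x in at_top. norm (?f x) \<le> K * x powr (- (\<alpha> / 2))"
          using eventually_gt_at_top[of 0]
        proof eventually_elim
          case (elim x)
          then have n: "x powr (\<alpha> / 2) > 0" by simp
          then show ?case
            using K[of "x powr (\<alpha> / 2)"] s_gamma_bounds(1)[of "x powr (\<alpha> / 2)" t] t
            by (simp add: powr_minus field_simps)
        qed
      qed
    qed
    ultimately obtain q :: "real ^ 'n \<Rightarrow> real" where q: "\<And>x. 0 \<le> q x" "integrable lborel q"
      "\<And>\<xi>. \<xi> \<noteq> 0 \<Longrightarrow> fourier (\<lambda>x. complex_of_real (q x)) \<xi> = complex_of_real (?f ((norm \<xi>)\<^sup>2))"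
      "fourier (\<lambda>x. complex_of_real (q x)) 0 = 1"
      using subordinated_gaussian[OF power_mixture_s_gamma[OF t d]] by metis
    have "fourier (\<lambda>x. complex_of_real (q x)) \<xi> = complex_of_real (s_gamma \<gamma> m t (norm \<xi> powr \<alpha>))" for \<xi>
    \<comment> \<open>A power mixture is specified only at positive arguments, so the frequency
      \<open>0\<close> relies on the total mass \<open>1\<close> and on
      \<open>s_gamma_zero\<close>.\<close>
    proof (cases "\<xi> = 0")
      case True
      then show ?thesis using q(4) s_gamma_zero[of t] t by simp
    next
      case False
      then have "((norm \<xi>)\<^sup>2) powr (\<alpha> / 2) = norm \<xi> powr \<alpha>"
        by (simp add: powr_powr flip: powr_numeral)
      then show ?thesis using q(3)[OF False] by simp
    qed
    then show ?thesis using q by blast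
  qed
  then obtain Q :: "real \<Rightarrow> real ^ 'n \<Rightarrow> real" where "\<And>t. t > 0 \<Longrightarrow> (\<forall>x. 0 \<le> Q t x) \<and> integrable lborel (Q t) \<and>
      (\<forall>\<xi>. fourier (\<lambda>x. complex_of_real (Q t x)) \<xi> = complex_of_real (s_gamma \<gamma> m t (norm \<xi> powr \<alpha>)))"
    by metis
  then show ?thesis unfolding fundamental_solution_def by blast
qed

text \<open>The transform determines \<open>Q t\<close> up to a null set, so \<open>Q t\<close>
  inherits its sign from the constructed solution; its integral is the transform at
  \<open>0\<close>.\<close>

lemma fundamental_solution_density:
  fixes Q :: "real \<Rightarrow> real ^ 'n \<Rightarrow> real"
  assumes \<alpha>: "0 < \<alpha>" "\<alpha> \<le> 2" and Q: "fundamental_solution \<gamma> m \<alpha> Q" and t: "t > 0"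
  shows "integrable lborel (Q t)" "AE x in lborel. 0 \<le> Q t x" "(LINT x|lborel. Q t x) = 1"
proof -
  obtain Q' :: "real \<Rightarrow> real ^ 'n \<Rightarrow> real" where Q': "fundamental_solution \<gamma> m \<alpha> Q'" "\<forall>t>0. \<forall>x. 0 \<le> Q' t x"
    using fundamental_solution_exists[OF \<alpha>] by blast
  show i: "integrable lborel (Q t)" using Q t by (simp add: fundamental_solution_def)
  have "AE x in lborel. Q t x = Q' t x"
    by (rule fourier_unique) (use Q Q' t in \<open>auto simp: fundamental_solution_def\<close>)
  then show "AE x in lborel. 0 \<le> Q t x" by eventually_elim (use Q' t in auto)
  have "complex_of_real (LINT x|lborel. Q t x) = fourier (\<lambda>x. complex_of_real (Q t x)) 0"
    by (simp add: fourier_def)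
  also have "\<dots> = 1" using Q t s_gamma_zero[of t] by (simp add: fundamental_solution_def)
  finally show "(LINT x|lborel. Q t x) = 1" by (simp only: of_real_eq_1_iff)
qed

lemma msd_fundamental_solution:
  fixes Q :: "real \<Rightarrow> real ^ 'n \<Rightarrow> real"
  assumes Q: "fundamental_solution \<gamma> m 2 Q" and t: "t > 0"
  shows "integrable lborel (\<lambda>x. (norm x)\<^sup>2 * Q t x)"
    "msd Q t = 2 * real CARD('n) * (t + \<gamma> * conv (\<lambda>_. 1) m t)"
proof -
  obtain K where K: "\<And>\<nu>. \<nu> > 0 \<Longrightarrow> \<bar>(1 - s_gamma \<gamma> m t \<nu>) / \<nu> - (t + \<gamma> * conv (\<lambda>_. 1) m t)\<bar> \<le> K * \<nu>"
    using s_gamma_derivative_at_zero[OF t] by blast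
  have F: "fourier (\<lambda>x. complex_of_real (Q t x)) \<xi> = complex_of_real (s_gamma \<gamma> m t ((norm \<xi>)\<^sup>2))" for \<xi>
    using Q t by (simp add: fundamental_solution_def)
  have z: "s_gamma \<gamma> m t 0 = 1" using s_gamma_zero t by simp
  note d = fundamental_solution_density[of 2, OF _ _ Q t]
  note M = second_moment[OF d(1) d(2) F z K]
  show "integrable lborel (\<lambda>x. (norm x)\<^sup>2 * Q t x)" using M(1) by simp
  show "msd Q t = 2 * real CARD('n) * (t + \<gamma> * conv (\<lambda>_. 1) m t)"
    unfolding msd_def using M(2) by simp
qed

end

theorem theorem2p1:
  fixes \<gamma> \<alpha> :: real and m :: "real \<Rightarrow> real"
  assumes "\<gamma> > 0" and "condition_H \<gamma> m" and "1 < \<alpha>" and "\<alpha> \<le> 2"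
  shows "(\<exists>Q :: real \<Rightarrow> real ^ 'n \<Rightarrow> real.
            fundamental_solution \<gamma> m \<alpha> Q \<and> (\<forall>t>0. \<forall>x. 0 \<le> Q t x)) \<and>
         (\<forall>Q :: real \<Rightarrow> real ^ 'n \<Rightarrow> real. fundamental_solution \<gamma> m \<alpha> Q \<longrightarrow>
            (\<forall>t>0. (AE x in lborel. 0 \<le> Q t x) \<and> (LINT x|lborel. Q t x) = 1) \<and>
            (\<exists>(M :: (real \<Rightarrow> real ^ 'n) measure) Y. prob_space M \<and>
               (\<forall>t>0. distributed M lborel (Y t) (\<lambda>x. ennreal (Q t x))))) \<and>
         (\<forall>Q :: real \<Rightarrow> real ^ 'n \<Rightarrow> real. fundamental_solution \<gamma> m 2 Q \<longrightarrow>
            (\<forall>t>0. integrable lborel (\<lambda>x. (norm x)\<^sup>2 * Q t x) \<and>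
               msd Q t = 2 * real CARD('n) * (t + \<gamma> * conv (\<lambda>_. 1) m t)))"
proof -
  obtain g where "relaxation_kernel \<gamma> m g" using condition_H_kernel[OF assms(2)] by blast
  then interpret relaxation_kernel \<gamma> m g .
  have \<alpha>: "0 < \<alpha>" "\<alpha> \<le> 2" using assms by auto
  show ?thesis
  proof (intro conjI allI impI)
    show "\<exists>Q :: real \<Rightarrow> real ^ 'n \<Rightarrow> real. fundamental_solution \<gamma> m \<alpha> Q \<and> (\<forall>t>0. \<forall>x. 0 \<le> Q t x)"
      by (rule fundamental_solution_exists[OF \<alpha>])
  next
    fix Q :: "real \<Rightarrow> real ^ 'n \<Rightarrow> real" and t :: real
    assume Q: "fundamental_solution \<gamma> m \<alpha> Q" and t: "t > 0"
    show "AE x in lborel. 0 \<le> Q t x" "(LINT x|lborel. Q t x) = 1"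
      by (rule fundamental_solution_density[OF \<alpha> Q t])+
  next
    fix Q :: "real \<Rightarrow> real ^ 'n \<Rightarrow> real"
    assume Q: "fundamental_solution \<gamma> m \<alpha> Q"
    show "\<exists>(M :: (real \<Rightarrow> real ^ 'n) measure) Y. prob_space M \<and>
        (\<forall>t>0. distributed M lborel (Y t) (\<lambda>x. ennreal (Q t x)))"
      by (rule independent_process_exists[OF fundamental_solution_density[OF \<alpha> Q]])
  next
    fix Q :: "real \<Rightarrow> real ^ 'n \<Rightarrow> real" and t :: real
    assume Q: "fundamental_solution \<gamma> m 2 Q" and t: "t > 0"
    show "integrable lborel (\<lambda>x. (norm x)\<^sup>2 * Q t x)"
      "msd Q t = 2 * real CARD('n) * (t + \<gamma> * conv (\<lambda>_. 1) m t)"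
      by (rule msd_fundamental_solution[OF Q t])+
  qed
qed

end
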